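(* Let $\mathcal{P}$ satisfy properties (a)–(f) and let $(P(n,t))_{t=0}^{N}$ be the $\mathcal{P}$-constrained random graph process. Let $h=h(n)$ be any function with $h(n)\to\infty$, let $t=t(n)\in[N]$ and $s=s(n)$. Then whp - $\mathrm{forb}(P(n,t))=O(hn^2/s)$ if $t=n/2-s$ with $s\gg n^{2/3}$; - $\mathrm{forb}(P(n,t))=O(hn^{4/3})$ if $t=n/2+s$ with $s=O(n^{2/3})$; - $\mathrm{forb}(P(n,t))=\Theta(s^2)$ if $t=n/2+s$ with $n^{2/3}\ll s\ll n$; - $\mathrm{forb}(P(n,t))=(\beta(c)^2+o(1))\,n^2/2$ if $t=cn/2$ for a constant $c>1$.
   Context: All graphs are vertex-labelled, simple and undirected. Let $\mathcal{P}$ be a class of graphs such that: (a) $\mathcal{P}$ is not the class of all graphs; (b) it contains all edgeless graphs; (c) it is closed under isomorphism; (d) it is closed under taking minors; (e) it is weakly addable, i.e. if $G\in\mathcal{P}$ and $u,v$ lie in different components of $G$ then $G+uv\in\mathcal{P}$; (f) if $G\in\mathcal{P}$ and $u,v$ are non-adjacent vertices in the same component of $G$ which is a tree, then $G+uv\in\mathcal{P}$. Let $N=\binom{n}{2}$. The $\mathcal{P}$-constrained random graph process: take a uniformly random ordering $e_1,\ldots,e_N$ of the edges of $K_n$; $P(n,0)$ is the empty graph on $[n]$; for $t\in[N]$, set $P(n,t)=P(n,t-1)+e_t$ if $P(n,t-1)+e_t\in\mathcal{P}$, and $P(n,t)=P(n,t-1)$ otherwise. For $H\in\mathcal{P}$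 on vertex set $[n]$, an edge $e\in E(K_n)\setminus E(H)$ is forbidden in $H$ if $H+e\notin\mathcal{P}$; $\mathrm{forb}(H)$ is the number of such edges. For $c>1$, $\beta(c)$ is the unique positive solution of $1-x=e^{-cx}$. "whp" means with probability tending to $1$ as $n\to\infty$; $a\ll b$ means $a=o(b)$. *)

theory Defs
  imports Complex_Main "HOL-Library.Landau_Symbols"
begin

text \<open>A graph is a pair (V, E) of a finite vertex set of labels (naturals) and a set of
  2-element subsets of V (simple, undirected, vertex-labelled).\<close>
type_synonym graph = "nat set \<times> nat set set"

definition is_graph :: "graph \<Rightarrow> bool" where
  "is_graph G \<longleftrightarrow> finite (fst G) \<and>
     snd G \<subseteq> {{u, v} | u v. u \<in> fst G \<and> v \<in> fst G \<and> u \<noteq> v}"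

definition add_edge :: "graph \<Rightarrow> nat \<Rightarrow> nat \<Rightarrow> graph" where
  "add_edge G u v = (fst G, insert {u, v} (snd G))"

definition induced :: "graph \<Rightarrow> nat set \<Rightarrow> graph" where
  "induced G S = (fst G \<inter> S, {e \<in> snd G. e \<subseteq> S})"

text \<open>One-step adjacency relation and reachability (paths) in G.\<close>
definition adj_rel :: "graph \<Rightarrow> (nat \<times> nat) set" where
  "adj_rel G = {(x, y). x \<in> fst G \<and> y \<in> fst G \<and> x \<noteq> y \<and> {x, y} \<in> snd G}"

definition connected_graph :: "graph \<Rightarrow> bool" where
  "connected_graph G \<longleftrightarrow> fst G \<noteq> {} \<and>
     (\<forall>x\<in>fst G. \<forall>y\<in>fst G. (x, y) \<in> (adj_rel G)\<^sup>*)"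

text \<open>Vertex set of the component of G containing u.\<close>
definition component :: "graph \<Rightarrow> nat \<Rightarrow> nat set" where
  "component G u = {v \<in> fst G. (u, v) \<in> (adj_rel G)\<^sup>*}"

definition same_component :: "graph \<Rightarrow> nat \<Rightarrow> nat \<Rightarrow> bool" where
  "same_component G u v \<longleftrightarrow> u \<in> fst G \<and> v \<in> fst G \<and> (u, v) \<in> (adj_rel G)\<^sup>*"

text \<open>Cycles: a list of at least 3 distinct vertices, cyclically consecutive ones adjacent.\<close>
definition is_cycle :: "graph \<Rightarrow> nat list \<Rightarrow> bool" where
  "is_cycle G vs \<longleftrightarrow> length vs \<ge> 3 \<and> distinct vs \<and> set vs \<subseteq> fst G \<and>
     (\<forall>i < length vs. {vs ! i, vs ! ((i + 1) mod length vs)} \<in> snd G)"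

definition acyclic_graph :: "graph \<Rightarrow> bool" where
  "acyclic_graph G \<longleftrightarrow> \<not> (\<exists>vs. is_cycle G vs)"

definition is_tree :: "graph \<Rightarrow> bool" where
  "is_tree G \<longleftrightarrow> connected_graph G \<and> acyclic_graph G"

definition graph_iso :: "graph \<Rightarrow> graph \<Rightarrow> bool" where
  "graph_iso G H \<longleftrightarrow> (\<exists>f. bij_betw f (fst G) (fst H) \<and>
     (\<forall>u\<in>fst G. \<forall>v\<in>fst G. {u, v} \<in> snd G \<longleftrightarrow> {f u, f v} \<in> snd H))"

text \<open>H is a minor of G: there is a minor model, i.e. disjoint nonempty branch sets in G,
  each inducing a connected subgraph, with an edge of G between the branch sets of any
  two adjacent vertices of H.\<close>
definition is_minor :: "graph \<Rightarrow> graph \<Rightarrow> bool" where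
  "is_minor H G \<longleftrightarrow> (\<exists>B :: nat \<Rightarrow> nat set.
     (\<forall>v\<in>fst H. B v \<subseteq> fst G \<and> connected_graph (induced G (B v))) \<and>
     (\<forall>u\<in>fst H. \<forall>v\<in>fst H. u \<noteq> v \<longrightarrow> B u \<inter> B v = {}) \<and>
     (\<forall>u\<in>fst H. \<forall>v\<in>fst H. {u, v} \<in> snd H \<longrightarrow> (\<exists>x\<in>B u. \<exists>y\<in>B v. {x, y} \<in> snd G)))"

text \<open>Properties (a)-(f) of the class \<P> (a class of graphs).\<close>
definition admissible_class :: "graph set \<Rightarrow> bool" where
  "admissible_class P \<longleftrightarrow>
     (\<forall>G\<in>P. is_graph G) \<and>
     (\<exists>G. is_graph G \<and> G \<notin> P) \<and>
     (\<forall>V. finite V \<longrightarrow> (V, {}) \<in> P) \<and>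
     (\<forall>G H. G \<in> P \<and> is_graph H \<and> graph_iso G H \<longrightarrow> H \<in> P) \<and>
     (\<forall>G H. G \<in> P \<and> is_graph H \<and> is_minor H G \<longrightarrow> H \<in> P) \<and>
     (\<forall>G u v. G \<in> P \<and> u \<in> fst G \<and> v \<in> fst G \<and> \<not> same_component G u v
          \<longrightarrow> add_edge G u v \<in> P) \<and>
     (\<forall>G u v. G \<in> P \<and> u \<in> fst G \<and> v \<in> fst G \<and> u \<noteq> v \<and> {u, v} \<notin> snd G \<and>
          same_component G u v \<and> is_tree (induced G (component G u))
          \<longrightarrow> add_edge G u v \<in> P)"

text \<open>Edges of K_n on vertex set [n] = {1..n}.\<close>
definition Kn_edges :: "nat \<Rightarrow> nat set set" where
  "Kn_edges n = {{u, v} | u v. u \<in> {1..n} \<and> v \<in> {1..n} \<and> u \<noteq> v}"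

text \<open>Orderings e_1,...,e_N of the edges of K_n (uniform distribution = counting measure).\<close>
definition orderings :: "nat \<Rightarrow> nat set list set" where
  "orderings n = {es. distinct es \<and> set es = Kn_edges n}"

definition proc_step :: "graph set \<Rightarrow> graph \<Rightarrow> nat set \<Rightarrow> graph" where
  "proc_step P G e = (if (fst G, insert e (snd G)) \<in> P then (fst G, insert e (snd G)) else G)"

text \<open>P(n,t) for the ordering es.\<close>
definition proc :: "graph set \<Rightarrow> nat \<Rightarrow> nat set list \<Rightarrow> nat \<Rightarrow> graph" where
  "proc P n es t = foldl (proc_step P) ({1..n}, {}) (take t es)"

definition forb :: "graph set \<Rightarrow> graph \<Rightarrow> nat" where
  "forb P H = card {e. (\<exists>u\<in>fst H. \<exists>v\<in>fst H. u \<noteq> v \<and> e = {u, v}) \<and> e \<notin> snd H \<and>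
                      (fst H, insert e (snd H)) \<notin> P}"

definition prob_ord :: "nat \<Rightarrow> (nat set list \<Rightarrow> bool) \<Rightarrow> real" where
  "prob_ord n Q = real (card {es \<in> orderings n. Q es}) / real (card (orderings n))"

text \<open>With high probability: probability tends to 1 as n \<rightarrow> \<infinity>.\<close>
definition whp :: "(nat \<Rightarrow> nat set list \<Rightarrow> bool) \<Rightarrow> bool" where
  "whp Q \<longleftrightarrow> (\<lambda>n. prob_ord n (Q n)) \<longlonglongrightarrow> 1"

definition beta :: "real \<Rightarrow> real" where
  "beta c = (THE x. x > 0 \<and> 1 - x = exp (- c * x))"

end

theory Submission
  imports Defs "HOL-Analysis.Analysis" "HOL-Combinatorics.Multiset_Permutations" "HOL-Real_Asymp.Real_Asymp"
begin

text \<open>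
  Because the class is weakly addable, the components of \<open>P(n,t)\<close> are those of the random graph
  \<open>G(n,t)\<close> formed by the first \<open>t\<close> edges, and a forbidden pair lies inside a component; so twice the
  number of forbidden pairs is at most \<open>\<Sum>\<^sub>v \<bar>C(v)\<bar>\<close>, the sum of the sizes of the components of the vertices \<open>v\<close>.

  Component sizes are controlled through the Laplace transform \<open>\<Sum>\<^sub>v exp (- l \<bar>C(v)\<bar>)\<close>.  In the
  binomial model its first two moments satisfy an exact recursion (expose the edges at one vertex,
  delete the vertex), and comparison with the fixed point equation \<open>f = exp (- l) (1 - p + p f)^n\<close> of a branching
  process gives its mean and a variance bound that is sharp down to the critical window.
  Monotonicity in the number of edges transfers the bounds to \<open>G(n,t)\<close>.

  For the lower bounds, cover most of the relevant vertices at an earlier time by connected pieces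
  of bounded size.  If many pairs of covered vertices were still open later, the edges arriving in between
  would make so many pairs of pieces adjacent that contracting the pieces leaves a
  graph of large average degree, hence (Mader) an excluded clique minor.
\<close>

section \<open>Random subsets and the component recursion\<close>

text \<open>The Laplace transform is bounded and truncates at scale \<open>1 / l\<close>:
  \<open>n\<close> minus it is, up to constants, the sum of \<open>min 1 (l * comp_size)\<close>
  over the vertices, so one statistic controls both the total size of the components below
  \<open>1 / l\<close> and the number of vertices above. Near \<open>n p = 1\<close>, with
  \<open>l = d^2\<close>, it has mean at most of order \<open>n d\<close> and variance at most of
  order \<open>n / d\<close>; Chebyshev is effective when \<open>n d^3\<close> is large, which is
  the edge of the window n^(2/3). Inside and below the window Markov and the slack \<open>h\<close>
  suffice. The obstacle in the lower bounds is a race. \<open>M\<close> pieces allow a = O(M)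
  adjacent pairs, which costs a factor 2^a, while the late edges gain an exponent of order (covered
  vertices)^2 (new edges) / n^2. Just above the window the pieces are components of size of order
  \<open>1 / d^2\<close> at time \<open>n / 2\<close>, with \<open>d = L s / n\<close>: O(n d^3) of
  them cover order \<open>n d\<close> vertices, so the cost is cubic in \<open>L\<close>, the gain
  quadratic, and a small \<open>L\<close> wins. A giant component is too large to be a piece; it is
  cut, by means of a degree bound, into pieces of at least \<open>m\<close> vertices for a large
  constant \<open>m\<close>, so that their number is a small multiple of \<open>n\<close>.\<close>

definition subset_mean :: "real \<Rightarrow> 'a set \<Rightarrow> ('a set \<Rightarrow> real) \<Rightarrow> real" where
  "subset_mean p S F = (\<Sum>X\<in>Pow S. p ^ card X * (1 - p) ^ card (S - X) * F X)"

text \<open>The mean of \<open>F\<close> under the binomial law Bin(k, p). Conditioning on one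
  trial, instead of an explicit sum, turns the later comparisons into inductions over
  trials.\<close>

primrec bin_mean :: "real \<Rightarrow> nat \<Rightarrow> (nat \<Rightarrow> real) \<Rightarrow> real" where
  "bin_mean p 0 F = F 0"
| "bin_mean p (Suc k) F = (1 - p) * bin_mean p k F + p * bin_mean p k (\<lambda>i. F (Suc i))"

lemma subset_mean_empty [simp]: "subset_mean p {} F = F {}"
  by (simp add: subset_mean_def)

lemma subset_mean_insert:
  assumes "finite S" "x \<notin> S"
  shows "subset_mean p (insert x S) F = (1 - p) * subset_mean p S F + p * subset_mean p S (\<lambda>X. F (insert x X))"
proof -
  have disj: "Pow S \<inter> insert x ` Pow S = {}" using assms by auto
  have inj: "inj_on (insert x) (Pow S)" using assms by (auto simp: inj_on_def insert_ident)
  have "subset_mean p (insert x S) F = (\<Sum>X\<in>Pow S. p ^ card X * (1 - p) ^ card (insert x S - X) * F X)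
     + (\<Sum>X\<in>insert x ` Pow S. p ^ card X * (1 - p) ^ card (insert x S - X) * F X)"
    unfolding subset_mean_def Pow_insert using assms disj by (intro sum.union_disjoint) auto
  also have "(\<Sum>X\<in>Pow S. p ^ card X * (1 - p) ^ card (insert x S - X) * F X) = (1 - p) * subset_mean p S F"
    unfolding subset_mean_def sum_distrib_left
  proof (rule sum.cong[OF refl])
    fix X assume "X \<in> Pow S"
    then have "insert x S - X = insert x (S - X)" "x \<notin> S - X" "finite (S - X)" using assms by auto
    then show "p ^ card X * (1 - p) ^ card (insert x S - X) * F X =
         (1 - p) * (p ^ card X * (1 - p) ^ card (S - X) * F X)" by simp
  qed
  also have "(\<Sum>X\<in>insert x ` Pow S. p ^ card X * (1 - p) ^ card (insert x S - X) * F X)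
     = p * subset_mean p S (\<lambda>X. F (insert x X))"
    unfolding subset_mean_def sum_distrib_left sum.reindex[OF inj]
  proof (rule sum.cong[OF refl])
    fix X assume "X \<in> Pow S"
    then have "insert x S - insert x X = S - X" "x \<notin> X" "finite X"
      using assms finite_subset by auto
    then show "((\<lambda>X. p ^ card X * (1 - p) ^ card (insert x S - X) * F X) \<circ> insert x) X =
         p * (p ^ card X * (1 - p) ^ card (S - X) * F (insert x X))" by simp
  qed
  finally show ?thesis .
qed

lemma subset_mean_cong: "(\<And>X. X \<subseteq> S \<Longrightarrow> F X = G X) \<Longrightarrow> subset_mean p S F = subset_mean p S G"
  unfolding subset_mean_def by (intro sum.cong) auto

lemma subset_mean_mono:
  assumes "0 \<le> p" "p \<le> 1" "\<And>X. X \<subseteq> S \<Longrightarrow> F X \<le> G X"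
  shows "subset_mean p S F \<le> subset_mean p S G"
  unfolding subset_mean_def using assms by (intro sum_mono mult_left_mono) auto

lemma subset_mean_const [simp]: "finite S \<Longrightarrow> subset_mean p S (\<lambda>_. c) = c"
  by (induction S rule: finite_induct) (auto simp: subset_mean_insert algebra_simps)

lemma subset_mean_add: "subset_mean p S (\<lambda>X. F X + G X) = subset_mean p S F + subset_mean p S G"
  by (simp add: subset_mean_def algebra_simps sum.distrib)

lemma subset_mean_diff: "subset_mean p S (\<lambda>X. F X - G X) = subset_mean p S F - subset_mean p S G"
  by (simp add: subset_mean_def algebra_simps sum_subtractf)

lemma subset_mean_cmult: "subset_mean p S (\<lambda>X. c * F X) = c * subset_mean p S F"
  by (simp add: subset_mean_def algebra_simps sum_distrib_left)

lemma subset_mean_sum: "subset_mean p S (\<lambda>X. \<Sum>i\<in>I. F i X) = (\<Sum>i\<in>I. subset_mean p S (F i))"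
  unfolding subset_mean_def sum_distrib_left by (rule sum.swap)

lemma subset_mean_union:
  assumes "finite S" "finite T" "S \<inter> T = {}"
  shows "subset_mean p (S \<union> T) F = subset_mean p S (\<lambda>X. subset_mean p T (\<lambda>Y. F (X \<union> Y)))"
  using assms(1,3)
proof (induction S arbitrary: F rule: finite_induct)
  case (insert x S)
  then have "subset_mean p (insert x S \<union> T) F = subset_mean p (insert x (S \<union> T)) F" by simp
  also have "\<dots> = (1 - p) * subset_mean p (S \<union> T) F + p * subset_mean p (S \<union> T) (\<lambda>X. F (insert x X))"
    using insert assms by (intro subset_mean_insert) auto
  finally show ?case using insert by (simp add: subset_mean_insert)
qed simp

lemma subset_mean_image:
  assumes "finite S" "inj_on g S"
  shows "subset_mean p (g ` S) F = subset_mean p S (\<lambda>X. F (g ` X))"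
  using assms
proof (induction S arbitrary: F rule: finite_induct)
  case (insert x S)
  then have "g x \<notin> g ` S" by auto
  then show ?case using insert by (simp add: subset_mean_insert)
qed simp

lemma subset_mean_card: "finite S \<Longrightarrow> subset_mean p S (\<lambda>X. F (card X)) = bin_mean p (card S) F"
proof (induction S arbitrary: F rule: finite_induct)
  case (insert x S)
  have "subset_mean p S (\<lambda>X. F (card (insert x X))) = subset_mean p S (\<lambda>X. F (Suc (card X)))"
    using insert(1,2) by (intro subset_mean_cong) (metis card_insert_disjoint finite_subset subsetD)
  then show ?case using insert insert.IH[of "\<lambda>i. F (Suc i)"] by (simp add: subset_mean_insert)
qed simp

lemma bin_mean_mono:
  assumes "0 \<le> p" "p \<le> 1" "\<And>i. i \<le> k \<Longrightarrow> F i \<le> G i"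
  shows "bin_mean p k F \<le> bin_mean p k G"
  using assms(3)
proof (induction k arbitrary: F G)
  case (Suc k)
  have "bin_mean p k F \<le> bin_mean p k G" "bin_mean p k (\<lambda>i. F (Suc i)) \<le> bin_mean p k (\<lambda>i. G (Suc i))"
    by (rule Suc.IH, rule Suc.prems, simp)+
  then show ?case using assms by (simp add: add_mono mult_left_mono)
qed simp

lemma bin_mean_const [simp]: "bin_mean p k (\<lambda>_. c) = c"
  by (induction k) (auto simp: algebra_simps)

lemma bin_mean_add: "bin_mean p k (\<lambda>i. F i + G i) = bin_mean p k F + bin_mean p k G"
  by (induction k arbitrary: F G) (auto simp: algebra_simps)

lemma bin_mean_cmult: "bin_mean p k (\<lambda>i. c * F i) = c * bin_mean p k F"
  by (induction k arbitrary: F) (auto simp: algebra_simps)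

lemma bin_mean_diff: "bin_mean p k (\<lambda>i. F i - G i) = bin_mean p k F - bin_mean p k G"
  using bin_mean_add[of p k F "\<lambda>i. -1 * G i"] bin_mean_cmult[of p k "-1" G] by simp

text \<open>The generating function of the binomial law; the shift \<open>j\<close> is what the
  induction needs, since a successful trial shifts \<open>F\<close> by one.\<close>

lemma bin_mean_power: "bin_mean p k (\<lambda>i. f ^ (j + i)) = f ^ j * (1 - p + p * f) ^ k"
proof (induction k arbitrary: j)
  case (Suc k)
  show ?case using Suc[of j] Suc[of "Suc j"] by (simp add: algebra_simps)
qed simp

text \<open>\<open>psi p l m j\<close> is the mean of \<open>exp (- l * \<bar>C\<bar>)\<close> for the union \<open>C\<close> of the components of \<open>j\<close> given
  vertices in the binomial random graph on \<open>m\<close> vertices; the recursion exposes the edges at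
  one of the \<open>j\<close> vertices and deletes it.\<close>

primrec psi :: "real \<Rightarrow> real \<Rightarrow> nat \<Rightarrow> nat \<Rightarrow> real" where
  "psi p l 0 j = 1"
| "psi p l (Suc m) j = (case j of 0 \<Rightarrow> 1 | Suc j' \<Rightarrow> exp (- l) * bin_mean p (m - j') (\<lambda>i. psi p l m (j' + i)))"

section \<open>The component recursion compared with the branching equation\<close>

lemma psi_0 [simp]: "psi p l m 0 = 1"
  by (cases m) auto

text \<open>\<open>fsub\<close> makes \<open>f\<close> a subsolution of the branching equation,
  hence a lower bound for the transform of one component. A subsolution, unlike the exact fixed
  point, can be chosen explicitly (\<open>1 - 4 * d\<close>, \<open>1 - x\<close>,
  \<open>0\<close>), and \<open>1 - f\<close> becomes the scale of all error terms.\<close>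

locale comp_rec =
  fixes p l f :: real and n :: nat
  assumes p0: "0 \<le> p" and p1: "p \<le> 1" and l0: "0 < l"
    and f0: "0 \<le> f" and f1: "f \<le> 1" and fsub: "f \<le> exp (- l) * (1 - p + p * f) ^ n"
begin

abbreviation "\<psi> \<equiv> psi p l"

text \<open>The third inequality closes the inductions below: an error proportional to
  \<open>l\<close>, incurred at each exposed vertex, is paid for by the discount factor
  \<open>exp (- l)\<close>.\<close>

lemma el: "0 < exp (- l)" "exp (- l) \<le> 1" "exp (- l) * l \<le> 1 - exp (- l)"
proof -
  have "1 + l \<le> exp l" by simp
  then have "exp (-l) * (1 + l) \<le> exp (-l) * exp l" by (intro mult_left_mono) auto
  then show "exp (- l) * l \<le> 1 - exp (- l)" by (simp add: exp_minus field_simps)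
qed (use l0 in auto)

lemma psi_bounds: "0 \<le> \<psi> m j" "\<psi> m j \<le> 1"
proof (induction m arbitrary: j)
  case (Suc m)
  { case 1
    show ?case
    proof (cases j)
      case (Suc j')
      have "bin_mean p (m - j') (\<lambda>_. 0) \<le> bin_mean p (m - j') (\<lambda>i. \<psi> m (j' + i))"
        using Suc.IH p0 p1 by (intro bin_mean_mono) auto
      then show ?thesis using Suc by simp
    qed simp
  next
    case 2
    show ?case
    proof (cases j)
      case (Suc j')
      have "bin_mean p (m - j') (\<lambda>i. \<psi> m (j' + i)) \<le> bin_mean p (m - j') (\<lambda>_. 1)"
        using Suc.IH p0 p1 by (intro bin_mean_mono) auto
      then have "exp (-l) * bin_mean p (m - j') (\<lambda>i. \<psi> m (j' + i)) \<le> exp (-l) * 1"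
        by (intro mult_left_mono) auto
      also have "\<dots> \<le> 1" using el by simp
      finally have "exp (-l) * bin_mean p (m - j') (\<lambda>i. \<psi> m (j' + i)) \<le> 1" .
      then show ?thesis using Suc by simp
    qed simp }
qed auto

lemma psi_le_exp: "j \<le> m \<Longrightarrow> \<psi> m j \<le> exp (- l * real j)"
proof (induction m arbitrary: j)
  case (Suc m)
  show ?case
  proof (cases j)
    case (Suc j')
    have "bin_mean p (m - j') (\<lambda>i. \<psi> m (j' + i)) \<le> bin_mean p (m - j') (\<lambda>_. exp (- l * real j'))"
    proof (rule bin_mean_mono[OF p0 p1])
      fix i assume "i \<le> m - j'"
      then have "\<psi> m (j' + i) \<le> exp (- l * real (j' + i))" using Suc.IH[of "j'+i"] Suc Suc.prems by simp
      also have "\<dots> \<le> exp (- l * real j')" using l0 by simp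
      finally show "\<psi> m (j' + i) \<le> exp (- l * real j')" .
    qed
    then have "exp (-l) * bin_mean p (m - j') (\<lambda>i. \<psi> m (j' + i)) \<le> exp (-l) * exp (- l * real j')"
      by simp
    also have "\<dots> = exp (- l * real j)" unfolding Suc exp_add[symmetric] by (simp add: algebra_simps)
    finally show ?thesis using Suc by simp
  qed simp
qed simp

text \<open>A further marked vertex only enlarges the union. Both sides expose the same vertex; the
  side with fewer marks has one more trial, and success in it produces exactly the mark that the
  other side already has.\<close>

lemma psi_Suc_le: "Suc j \<le> m \<Longrightarrow> \<psi> m (Suc j) \<le> \<psi> m j"
proof (induction m arbitrary: j)
  case (Suc m)
  show ?case
  proof (cases j)
    case 0 then show ?thesis using psi_bounds[of "Suc m" 1] by (simp del: psi.simps)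
  next
    case (Suc j')
    define k where "k = m - j"
    have k: "m - j' = Suc k" using Suc Suc.prems by (simp add: k_def)
    have "bin_mean p k (\<lambda>i. \<psi> m (j + i)) \<le> bin_mean p k (\<lambda>i. \<psi> m (j' + i))"
    proof (rule bin_mean_mono[OF p0 p1])
      fix i assume "i \<le> k"
      then show "\<psi> m (j + i) \<le> \<psi> m (j' + i)"
        using Suc.IH[of "j' + i"] Suc Suc.prems by (simp add: k_def)
    qed
    then have "(1 - p) * bin_mean p k (\<lambda>i. \<psi> m (j + i)) \<le> (1 - p) * bin_mean p k (\<lambda>i. \<psi> m (j' + i))"
      using p1 by (intro mult_left_mono) auto
    then have "bin_mean p k (\<lambda>i. \<psi> m (j + i)) \<le> bin_mean p (Suc k) (\<lambda>i. \<psi> m (j' + i))"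
      using Suc by (simp add: algebra_simps)
    then show ?thesis using Suc k by (simp add: k_def)
  qed
qed simp

lemma bin_mean_psi_antimono:
  assumes "j + Suc k \<le> m"
  shows "bin_mean p (Suc k) (\<lambda>i. \<psi> m (j + i)) \<le> bin_mean p k (\<lambda>i. \<psi> m (j + i))"
proof -
  have "bin_mean p k (\<lambda>i. \<psi> m (j + Suc i)) \<le> bin_mean p k (\<lambda>i. \<psi> m (j + i))"
    using assms by (intro bin_mean_mono[OF p0 p1]) (simp add: psi_Suc_le)
  then have "p * bin_mean p k (\<lambda>i. \<psi> m (j + Suc i)) \<le> p * bin_mean p k (\<lambda>i. \<psi> m (j + i))"
    using p0 by (intro mult_left_mono) auto
  then show ?thesis by (simp add: algebra_simps)
qed

lemma pf: "0 \<le> 1 - p + p * f" "1 - p + p * f \<le> 1"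
  using p0 p1 f0 f1 by (auto simp: mult_left_le)

text \<open>The counterpart of monotonicity: a further marked vertex costs at most the factor
  \<open>f\<close>. This is where the subsolution property enters.\<close>

lemma psi_Suc_ge: "Suc j \<le> m \<Longrightarrow> m \<le> n \<Longrightarrow> f * \<psi> m j \<le> \<psi> m (Suc j)"
proof (induction m arbitrary: j)
  case (Suc m)
  show ?case
  proof (cases j)
    case 0
    note Suc_IH = Suc.IH
    \<comment> \<open>Iterating the induction hypothesis at \<open>m\<close> over the number of
      marks replaces \<open>psi\<close> by a pure power, to which the generating function and
      \<open>fsub\<close> apply.\<close>
    have pw: "f ^ i \<le> \<psi> m i" if "i \<le> m" for i using that
    proof (induction i)
      case (Suc i)
      have "f ^ Suc i \<le> f * \<psi> m i" using Suc f0 by (simp add: mult_left_mono)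
      also have "\<dots> \<le> \<psi> m (Suc i)" using Suc.prems \<open>Suc m \<le> n\<close> by (intro Suc_IH) auto
      finally show ?case .
    qed simp
    have "f \<le> exp (- l) * (1 - p + p * f) ^ n" by (rule fsub)
    also have "\<dots> \<le> exp (- l) * (1 - p + p * f) ^ m"
      using Suc.prems pf by (intro mult_left_mono power_decreasing) auto
    also have "\<dots> = exp (- l) * bin_mean p m (\<lambda>i. f ^ i)" using bin_mean_power[of p m f 0] by simp
    also have "\<dots> \<le> exp (- l) * bin_mean p m (\<lambda>i. \<psi> m i)"
      using pw by (intro mult_left_mono bin_mean_mono[OF p0 p1]) auto
    finally show ?thesis using 0 by simp
  next
    case (Suc j')
    define k where "k = m - j"
    have k: "m - j' = Suc k" using Suc Suc.prems by (simp add: k_def)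
    have "f * \<psi> (Suc m) j = exp (-l) * (f * bin_mean p (Suc k) (\<lambda>i. \<psi> m (j' + i)))"
      using Suc k by (simp del: bin_mean.simps)
    also have "\<dots> \<le> exp (-l) * (f * bin_mean p k (\<lambda>i. \<psi> m (j' + i)))"
      using k Suc Suc.prems f0 by (intro mult_left_mono bin_mean_psi_antimono) auto
    also have "\<dots> = exp (-l) * bin_mean p k (\<lambda>i. f * \<psi> m (j' + i))" by (simp add: bin_mean_cmult)
    also have "\<dots> \<le> exp (-l) * bin_mean p k (\<lambda>i. \<psi> m (j + i))"
    proof (intro mult_left_mono bin_mean_mono[OF p0 p1])
      fix i assume "i \<le> k"
      then show "f * \<psi> m (j' + i) \<le> \<psi> m (j + i)"
        using Suc.IH[of "j' + i"] Suc Suc.prems by (simp add: k_def)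
    qed simp
    finally show ?thesis using k_def Suc by simp
  qed
qed simp

lemma psi_1_ge: "1 \<le> m \<Longrightarrow> m \<le> n \<Longrightarrow> f \<le> \<psi> m 1"
  using psi_Suc_ge[of 0 m] by simp

lemma psi_drop: assumes "Suc j \<le> m" "m \<le> n" shows "\<psi> m j - \<psi> m (Suc j) \<le> 1 - f"
proof -
  have "\<psi> m j - \<psi> m (Suc j) \<le> (1 - f) * \<psi> m j" using psi_Suc_ge[OF assms] by (simp add: algebra_simps)
  also have "\<dots> \<le> (1 - f) * 1" using f1 psi_bounds by (intro mult_left_mono) auto
  finally show ?thesis by simp
qed

text \<open>Each exposed vertex hits the extra vertex with probability \<open>p\<close>, and a hit
  lowers the mean by at most \<open>1 - f\<close>. The discounted number of exposures is at most
  \<open>(1 - psi) / l\<close>, which explains the bound; its shape reproduces itself under one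
  exposure because of \<open>el\<close>.\<close>

lemma psi_remove_vertex:
  "j \<le> m \<Longrightarrow> Suc m \<le> n \<Longrightarrow> \<psi> m j - \<psi> (Suc m) j \<le> p * (1 - f) / l * (1 - \<psi> m j)"
proof (induction m arbitrary: j)
  case (Suc m)
  define c where "c = p * (1 - f) / l"
  have c0: "0 \<le> c" and cl: "p * (1 - f) = c * l" using p0 f1 l0 by (auto simp: c_def)
  show ?case
  proof (cases j)
    case 0 then show ?thesis by (simp del: psi.simps)
  next
    case (Suc j')
    define k where "k = m - j'"
    have k: "Suc m - j' = Suc k" using Suc Suc.prems by (simp add: k_def)
    let ?H = "\<lambda>i. \<psi> m (j' + i)" and ?H' = "\<lambda>i. \<psi> (Suc m) (j' + i)"
    have s1: "\<psi> (Suc m) j = exp (-l) * bin_mean p k ?H" using Suc by (simp add: k_def)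
    have "\<psi> (Suc (Suc m)) j = exp (-l) * bin_mean p (Suc k) ?H'"
      using k Suc psi.simps(2)[of p l "Suc m" j] by simp
    \<comment> \<open>The extra vertex amounts to one extra trial, which is split off here; its
      effect is \<open>p\<close> times the drop caused by one more mark.\<close>
    also have "bin_mean p (Suc k) ?H' = bin_mean p k ?H' - p * bin_mean p k (\<lambda>i. ?H' i - ?H' (Suc i))"
      unfolding bin_mean_diff by (simp add: algebra_simps)
    finally have s2: "\<psi> (Suc (Suc m)) j = exp (-l) * (bin_mean p k ?H' - p * bin_mean p k (\<lambda>i. ?H' i - ?H' (Suc i)))" .
    have e1: "bin_mean p k (\<lambda>i. ?H' i - ?H' (Suc i)) \<le> bin_mean p k (\<lambda>_. 1 - f)"
    proof (rule bin_mean_mono[OF p0 p1])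
      fix i assume "i \<le> k"
      then show "?H' i - ?H' (Suc i) \<le> 1 - f"
        using psi_drop[of "j' + i" "Suc m"] Suc Suc.prems by (simp add: k_def del: psi.simps)
    qed
    have e2: "bin_mean p k (\<lambda>i. ?H i - ?H' i) \<le> bin_mean p k (\<lambda>i. c * (1 - ?H i))"
    proof (rule bin_mean_mono[OF p0 p1])
      fix i assume "i \<le> k"
      then show "?H i - ?H' i \<le> c * (1 - ?H i)"
        using Suc.IH[of "j' + i"] Suc Suc.prems by (simp add: k_def c_def del: psi.simps)
    qed
    have e3: "bin_mean p k (\<lambda>i. ?H i - ?H' i) = bin_mean p k ?H - bin_mean p k ?H'" by (rule bin_mean_diff)
    have e4: "bin_mean p k (\<lambda>i. c * (1 - ?H i)) = c - c * bin_mean p k ?H"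
      by (simp add: bin_mean_cmult bin_mean_diff algebra_simps)
    have "p * bin_mean p k (\<lambda>i. ?H' i - ?H' (Suc i)) \<le> p * (1 - f)" using e1 p0 by (intro mult_left_mono) auto
    then have "\<psi> (Suc m) j - \<psi> (Suc (Suc m)) j \<le> exp (-l) * (c - c * bin_mean p k ?H + c * l)"
      using cl
      unfolding s1 s2 right_diff_distrib[symmetric] using e2 e3 e4 by (intro mult_left_mono) auto
    also have "\<dots> = exp (-l) * c + c * (exp (-l) * l) - c * \<psi> (Suc m) j"
      unfolding s1 by (simp add: algebra_simps)
    also have "\<dots> \<le> exp (-l) * c + c * (1 - exp (-l)) - c * \<psi> (Suc m) j"
      using mult_left_mono[OF el(3) c0] by simp
    also have "\<dots> = c * (1 - \<psi> (Suc m) j)" by (simp add: algebra_simps del: psi.simps)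
    finally show ?thesis by (simp add: c_def)
  qed
qed simp

text \<open>The bound of \<open>psi_remove_vertex\<close> for a single marked vertex, where
  \<open>1 - psi\<close> is at most \<open>1 - f\<close>.\<close>

definition "L = p * (1 - f)\<^sup>2 / l"

lemma L0: "0 \<le> L" using p0 l0 by (simp add: L_def)

lemma psi_1_mono: 
  assumes "1 \<le> m" "m \<le> n" shows "\<psi> m 1 \<le> \<psi> n 1 + L * real (n - m)"
  using assms(2,1)
proof (induction rule: inc_induct)
  case (step m)
  have "\<psi> m 1 - \<psi> (Suc m) 1 \<le> p * (1 - f) / l * (1 - \<psi> m 1)"
    using step by (intro psi_remove_vertex) auto
  also have "\<dots> \<le> p * (1 - f) / l * (1 - f)"
    using step p0 f1 l0 psi_1_ge[of m] by (intro mult_left_mono) auto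
  also have "\<dots> = L" by (simp add: L_def power2_eq_square)
  finally have "\<psi> m 1 \<le> \<psi> (Suc m) 1 + L" by simp
  also have "\<dots> \<le> \<psi> n 1 + L * real (n - Suc m) + L" using step by simp
  also have "\<dots> = \<psi> n 1 + L * real (n - m)" using step by (simp add: algebra_simps of_nat_diff)
  finally show ?case .
qed simp

text \<open>Chosen so that \<open>\<alpha> * l\<close> pays, at each exposure, for the vertex lost
  from the pool (\<open>L\<close>) and for the chance of hitting the additional marked vertex
  (\<open>p * (1 - f)\<close>).\<close>

definition "\<alpha> = (L + p * (1 - f)) / l"

text \<open>A further marked vertex contributes almost independently, by nearly the factor
  \<open>psi n 1\<close>. The term with \<open>n - m\<close> accounts for the vertices deleted so
  far, and the term with \<open>\<alpha>\<close> for what is still to be exposed; the latter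
  reproduces itself as in \<open>psi_remove_vertex\<close>.\<close>

lemma psi_decorrelated:
  "Suc j \<le> m \<Longrightarrow> m \<le> n \<Longrightarrow> \<psi> m (Suc j) \<le> \<psi> n 1 * \<psi> m j + L * real (n - m) + \<alpha> * (1 - \<psi> m j)"
proof (induction m arbitrary: j)
  case (Suc m)
  show ?case
  proof (cases j)
    case 0 then show ?thesis using psi_1_mono[of "Suc m"] Suc.prems by (simp del: psi.simps)
  next
    case (Suc j')
    define k where "k = m - j"
    define a where "a = \<psi> n 1"
    have a: "0 \<le> a" "a \<le> 1" using psi_bounds by (auto simp: a_def)
    have k: "m - j' = Suc k" using Suc Suc.prems by (simp add: k_def)
    have al0: "0 \<le> \<alpha>" and all: "p * (1 - f) = \<alpha> * l - L" using L0 p0 f1 l0 by (auto simp: \<alpha>_def)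
    let ?H = "\<lambda>i. \<psi> m (j' + i)"
    have s1: "\<psi> (Suc m) (Suc j) = exp (-l) * bin_mean p k (\<lambda>i. ?H (Suc i))" using Suc by (simp add: k_def)
    have s2: "\<psi> (Suc m) j = exp (-l) * bin_mean p (Suc k) ?H" using Suc k by (simp del: bin_mean.simps)
    have "bin_mean p k (\<lambda>i. ?H (Suc i)) \<le> bin_mean p k (\<lambda>i. (a - \<alpha>) * ?H i + (L * real (n - m) + \<alpha>))"
    proof (rule bin_mean_mono[OF p0 p1])
      fix i assume "i \<le> k"
      then have "?H (Suc i) \<le> a * ?H i + L * real (n - m) + \<alpha> * (1 - ?H i)"
        using Suc.IH[of "j' + i"] Suc Suc.prems by (simp add: k_def a_def)
      then show "?H (Suc i) \<le> (a - \<alpha>) * ?H i + (L * real (n - m) + \<alpha>)" by (simp add: algebra_simps)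
    qed
    also have "\<dots> = (a - \<alpha>) * bin_mean p k ?H + (L * real (n - m) + \<alpha>)" by (simp add: bin_mean_add bin_mean_cmult)
    finally have e1: "bin_mean p k (\<lambda>i. ?H (Suc i)) \<le> (a - \<alpha>) * bin_mean p k ?H + (L * real (n - m) + \<alpha>)" .
    have d1: "bin_mean p (Suc k) ?H \<le> bin_mean p k ?H" using k Suc Suc.prems by (intro bin_mean_psi_antimono) auto
    have "bin_mean p k (\<lambda>i. ?H i - ?H (Suc i)) \<le> bin_mean p k (\<lambda>_. 1 - f)"
    proof (rule bin_mean_mono[OF p0 p1])
      fix i assume "i \<le> k"
      then show "?H i - ?H (Suc i) \<le> 1 - f"
        using psi_drop[of "j' + i" m] Suc Suc.prems by (simp add: k_def)
    qed
    then have "p * bin_mean p k (\<lambda>i. ?H i - ?H (Suc i)) \<le> p * (1 - f)" using p0 by (intro mult_left_mono) auto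
    then have d2: "bin_mean p k ?H - bin_mean p (Suc k) ?H \<le> p * (1 - f)" unfolding bin_mean_diff by (simp add: algebra_simps)
    \<comment> \<open>The coefficient \<open>a - \<alpha>\<close> may be negative, so the
      nonnegative difference between \<open>k\<close> and \<open>Suc k\<close> trials is bounded
      with coefficient 1 instead.\<close>
    have "(a - \<alpha>) * (bin_mean p k ?H - bin_mean p (Suc k) ?H) \<le> a * (bin_mean p k ?H - bin_mean p (Suc k) ?H)"
      using d1 al0 by (intro mult_right_mono) auto
    also have "\<dots> \<le> 1 * (bin_mean p k ?H - bin_mean p (Suc k) ?H)" using d1 a by (intro mult_right_mono) auto
    finally have d3: "(a - \<alpha>) * bin_mean p k ?H \<le> (a - \<alpha>) * bin_mean p (Suc k) ?H + p * (1 - f)"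
      using d2 by (simp add: algebra_simps)
    have LL: "L * real (n - m) = L * real (n - Suc m) + L"
      using Suc.prems by (simp add: algebra_simps of_nat_diff)
    have "\<psi> (Suc m) (Suc j) \<le> exp (-l) * ((a - \<alpha>) * bin_mean p (Suc k) ?H + p * (1 - f) + L * real (n - m) + \<alpha>)"
      unfolding s1 using e1 d3 by (intro mult_left_mono) auto
    also have "\<dots> = (a - \<alpha>) * \<psi> (Suc m) j + exp (-l) * \<alpha> + \<alpha> * (exp (-l) * l) + exp (-l) * (L * real (n - Suc m))"
      unfolding s2 LL all by (simp add: algebra_simps del: bin_mean.simps)
    also have "\<dots> \<le> (a - \<alpha>) * \<psi> (Suc m) j + exp (-l) * \<alpha> + \<alpha> * (1 - exp (-l)) + 1 * (L * real (n - Suc m))"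
      using el L0 al0 by (intro add_mono order.refl mult_left_mono mult_right_mono) auto
    also have "\<dots> = a * \<psi> (Suc m) j + L * real (n - Suc m) + \<alpha> * (1 - \<psi> (Suc m) j)"
      by (simp add: algebra_simps del: psi.simps)
    finally show ?thesis by (simp add: a_def)
  qed
qed simp

text \<open>Two vertices are nearly uncorrelated; multiplied by n^2 this error is the main part of
  the variance bound.\<close>

lemma psi_2_le:
  assumes "2 \<le> n" shows "\<psi> n 2 \<le> (\<psi> n 1)\<^sup>2 + \<alpha> * (1 - f)"
proof -
  have al0: "0 \<le> \<alpha>" using L0 p0 f1 l0 by (simp add: \<alpha>_def)
  have "\<psi> n 2 \<le> \<psi> n 1 * \<psi> n 1 + \<alpha> * (1 - \<psi> n 1)"
    using psi_decorrelated[of 1 n] assms by (simp add: numeral_2_eq_2)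
  also have "\<alpha> * (1 - \<psi> n 1) \<le> \<alpha> * (1 - f)" using al0 psi_1_ge[of n] assms by (intro mult_left_mono) auto
  finally show ?thesis by (simp add: power2_eq_square)
qed

text \<open>Here \<open>g\<close> is a supersolution for a pool of only \<open>n - K\<close>
  vertices. The factor \<open>exp (- l * real (n - m))\<close> is the discount of the vertices
  exposed so far. The correction term is optional stopping in algebraic form: discount times
  \<open>f ^ j\<close> is a submartingale, so one minus it can only decrease in mean, and it is at
  least 1/2 once \<open>K\<close> vertices are used up. Starting from one vertex it equals
  \<open>1 - f\<close>, so the truncation error stays proportional to \<open>1 - f\<close>.\<close>

lemma psi_upper_aux:
  assumes g0: "0 \<le> g" and g1: "g \<le> 1" and gsup: "exp (- l) * (1 - p + p * g) ^ (n - K) \<le> g"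
    and K: "exp (- l * real K) \<le> 1/2"
  shows "j \<le> m \<Longrightarrow> m \<le> n \<Longrightarrow> exp (- l * real (n - m)) * \<psi> m j \<le> 
     exp (- l * real (n - m)) * g ^ j + 2 * exp (- l * real K) * (1 - exp (- l * real (n - m)) * f ^ j)"
proof (induction m arbitrary: j)
  case 0
  have "f ^ 0 \<le> (1::real)" by simp
  have "exp (- l * real n) * 1 \<le> 1 * (1::real)" using l0 by (intro mult_mono) auto
  then show ?case using 0 by simp
next
  case (Suc m)
  have fle: "f \<le> exp (- l)"
  proof -
    have "exp (- l) * (1 - p + p * f) ^ n \<le> exp (-l) * 1" using pf by (intro mult_left_mono power_le_one) auto
    then show ?thesis using fsub by linarith
  qed
  define e where "e = exp (- l * real (n - Suc m))"
  have e: "0 < e" "e \<le> 1" using l0 by (auto simp: e_def)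
  have ee: "exp (- l * real (n - m)) = e * exp (-l)"
    using Suc.prems unfolding e_def exp_add[symmetric] by (simp add: of_nat_diff algebra_simps)
  show ?case
  proof (cases "n - Suc m + j > K")
    \<comment> \<open>More than \<open>K\<close> vertices are exposed or marked: the discounted left
      side is below \<open>exp (- l * real K)\<close>, and the correction term alone exceeds this,
      its bracket being at least 1/2.\<close>
    case True
    have "e * \<psi> (Suc m) j \<le> e * exp (- l * real j)"
      using Suc.prems e by (intro mult_left_mono psi_le_exp) auto
    also have "\<dots> = exp (- l * real (n - Suc m + j))" unfolding e_def exp_add[symmetric] by (simp add: algebra_simps)
    also have "\<dots> \<le> exp (- l * real K)" using True l0 by simp
    finally have 1: "e * \<psi> (Suc m) j \<le> exp (- l * real K)" .
    have "e * f ^ j \<le> e * exp (- l * real j)"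
      using e fle f0 power_mono[of f "exp (-l)" j] by (simp add: exp_of_nat_mult[symmetric] mult.commute)
    also have "\<dots> = exp (- l * real (n - Suc m + j))" unfolding e_def exp_add[symmetric] by (simp add: algebra_simps)
    also have "\<dots> \<le> exp (- l * real K)" using True l0 by simp
    finally have "e * f ^ j \<le> 1/2" using K by simp
    then have "2 * exp (- l * real K) * (1/2) \<le> 2 * exp (- l * real K) * (1 - e * f ^ j)"
      by (intro mult_left_mono) auto
    moreover have "0 \<le> e * g ^ j" using e g0 by simp
    ultimately show ?thesis using 1 unfolding e_def[symmetric] by linarith
  next
    case False
    show ?thesis
    proof (cases j)
      case 0
      then show ?thesis using e K unfolding e_def[symmetric] by (simp add: algebra_simps del: psi.simps)
    next
      case (Suc j')
      let ?k = "m - j'"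
      have k: "n - K \<le> ?k" "?k \<le> n" using Suc False Suc.prems by auto
      have pg: "0 \<le> 1 - p + p * g" "1 - p + p * g \<le> 1" using p0 p1 g0 g1 by (auto simp: mult_left_le)
      have "e * \<psi> (Suc m) j = bin_mean p ?k (\<lambda>i. exp (- l * real (n - m)) * \<psi> m (j' + i))"
        unfolding ee using Suc by (simp add: bin_mean_cmult)
      also have "\<dots> \<le> bin_mean p ?k (\<lambda>i. exp (- l * real (n - m)) * g ^ (j' + i) + 
           2 * exp (- l * real K) * (1 - exp (- l * real (n - m)) * f ^ (j' + i)))"
        using Suc Suc.prems by (intro bin_mean_mono[OF p0 p1] Suc.IH) auto
      also have "\<dots> = e * (g ^ j' * (exp (-l) * (1 - p + p * g) ^ ?k)) 
         + 2 * exp (- l * real K) * (1 - e * (f ^ j' * (exp (-l) * (1 - p + p * f) ^ ?k)))"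
        unfolding ee bin_mean_add bin_mean_cmult bin_mean_diff bin_mean_power bin_mean_const by (simp only: mult_ac)
      \<comment> \<open>At most \<open>K\<close> vertices are used up, so at least
        \<open>n - K\<close> trials remain and \<open>g\<close> is a supersolution; \<open>f\<close>
        stays a subsolution because fewer than \<open>n\<close> trials only raise its right
        side.\<close>
      also have "\<dots> \<le> e * (g ^ j' * g) + 2 * exp (- l * real K) * (1 - e * (f ^ j' * f))"
      proof -
        have "exp (-l) * (1 - p + p * g) ^ ?k \<le> exp (-l) * (1 - p + p * g) ^ (n - K)"
          using pg k by (intro mult_left_mono power_decreasing) auto
        then have 1: "exp (-l) * (1 - p + p * g) ^ ?k \<le> g" using gsup by linarith
        have "exp (-l) * (1 - p + p * f) ^ n \<le> exp (-l) * (1 - p + p * f) ^ ?k"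
          using pf k by (intro mult_left_mono power_decreasing) auto
        then have 2: "f \<le> exp (-l) * (1 - p + p * f) ^ ?k" using fsub by linarith
        show ?thesis using 1 2 e g0 f0
          by (intro add_mono mult_left_mono diff_left_mono) auto
      qed
      finally show ?thesis unfolding e_def[symmetric] Suc by (simp add: mult.commute del: psi.simps)
    qed
  qed
qed

lemma psi_1_le:
  assumes "0 \<le> g" "g \<le> 1" "exp (- l) * (1 - p + p * g) ^ (n - K) \<le> g"
    "exp (- l * real K) \<le> 1/2" "1 \<le> n"
  shows "\<psi> n 1 \<le> g + 2 * exp (- l * real K) * (1 - f)"
  using psi_upper_aux[OF assms(1-4), of 1 n] assms(5) by simp

end

section \<open>Components of the binomial random graph\<close>

definition pairs :: "nat set \<Rightarrow> nat set set" where
  "pairs V = {{u, v} | u v. u \<in> V \<and> v \<in> V \<and> u \<noteq> v}"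

definition edge_rel :: "nat set set \<Rightarrow> (nat \<times> nat) set" where
  "edge_rel E = {(x, y). {x, y} \<in> E}"

definition reach :: "nat set set \<Rightarrow> nat set \<Rightarrow> nat set" where
  "reach E A = (edge_rel E)\<^sup>* `` A"

lemma Kn_edges_eq: "Kn_edges n = pairs {1..n}"
  by (simp add: Kn_edges_def pairs_def)

lemma pairs_subset_Pow: "pairs V \<subseteq> Pow V"
  by (auto simp: pairs_def)

lemma finite_pairs [simp]: "finite V \<Longrightarrow> finite (pairs V)"
  using finite_subset[OF pairs_subset_Pow] by simp

lemma in_pairs_iff: "{x, y} \<in> pairs V \<longleftrightarrow> x \<in> V \<and> y \<in> V \<and> x \<noteq> y"
  by (auto simp: pairs_def doubleton_eq_iff)

lemma pairs_cases: "e \<in> pairs V \<Longrightarrow> (\<And>u v. e = {u, v} \<Longrightarrow> u \<in> V \<Longrightarrow> v \<in> V \<Longrightarrow> u \<noteq> v \<Longrightarrow> thesis) \<Longrightarrow> thesis"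
  by (auto simp: pairs_def)

lemma card_pairs: "finite V \<Longrightarrow> card (pairs V) = card V choose 2"
proof -
  assume "finite V"
  have "pairs V = {B. B \<subseteq> V \<and> card B = 2}" by (auto simp: pairs_def card_2_iff)
  then show ?thesis using n_subsets[OF \<open>finite V\<close>] by simp
qed

lemma pairs_insert: "w \<notin> V \<Longrightarrow> pairs (insert w V) = pairs V \<union> (\<lambda>x. {w, x}) ` V"
  by (auto simp: pairs_def)

lemma sym_erel: "sym (edge_rel E)"
  by (auto simp: sym_def edge_rel_def insert_commute)

lemma edge_rel_rtrancl_sym: "(x, y) \<in> (edge_rel E)\<^sup>* \<Longrightarrow> (y, x) \<in> (edge_rel E)\<^sup>*"
  using sym_rtrancl[OF sym_erel] by (auto simp: sym_def)

lemma reach_superset: "A \<subseteq> reach E A"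
  by (auto simp: reach_def)

lemma reach_mono: "E \<subseteq> E' \<Longrightarrow> A \<subseteq> A' \<Longrightarrow> reach E A \<subseteq> reach E' A'"
  unfolding reach_def by (intro Image_mono rtrancl_mono) (auto simp: edge_rel_def)

lemma reach_step: "x \<in> reach E A \<Longrightarrow> {x, y} \<in> E \<Longrightarrow> y \<in> reach E A"
  unfolding reach_def by (auto simp: edge_rel_def intro: rtrancl_into_rtrancl)

lemma reach_subset:
  assumes "A \<subseteq> R" "\<And>x y. x \<in> R \<Longrightarrow> {x, y} \<in> E \<Longrightarrow> y \<in> R"
  shows "reach E A \<subseteq> R"
proof -
  have "(edge_rel E)\<^sup>* `` R = R" using assms(2) by (intro Image_closed_trancl) (auto simp: edge_rel_def)
  then show ?thesis unfolding reach_def using Image_mono[OF order_refl assms(1), of "(edge_rel E)\<^sup>*"] by simp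
qed

lemma reach_subset_verts: "A \<subseteq> V \<Longrightarrow> E \<subseteq> pairs V \<Longrightarrow> reach E A \<subseteq> V"
  by (rule reach_subset) (use in_pairs_iff in auto)

lemma reach_empty [simp]: "reach E {} = {}"
  by (simp add: reach_def)

lemma reach_Un: "reach E (A \<union> B) = reach E A \<union> reach E B"
  by (auto simp: reach_def)

lemma reach_eq: "u \<in> reach E {v} \<Longrightarrow> reach E {u} = reach E {v}"
proof -
  assume "u \<in> reach E {v}"
  then have 1: "(v, u) \<in> (edge_rel E)\<^sup>*" by (simp add: reach_def)
  have 2: "(u, v) \<in> (edge_rel E)\<^sup>*" by (rule edge_rel_rtrancl_sym[OF 1])
  show ?thesis unfolding reach_def using rtrancl_trans[OF 1] rtrancl_trans[OF 2] by auto
qed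

text \<open>The graph identity behind the recursion: once \<open>w\<close> is marked, its edges to
  \<open>X\<close> merely mark \<open>X\<close> in the graph without \<open>w\<close>.\<close>

lemma reach_expose:
  assumes "w \<notin> V" "A \<subseteq> V" "X \<subseteq> V" "E \<subseteq> pairs V"
  shows "reach (E \<union> (\<lambda>x. {w, x}) ` X) (insert w A) = insert w (reach E (A \<union> X))" (is "reach ?E _ = ?R")
proof
  have A: "insert w A \<subseteq> reach ?E (insert w A)" by (rule reach_superset)
  have "X \<subseteq> reach ?E (insert w A)"
  proof
    fix x assume "x \<in> X"
    then have "{w, x} \<in> ?E" by blast
    with A show "x \<in> reach ?E (insert w A)" using reach_step[of w] by blast
  qed
  then have "A \<union> X \<subseteq> reach ?E (insert w A)" using A by blast
  then have "reach E (A \<union> X) \<subseteq> reach ?E (insert w A)"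
    by (rule reach_subset) (rule reach_step, assumption, blast)
  then show "?R \<subseteq> reach ?E (insert w A)" using A by blast
next
  have AX: "A \<union> X \<subseteq> reach E (A \<union> X)" by (rule reach_superset)
  show "reach ?E (insert w A) \<subseteq> ?R"
  proof (rule reach_subset)
    show "insert w A \<subseteq> ?R" using AX by blast
    fix x y assume x: "x \<in> ?R" and xy: "{x, y} \<in> ?E"
    from xy show "y \<in> ?R"
    proof
      assume xy: "{x, y} \<in> E"
      then have "{x, y} \<in> pairs V" using assms(4) by blast
      then have "x \<noteq> w" using assms(1) by (auto simp: in_pairs_iff)
      then show ?thesis using x xy reach_step[of x E "A \<union> X" y] by blast
    next
      assume "{x, y} \<in> (\<lambda>x. {w, x}) ` X"
      then have "y = w \<or> y \<in> X" by (auto simp: doubleton_eq_iff)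
      then show ?thesis using AX by blast
    qed
  qed
qed

lemma subset_mean_swap: "subset_mean p S (\<lambda>X. subset_mean p T (\<lambda>Y. G X Y)) = subset_mean p T (\<lambda>Y. subset_mean p S (\<lambda>X. G X Y))"
  unfolding subset_mean_def sum_distrib_left by (subst sum.swap) (simp add: mult_ac)

lemma subset_mean_reach:
  assumes "finite V" "A \<subseteq> V"
  shows "subset_mean p (pairs V) (\<lambda>E. exp (- l * real (card (reach E A)))) = psi p l (card V) (card A)"
  using assms
proof (induction "card V" arbitrary: V A)
  case 0
  then have "V = {}" "A = {}" by auto
  then show ?case by (simp add: pairs_def)
next
  case (Suc m)
  show ?case
  proof (cases "A = {}")
    case True then show ?thesis using Suc by simp
  next
    case False
    then obtain w where w: "w \<in> A" by blast
    define A' where "A' = A - {w}"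
    define V' where "V' = V - {w}"
    have *: "w \<notin> V'" "A' \<subseteq> V'" "A = insert w A'" "V = insert w V'" "w \<notin> A'" "finite V'" "finite A'"
      using Suc.prems w finite_subset[of A V] by (auto simp: A'_def V'_def)
    have cV: "card V' = m" using Suc.hyps(2) * by simp
    have cA: "card A = Suc (card A')" using * by simp
    have inj: "inj_on (\<lambda>x. {w, x}) V'" by (auto simp: inj_on_def doubleton_eq_iff)
    have "subset_mean p (pairs V) (\<lambda>E. exp (- l * real (card (reach E A))))
        = subset_mean p (pairs V') (\<lambda>E. subset_mean p ((\<lambda>x. {w, x}) ` V') (\<lambda>Y. exp (- l * real (card (reach (E \<union> Y) A)))))"
      unfolding *(4) pairs_insert[OF *(1)]
    proof (rule subset_mean_union)
      show "pairs V' \<inter> (\<lambda>x. {w, x}) ` V' = {}" using *(1) by (auto simp: in_pairs_iff)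
    qed (use *(6) in auto)
    also have "\<dots> = subset_mean p (pairs V') (\<lambda>E. subset_mean p V' (\<lambda>X. exp (-l) * exp (- l * real (card (reach E (A' \<union> X))))))"
      unfolding subset_mean_image[OF *(6) inj]
    proof (intro subset_mean_cong)
      fix E X assume EX: "E \<subseteq> pairs V'" "X \<subseteq> V'"
      have sub: "reach E (A' \<union> X) \<subseteq> V'" using EX * by (intro reach_subset_verts) auto
      then have "w \<notin> reach E (A' \<union> X)" "finite (reach E (A' \<union> X))" using * finite_subset by auto
      then have "card (reach (E \<union> (\<lambda>x. {w, x}) ` X) A) = Suc (card (reach E (A' \<union> X)))"
        unfolding *(3) reach_expose[OF *(1,2) EX(2,1)] by simp
      then show "exp (- l * real (card (reach (E \<union> (\<lambda>x. {w, x}) ` X) A))) =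
          exp (-l) * exp (- l * real (card (reach E (A' \<union> X))))"
        by (simp add: exp_add[symmetric] algebra_simps)
    qed
    also have "\<dots> = exp (-l) * subset_mean p V' (\<lambda>X. subset_mean p (pairs V') (\<lambda>E. exp (- l * real (card (reach E (A' \<union> X))))))"
      unfolding subset_mean_cmult by (simp only: subset_mean_swap[of p "pairs V'" V'])
    also have "subset_mean p V' (\<lambda>X. subset_mean p (pairs V') (\<lambda>E. exp (- l * real (card (reach E (A' \<union> X)))))) =
       subset_mean p V' (\<lambda>X. psi p l m (card (A' \<union> X)))"
    proof (rule subset_mean_cong)
      fix X assume "X \<subseteq> V'"
      then show "subset_mean p (pairs V') (\<lambda>E. exp (- l * real (card (reach E (A' \<union> X))))) = psi p l m (card (A' \<union> X))"
        using Suc.hyps(1)[of V' "A' \<union> X"] cV *(2,6) by simp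
    qed
    \<comment> \<open>Edges from \<open>w\<close> to vertices that are already marked change
      nothing, so these trials integrate out and only those outside \<open>A'\<close> count.\<close>
    also have "\<dots> = subset_mean p (A' \<union> (V' - A')) (\<lambda>X. psi p l m (card (A' \<union> X)))"
      using *(2) by (simp add: Un_absorb1)
    also have "\<dots> = subset_mean p A' (\<lambda>Y. subset_mean p (V' - A') (\<lambda>X. psi p l m (card A' + card X)))"
    proof (subst subset_mean_union)
      show "subset_mean p A' (\<lambda>Y. subset_mean p (V' - A') (\<lambda>X. psi p l m (card (A' \<union> (Y \<union> X))))) =
            subset_mean p A' (\<lambda>Y. subset_mean p (V' - A') (\<lambda>X. psi p l m (card A' + card X)))"
      proof (intro subset_mean_cong)
        fix Y X assume YX: "Y \<subseteq> A'" "X \<subseteq> V' - A'"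
        then have "A' \<union> (Y \<union> X) = A' \<union> X" by auto
        moreover have "card (A' \<union> X) = card A' + card X"
          using YX * finite_subset[of X V'] by (intro card_Un_disjoint) auto
        ultimately show "psi p l m (card (A' \<union> (Y \<union> X))) = psi p l m (card A' + card X)" by simp
      qed
    qed (use *(6,7) in auto)
    also have "\<dots> = bin_mean p (m - card A') (\<lambda>i. psi p l m (card A' + i))"
      using *(2,6,7) cV by (simp add: subset_mean_card[where F="\<lambda>i. psi p l m (card A' + i)"] card_Diff_subset)
    finally show ?thesis unfolding cA using Suc.hyps(2)[symmetric] by simp
  qed
qed

definition comp_laplace :: "real \<Rightarrow> nat \<Rightarrow> nat set set \<Rightarrow> real" where
  "comp_laplace l n E = (\<Sum>v\<in>{1..n}. exp (- l * real (card (reach E {v}))))"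

lemma EP_W: "subset_mean p (pairs {1..n}) (comp_laplace l n) = real n * psi p l n 1"
proof -
  have "subset_mean p (pairs {1..n}) (comp_laplace l n) = (\<Sum>v\<in>{1..n}. psi p l n 1)"
    unfolding comp_laplace_def subset_mean_sum using subset_mean_reach[of "{1..n}" "{_}" p l] by (intro sum.cong) simp_all
  then show ?thesis by simp
qed

lemma subset_mean_markov:
  assumes "0 \<le> p" "p \<le> 1" "0 < d" "\<And>X. X \<subseteq> S \<Longrightarrow> 0 \<le> F X" "\<And>X. X \<subseteq> S \<Longrightarrow> Q X \<Longrightarrow> d \<le> F X"
  shows "subset_mean p S (\<lambda>X. of_bool (Q X)) \<le> subset_mean p S F / d"
proof -
  have "subset_mean p S (\<lambda>X. of_bool (Q X)) \<le> subset_mean p S (\<lambda>X. 1 / d * F X)"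
  proof (rule subset_mean_mono[OF assms(1,2)])
    fix X assume X: "X \<subseteq> S"
    show "of_bool (Q X) \<le> 1 / d * F X"
      using assms(4)[OF X] assms(5)[OF X] assms(3) by (cases "Q X") (simp_all add: field_simps)
  qed
  then show ?thesis unfolding subset_mean_cmult by simp
qed

context comp_rec begin

text \<open>The size of a union is at most the sum of the sizes, so a product of two weights is at
  most the weight of the union of the two components, whose mean is \<open>psi n 2\<close>. The
  diagonal contributes at most \<open>n\<close>.\<close>

lemma EP_W_square:
  assumes "2 \<le> n"
  shows "subset_mean p (pairs {1..n}) (\<lambda>E. (comp_laplace l n E)\<^sup>2) \<le> real n + (real n)\<^sup>2 * \<psi> n 2"
proof -
  let ?V = "{1..n}"
  let ?F = "\<lambda>v u. subset_mean p (pairs ?V) (\<lambda>E. exp (- l * real (card (reach E {u, v}))))"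
  have "subset_mean p (pairs ?V) (\<lambda>E. (comp_laplace l n E)\<^sup>2) \<le> subset_mean p (pairs ?V) (\<lambda>E. \<Sum>v\<in>?V. \<Sum>u\<in>?V. exp (- l * real (card (reach E {u, v}))))"
  proof (rule subset_mean_mono[OF p0 p1])
    fix E assume "E \<subseteq> pairs ?V"
    have "exp (- l * real (card (reach E {u}))) * exp (- l * real (card (reach E {v}))) \<le> exp (- l * real (card (reach E {u, v})))" for u v
    proof -
      have "card (reach E {u, v}) \<le> card (reach E {u}) + card (reach E {v})"
        using reach_Un[of E "{u}" "{v}"] card_Un_le by (metis insert_is_Un)
      then have "l * real (card (reach E {u, v})) \<le> l * (real (card (reach E {u})) + real (card (reach E {v})))"
        using l0 by (intro mult_left_mono) auto
      then show ?thesis unfolding exp_add[symmetric] by (simp add: algebra_simps)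
    qed
    then show "(comp_laplace l n E)\<^sup>2 \<le> (\<Sum>v\<in>?V. \<Sum>u\<in>?V. exp (- l * real (card (reach E {u, v}))))"
      unfolding comp_laplace_def power2_eq_square sum_product by (intro sum_mono) (simp add: insert_commute)
  qed
  also have "\<dots> = (\<Sum>v\<in>?V. \<Sum>u\<in>?V. ?F v u)" unfolding subset_mean_sum ..
  also have "\<dots> \<le> (\<Sum>v\<in>?V. 1 + real n * \<psi> n 2)"
  proof (rule sum_mono)
    fix v assume v: "v \<in> ?V"
    have "(\<Sum>u\<in>?V. ?F v u) = ?F v v + (\<Sum>u\<in>?V - {v}. ?F v u)" using v by (simp add: sum.remove)
    also have "?F v v \<le> 1" using v subset_mean_reach[of ?V "{v}" p l] psi_bounds[of n 1] by simp
    also have "(\<Sum>u\<in>?V - {v}. ?F v u) = (\<Sum>u\<in>?V - {v}. \<psi> n 2)"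
    proof (rule sum.cong[OF refl])
      fix u assume u: "u \<in> ?V - {v}"
      then have "card {u, v} = 2" by simp
      then show "?F v u = \<psi> n 2" using subset_mean_reach[of ?V "{u, v}" p l] u v by simp
    qed
    also have "\<dots> \<le> real n * \<psi> n 2" using psi_bounds[of n 2] v by (simp add: mult_right_mono)
    finally show "(\<Sum>u\<in>?V. ?F v u) \<le> 1 + real n * \<psi> n 2" by simp
  qed
  also have "\<dots> = real n + (real n)\<^sup>2 * \<psi> n 2" by (simp add: algebra_simps power2_eq_square)
  finally show ?thesis .
qed

text \<open>Chebyshev's inequality. The squared mean cancels against the leading term of
  \<open>psi_2_le\<close>, leaving the diagonal and the correlation error.\<close>

lemma EP_W_deviation:
  assumes "2 \<le> n" "0 < d"
  shows "subset_mean p (pairs {1..n}) (\<lambda>E. of_bool (d \<le> \<bar>comp_laplace l n E - real n * \<psi> n 1\<bar>)) \<le>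
    (real n + (real n)\<^sup>2 * ((p * (1 - f)\<^sup>2 / l + p * (1 - f)) * (1 - f) / l)) / d\<^sup>2"
proof -
  let ?S = "pairs {1..n}"
  define \<mu> where "\<mu> = real n * \<psi> n 1"
  have "subset_mean p ?S (\<lambda>E. of_bool (d \<le> \<bar>comp_laplace l n E - \<mu>\<bar>)) \<le> subset_mean p ?S (\<lambda>E. (comp_laplace l n E - \<mu>)\<^sup>2) / d\<^sup>2"
  proof (rule subset_mean_markov[OF p0 p1])
    fix X assume "d \<le> \<bar>comp_laplace l n X - \<mu>\<bar>"
    then have "d\<^sup>2 \<le> \<bar>comp_laplace l n X - \<mu>\<bar>\<^sup>2" using assms by (intro power_mono) auto
    then show "d\<^sup>2 \<le> (comp_laplace l n X - \<mu>)\<^sup>2" by simp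
  qed (use assms in auto)
  also have "subset_mean p ?S (\<lambda>E. (comp_laplace l n E - \<mu>)\<^sup>2) = subset_mean p ?S (\<lambda>E. (comp_laplace l n E)\<^sup>2 + ((-2 * \<mu>) * comp_laplace l n E + \<mu>\<^sup>2))"
    by (simp add: power2_eq_square algebra_simps)
  also have "\<dots> = subset_mean p ?S (\<lambda>E. (comp_laplace l n E)\<^sup>2) - \<mu>\<^sup>2"
    unfolding subset_mean_add subset_mean_cmult EP_W by (simp add: \<mu>_def power2_eq_square)
  also have "\<dots> \<le> real n + (real n)\<^sup>2 * ((\<psi> n 1)\<^sup>2 + \<alpha> * (1 - f)) - \<mu>\<^sup>2"
    using EP_W_square[OF assms(1)] mult_left_mono[OF psi_2_le[OF assms(1)], of "(real n)\<^sup>2"] by simp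
  also have "\<dots> = real n + (real n)\<^sup>2 * (\<alpha> * (1 - f))" by (simp add: \<mu>_def power2_eq_square algebra_simps)
  finally show ?thesis by (simp add: \<mu>_def \<alpha>_def L_def divide_right_mono)
qed

end

section \<open>From the Laplace transform to large and small components\<close>

definition comp_size :: "nat set set \<Rightarrow> nat \<Rightarrow> nat" where
  "comp_size E v = card (reach E {v})"

text \<open>Collecting vertices instead of components makes the cardinality the total size of all
  components above the threshold.\<close>

definition big_comps :: "nat \<Rightarrow> real \<Rightarrow> nat set set \<Rightarrow> nat set" where
  "big_comps n k E = {v \<in> {1..n}. k \<le> real (comp_size E v)}"

lemma exp_lower: "0 \<le> z \<Longrightarrow> z \<le> 1 \<Longrightarrow> z / 2 \<le> 1 - exp (- z)" for z :: real
proof -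
  assume z: "0 \<le> z" "z \<le> 1"
  have "exp (- z) \<le> 1 / (1 + z)" using z exp_ge_add_one_self[of z] by (simp add: exp_minus field_simps)
  moreover have "1 / (1 + z) \<le> 1 - z / 2"
  proof -
    have "z * z \<le> z * 1" using z by (intro mult_left_mono) auto
    then show ?thesis using z by (simp add: field_simps)
  qed
  ultimately show ?thesis by simp
qed

text \<open>In the lemma names below, \<open>X\<close> stands for this difference. A vertex
  contributes at least a constant if its component has \<open>1 / l\<close> or more vertices, and
  otherwise at least half of \<open>l\<close> times the component size; it never contributes more
  than \<open>min 1 (l * comp_size)\<close>.\<close>

lemma X_eq: "real n - comp_laplace l n E = (\<Sum>v\<in>{1..n}. 1 - exp (- l * real (comp_size E v)))"
  by (simp add: comp_laplace_def sum_subtractf comp_size_def)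

lemma X_big:
  assumes "0 < l"
  shows "(1 - exp (- l * k)) * real (card (big_comps n k E)) \<le> real n - comp_laplace l n E"
proof -
  have "(\<Sum>v\<in>big_comps n k E. 1 - exp (- l * k)) \<le> (\<Sum>v\<in>big_comps n k E. 1 - exp (- l * real (comp_size E v)))"
    using assms by (intro sum_mono) (auto simp: big_comps_def)
  also have "\<dots> \<le> (\<Sum>v\<in>{1..n}. 1 - exp (- l * real (comp_size E v)))"
    using assms by (intro sum_mono2) (auto simp: big_comps_def)
  finally show ?thesis by (simp add: X_eq mult.commute)
qed

lemma X_small:
  assumes "0 < l"
  shows "(\<Sum>v\<in>{1..n} - big_comps n (1 / l) E. real (comp_size E v)) \<le> 2 * (real n - comp_laplace l n E) / l"
proof -
  have "(\<Sum>v\<in>{1..n} - big_comps n (1 / l) E. real (comp_size E v)) \<le> 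
        (\<Sum>v\<in>{1..n} - big_comps n (1 / l) E. 2 / l * (1 - exp (- l * real (comp_size E v))))"
  proof (rule sum_mono)
    fix v assume "v \<in> {1..n} - big_comps n (1 / l) E"
    then have "real (comp_size E v) < 1 / l" by (auto simp: big_comps_def)
    then have "l * real (comp_size E v) \<le> 1" using assms by (simp add: field_simps)
    from exp_lower[OF _ this] assms show "real (comp_size E v) \<le> 2 / l * (1 - exp (- l * real (comp_size E v)))"
      by (simp add: field_simps)
  qed
  also have "\<dots> \<le> (\<Sum>v\<in>{1..n}. 2 / l * (1 - exp (- l * real (comp_size E v))))"
    using assms by (intro sum_mono2) auto
  also have "\<dots> = 2 * (real n - comp_laplace l n E) / l" unfolding X_eq sum_distrib_left[symmetric] by simp
  finally show ?thesis .
qed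

text \<open>The converse direction, with a threshold unrelated to \<open>l\<close>: if the small
  components are known to contribute little, a large \<open>X\<close> forces many vertices into
  components of size at least \<open>k\<close>.\<close>

lemma X_le:
  assumes "0 < l"
  shows "real n - comp_laplace l n E \<le> l * (\<Sum>v\<in>{1..n} - big_comps n k E. real (comp_size E v)) + real (card (big_comps n k E))"
proof -
  have "real n - comp_laplace l n E = (\<Sum>v\<in>{1..n} - big_comps n k E. 1 - exp (- l * real (comp_size E v))) +
     (\<Sum>v\<in>big_comps n k E. 1 - exp (- l * real (comp_size E v)))"
    unfolding X_eq by (intro sum.subset_diff) (auto simp: big_comps_def)
  also have "\<dots> \<le> (\<Sum>v\<in>{1..n} - big_comps n k E. l * real (comp_size E v)) + (\<Sum>v\<in>big_comps n k E. 1)"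
  proof (intro add_mono sum_mono)
    fix v show "1 - exp (- l * real (comp_size E v)) \<le> l * real (comp_size E v)"
      using exp_ge_add_one_self[of "- l * real (comp_size E v)"] by simp
  qed auto
  finally show ?thesis by (simp add: sum_distrib_left)
qed

lemma comp_size_le_big:
  assumes "E \<subseteq> pairs {1..n}" "v \<in> big_comps n k E"
  shows "reach E {v} \<subseteq> big_comps n k E" "comp_size E v \<le> card (big_comps n k E)"
proof -
  have "reach E {v} \<subseteq> {1..n}" using assms by (intro reach_subset_verts) (auto simp: big_comps_def)
  then show "reach E {v} \<subseteq> big_comps n k E" using assms(2) reach_eq by (fastforce simp: big_comps_def comp_size_def)
  then show "comp_size E v \<le> card (big_comps n k E)" 
    unfolding comp_size_def by (intro card_mono) (auto simp: big_comps_def)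
qed

text \<open>A component above the threshold consists of vertices of \<open>big_comps\<close>, so its
  size is at most their number; hence the square.\<close>

lemma sum_comp_size_le:
  assumes "E \<subseteq> pairs {1..n}"
  shows "(\<Sum>v\<in>{1..n}. real (comp_size E v)) \<le> 
     (\<Sum>v\<in>{1..n} - big_comps n k E. real (comp_size E v)) + (real (card (big_comps n k E)))\<^sup>2"
proof -
  have "(\<Sum>v\<in>{1..n}. real (comp_size E v)) = (\<Sum>v\<in>{1..n} - big_comps n k E. real (comp_size E v)) + (\<Sum>v\<in>big_comps n k E. real (comp_size E v))"
    by (intro sum.subset_diff) (auto simp: big_comps_def)
  also have "(\<Sum>v\<in>big_comps n k E. real (comp_size E v)) \<le> (\<Sum>v\<in>big_comps n k E. real (card (big_comps n k E)))"
    using comp_size_le_big(2)[OF assms] by (intro sum_mono) auto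
  finally show ?thesis by (simp add: power2_eq_square)
qed

lemma sum_comp_size_le_X:
  assumes "E \<subseteq> pairs {1..n}" "0 < l" "real n - comp_laplace l n E \<le> z"
  shows "(\<Sum>v\<in>{1..n}. real (comp_size E v)) \<le> 2 * z / l + (2 * z)\<^sup>2"
proof -
  have "1 / 2 * real (card (big_comps n (1 / l) E)) \<le> (1 - exp (- l * (1 / l))) * real (card (big_comps n (1 / l) E))"
    using assms exp_lower[of 1] by (intro mult_right_mono) auto
  also have "\<dots> \<le> z" using X_big[OF assms(2), of "1 / l" n E] assms(3) by simp
  finally have "(real (card (big_comps n (1 / l) E)))\<^sup>2 \<le> (2 * z)\<^sup>2" by (intro power_mono) auto
  moreover have "2 * (real n - comp_laplace l n E) / l \<le> 2 * z / l"
    using assms by (intro divide_right_mono) auto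
  ultimately show ?thesis
    using sum_comp_size_le[OF assms(1), of "1 / l"] X_small[OF assms(2), where n = n and E = E] by linarith
qed

lemma sum_comp_size_le_count:
  assumes "E \<subseteq> pairs {1..n}" "0 \<le> k"
  shows "(\<Sum>v\<in>{1..n}. real (comp_size E v)) \<le> k * real n + (real (card (big_comps n k E)))\<^sup>2"
proof -
  have "(\<Sum>v\<in>{1..n} - big_comps n k E. real (comp_size E v)) \<le> (\<Sum>v\<in>{1..n} - big_comps n k E. k)"
    by (intro sum_mono) (auto simp: big_comps_def)
  also have "\<dots> \<le> (\<Sum>v\<in>{1..n}. k)" using assms by (intro sum_mono2) auto
  finally show ?thesis using sum_comp_size_le[OF assms(1), of k] by (simp add: mult.commute)
qed

lemma comp_laplace_antimono:
  assumes "0 < l" "E \<subseteq> E'" "E' \<subseteq> pairs {1..n}"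
  shows "comp_laplace l n E' \<le> comp_laplace l n E"
  unfolding comp_laplace_def
proof (rule sum_mono)
  fix v assume v: "v \<in> {1..n}"
  have "reach E' {v} \<subseteq> {1..n}" using assms v by (intro reach_subset_verts) auto
  then have "card (reach E {v}) \<le> card (reach E' {v})"
    using assms by (intro card_mono reach_mono) (auto intro: finite_subset)
  then show "exp (- l * real (card (reach E' {v}))) \<le> exp (- l * real (card (reach E {v})))"
    using assms by simp
qed

section \<open>Connected families, clique models and splitting\<close>

definition rel_within :: "nat set set \<Rightarrow> nat set \<Rightarrow> (nat \<times> nat) set" where
  "rel_within E B = {(x, y). x \<in> B \<and> y \<in> B \<and> {x, y} \<in> E}"

definition conn_set :: "nat set set \<Rightarrow> nat set \<Rightarrow> bool" where
  "conn_set E B \<longleftrightarrow> B \<noteq> {} \<and> (\<forall>x\<in>B. \<forall>y\<in>B. (x, y) \<in> (rel_within E B)\<^sup>*)"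

lemma rel_within_sym: "(x, y) \<in> (rel_within E B)\<^sup>* \<Longrightarrow> (y, x) \<in> (rel_within E B)\<^sup>*"
proof -
  have "sym (rel_within E B)" by (auto simp: sym_def rel_within_def insert_commute)
  then show "(x, y) \<in> (rel_within E B)\<^sup>* \<Longrightarrow> (y, x) \<in> (rel_within E B)\<^sup>*"
    by (meson symD sym_rtrancl)
qed

lemma rel_within_mono: "E \<subseteq> E' \<Longrightarrow> B \<subseteq> B' \<Longrightarrow> (rel_within E B)\<^sup>* \<subseteq> (rel_within E' B')\<^sup>*"
  by (intro rtrancl_mono) (auto simp: rel_within_def)

lemma conn_set_rootI:
  assumes "r \<in> B" "\<And>x. x \<in> B \<Longrightarrow> (r, x) \<in> (rel_within E B)\<^sup>*"
  shows "conn_set E B"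
  unfolding conn_set_def using assms rel_within_sym rtrancl_trans by (metis empty_iff)

lemma conn_set_path: "conn_set E B \<Longrightarrow> x \<in> B \<Longrightarrow> y \<in> B \<Longrightarrow> (x, y) \<in> (rel_within E B)\<^sup>*"
  by (simp add: conn_set_def)

lemma conn_set_mono: "conn_set E B \<Longrightarrow> E \<subseteq> E' \<Longrightarrow> conn_set E' B"
  using rel_within_mono[of E E' B B] by (auto simp: conn_set_def)

lemma conn_Un:
  assumes "conn_set E B" "conn_set E B'" "x \<in> B" "y \<in> B'" "{x, y} \<in> E"
  shows "conn_set E (B \<union> B')"
proof (rule conn_set_rootI[of x])
  fix z assume "z \<in> B \<union> B'"
  then show "(x, z) \<in> (rel_within E (B \<union> B'))\<^sup>*"
  proof
    assume "z \<in> B"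
    then show ?thesis using conn_set_path[OF assms(1,3)] rel_within_mono[of E E B "B \<union> B'"] by blast
  next
    assume "z \<in> B'"
    then have "(y, z) \<in> (rel_within E (B \<union> B'))\<^sup>*"
      using conn_set_path[OF assms(2,4)] rel_within_mono[of E E B' "B \<union> B'"] by blast
    moreover have "(x, y) \<in> rel_within E (B \<union> B')" using assms by (auto simp: rel_within_def)
    ultimately show ?thesis by (rule converse_rtrancl_into_rtrancl[rotated])
  qed
qed (use assms in auto)

lemma conn_set_reach: "conn_set E (reach E {v})"
proof (rule conn_set_rootI[of v])
  show "v \<in> reach E {v}" using reach_superset by blast
  fix x assume "x \<in> reach E {v}"
  then have "(v, x) \<in> (edge_rel E)\<^sup>*" by (simp add: reach_def)
  then show "(v, x) \<in> (rel_within E (reach E {v}))\<^sup>*"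
  proof (induction rule: rtrancl_induct)
    case (step y z)
    then have "y \<in> reach E {v}" "z \<in> reach E {v}" "{y, z} \<in> E"
      by (auto simp: reach_def edge_rel_def intro: rtrancl_into_rtrancl)
    then have "(y, z) \<in> rel_within E (reach E {v})" by (simp add: rel_within_def)
    with step show ?case by (meson rtrancl_into_rtrancl)
  qed simp
qed

lemma conn_set_escape:
  assumes "conn_set E C" "B \<subseteq> C" "B \<noteq> {}" "B \<noteq> C"
  shows "\<exists>x\<in>B. \<exists>y\<in>C - B. {x, y} \<in> E"
proof (rule ccontr)
  assume *: "\<not> ?thesis"
  obtain x z where xz: "x \<in> B" "z \<in> C" "z \<notin> B" using assms by blast
  then have "(x, z) \<in> (rel_within E C)\<^sup>*" using conn_set_path assms by blast
  then have "z \<in> B"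
    by (induction rule: rtrancl_induct) (use xz * in \<open>auto simp: rel_within_def\<close>)
  with xz show False by simp
qed

lemma conn_set_connected_graph:
  assumes "conn_set E B" "B \<subseteq> V" "E \<subseteq> pairs V"
  shows "connected_graph (induced (V, E) B)"
proof -
  have "adj_rel (induced (V, E) B) = rel_within E B"
  proof -
    have "x \<noteq> y" if "{x, y} \<in> E" for x y using that assms(3) by (auto simp: pairs_def)
    then show ?thesis using assms(2) by (auto simp: adj_rel_def induced_def rel_within_def)
  qed
  moreover have "fst (induced (V, E) B) = B" using assms by (auto simp: induced_def)
  ultimately show ?thesis using assms(1) by (simp add: connected_graph_def conn_set_def)
qed

definition sets_adjacent :: "nat set set \<Rightarrow> nat set \<Rightarrow> nat set \<Rightarrow> bool" where
  "sets_adjacent E B B' \<longleftrightarrow> (\<exists>x\<in>B. \<exists>y\<in>B'. {x, y} \<in> E)"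

lemma sets_adjacent_sym: "sets_adjacent E B B' \<longleftrightarrow> sets_adjacent E B' B"
  unfolding sets_adjacent_def by (metis insert_commute)

lemma sets_adjacent_mono: "sets_adjacent E A A' \<Longrightarrow> A \<subseteq> B \<Longrightarrow> A' \<subseteq> B' \<Longrightarrow> sets_adjacent E B B'"
  by (auto simp: sets_adjacent_def)

definition adjacent_pairs :: "nat set set \<Rightarrow> nat set set \<Rightarrow> (nat set \<times> nat set) set" where
  "adjacent_pairs E F = {(B, B'). B \<in> F \<and> B' \<in> F \<and> B \<noteq> B' \<and> sets_adjacent E B B'}"

definition conn_set_family :: "nat set set \<Rightarrow> nat set set \<Rightarrow> bool" where
  "conn_set_family E F \<longleftrightarrow> finite F \<and> (\<forall>B\<in>F. conn_set E B) \<and> (\<forall>B\<in>F. \<forall>B'\<in>F. B \<noteq> B' \<longrightarrow> B \<inter> B' = {})"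

lemma conn_set_family_subset: "conn_set_family E F \<Longrightarrow> F' \<subseteq> F \<Longrightarrow> conn_set_family E F'"
  unfolding conn_set_family_def by (meson finite_subset subsetD)

lemma conn_set_family_nonempty: "conn_set_family E F \<Longrightarrow> B \<in> F \<Longrightarrow> B \<noteq> {}"
  by (auto simp: conn_set_family_def conn_set_def)

lemma finite_adjR [simp]: "finite F \<Longrightarrow> finite (adjacent_pairs E F)"
  by (rule finite_subset[of _ "F \<times> F"]) (auto simp: adjacent_pairs_def)

text \<open>Adjacencies are counted as ordered pairs. The merge loses the two orders of the merged
  pair and, for each common neighbour, identifies its pair with \<open>B\<close> and its pair with
  \<open>B'\<close>, again in both orders.\<close>

lemma conn_set_family_merge:
  assumes F: "conn_set_family E F" and B: "B \<in> F" "B' \<in> F" "B \<noteq> B'" "sets_adjacent E B B'"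
  defines "Com \<equiv> {C \<in> F. C \<noteq> B \<and> C \<noteq> B' \<and> sets_adjacent E C B \<and> sets_adjacent E C B'}"
  defines "F' \<equiv> insert (B \<union> B') (F - {B, B'})"
  shows "conn_set_family E F'" "Suc (card F') = card F" "card (adjacent_pairs E F) \<le> card (adjacent_pairs E F') + 2 + 2 * card Com"
proof -
  have fin: "finite F" using F by (simp add: conn_set_family_def)
  have disj: "A \<in> F \<Longrightarrow> A' \<in> F \<Longrightarrow> A \<noteq> A' \<Longrightarrow> A \<inter> A' = {}" for A A' using F by (simp add: conn_set_family_def)
  have cn: "A \<in> F \<Longrightarrow> conn_set E A" for A using F by (simp add: conn_set_family_def)
  have notin: "A \<in> F \<Longrightarrow> A \<noteq> B \<Longrightarrow> A \<noteq> B' \<Longrightarrow> A \<noteq> B \<union> B' \<and> A \<inter> (B \<union> B') = {}" for A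
    using disj[of A B] disj[of A B'] conn_set_family_nonempty[OF F B(1)] B by blast
  have "conn_set E (B \<union> B')" using B(4) conn_Un[OF cn[OF B(1)] cn[OF B(2)]] by (auto simp: sets_adjacent_def)
  then show fam': "conn_set_family E F'"
    unfolding conn_set_family_def F'_def using fin cn disj notin by (auto simp: Int_commute)
  have "B \<union> B' \<notin> F - {B, B'}" using notin by blast
  moreover have "card (F - {B, B'}) + 2 = card F"
  proof -
    have "card (F - {B, B'}) = card F - 2" using B fin by (subst card_Diff_subset) auto
    moreover have "card {B, B'} \<le> card F" using B fin by (intro card_mono) auto
    ultimately show ?thesis using B(3) by simp
  qed
  ultimately show "Suc (card F') = card F" using fin by (simp add: F'_def)
  define \<phi> where "\<phi> = (\<lambda>C. if C = B \<or> C = B' then B \<union> B' else C)"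
  \<comment> \<open>Of the two pairs of a common neighbour, the one with \<open>B'\<close> is
    discarded and the one with \<open>B\<close> kept; outside \<open>bad\<close> the merging map is
    then injective on adjacent pairs.\<close>
  define bad where "bad = {(B, B'), (B', B)} \<union> {B'} \<times> Com \<union> Com \<times> {B'}"
  have finC: "finite Com" using fin by (simp add: Com_def)
  have "card bad \<le> card {(B, B'), (B', B)} + card ({B'} \<times> Com) + card (Com \<times> {B'})"
    unfolding bad_def using card_Un_le order_trans add_right_mono by meson
  also have "\<dots> = 2 + 2 * card Com" using B finC by (simp add: card_cartesian_product)
  finally have cbad: "card bad \<le> 2 + 2 * card Com" .
  have finb: "finite bad" using finC by (simp add: bad_def)
  have phiD: "C = D \<or> {C, D} = {B, B'}" if "\<phi> C = \<phi> D" "C \<in> F" "D \<in> F" for C D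
    using that notin[of C] notin[of D] unfolding \<phi>_def by (auto split: if_splits)
  have comD: "C \<in> Com" if "C \<in> F" "C \<noteq> B" "C \<noteq> B'" "sets_adjacent E C B" "sets_adjacent E C B'" for C
    using that by (simp add: Com_def)
  have RD: "C \<in> F" "D \<in> F" "C \<noteq> D" "sets_adjacent E C D" "sets_adjacent E D C" "\<not> (C = B \<and> D = B')" "\<not> (C = B' \<and> D = B)"
      "C = B' \<Longrightarrow> D \<notin> Com" "D = B' \<Longrightarrow> C \<notin> Com"
    if "(C, D) \<in> adjacent_pairs E F" "(C, D) \<notin> bad" for C D
    using that sets_adjacent_sym[of E C D] by (auto simp: adjacent_pairs_def bad_def)
  have inj: "inj_on (map_prod \<phi> \<phi>) (adjacent_pairs E F - bad)"
  proof (rule inj_onI)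
    fix p q assume p: "p \<in> adjacent_pairs E F - bad" and q: "q \<in> adjacent_pairs E F - bad" and pq: "map_prod \<phi> \<phi> p = map_prod \<phi> \<phi> q"
    obtain C D C' D' where p': "p = (C, D)" and q': "q = (C', D')" by (metis surj_pair)
    have 1: "(C, D) \<in> adjacent_pairs E F" "(C, D) \<notin> bad" and 2: "(C', D') \<in> adjacent_pairs E F" "(C', D') \<notin> bad"
      using p q p' q' by auto
    have eq: "\<phi> C = \<phi> C'" "\<phi> D = \<phi> D'" using pq p' q' by auto
    note r1 = RD[OF 1] and r2 = RD[OF 2]
    have c: "C = C' \<or> C = B \<and> C' = B' \<or> C = B' \<and> C' = B"
      using phiD[OF eq(1) r1(1) r2(1)] unfolding doubleton_eq_iff by blast
    have c': "D = D' \<or> D = B \<and> D' = B' \<or> D = B' \<and> D' = B"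
      using phiD[OF eq(2) r1(2) r2(2)] unfolding doubleton_eq_iff by blast
    have d: "C = C'"
    proof (rule ccontr)
      assume "C \<noteq> C'"
      then have cc: "C = B \<and> C' = B' \<or> C = B' \<and> C' = B" using c by blast
      then have D: "D \<noteq> B" "D \<noteq> B'" and "D = D'" using r1(3,6,7) r2(3,6,7) c' by blast+
      then have "D \<in> Com" using cc r1(2,5) r2(5) by (intro comD) auto
      then show False using cc r1(8) r2(8) \<open>D = D'\<close> by blast
    qed
    moreover have "D = D'"
    proof (rule ccontr)
      assume "D \<noteq> D'"
      then have cc: "D = B \<and> D' = B' \<or> D = B' \<and> D' = B" using c' by blast
      then have C: "C \<noteq> B" "C \<noteq> B'" using r1(3,6,7) r2(3,6,7) d by blast+
      then have "C \<in> Com" using cc r1(1,4) r2(4) d by (intro comD) auto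
      then show False using cc r1(9) r2(9) d by blast
    qed
    ultimately show "p = q" using p' q' by simp
  qed
  have img: "map_prod \<phi> \<phi> ` (adjacent_pairs E F - bad) \<subseteq> adjacent_pairs E F'"
  proof (rule image_subsetI)
    fix p assume p: "p \<in> adjacent_pairs E F - bad"
    obtain C D where p': "p = (C, D)" by (metis surj_pair)
    have "(C, D) \<in> adjacent_pairs E F" "(C, D) \<notin> bad" using p p' by auto
    then have r: "C \<in> F" "D \<in> F" "C \<noteq> D" "sets_adjacent E C D" "{C, D} \<noteq> {B, B'}"
      using RD[of C D] by (simp_all add: doubleton_eq_iff)
    then have "\<phi> C \<noteq> \<phi> D" using phiD by blast
    moreover have "\<phi> C \<in> F'" "\<phi> D \<in> F'" using r by (auto simp: \<phi>_def F'_def)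
    moreover have "sets_adjacent E (\<phi> C) (\<phi> D)" by (rule sets_adjacent_mono[OF r(4)]) (auto simp: \<phi>_def)
    ultimately show "map_prod \<phi> \<phi> p \<in> adjacent_pairs E F'" by (simp add: adjacent_pairs_def p')
  qed
  have "card (adjacent_pairs E F) \<le> card (adjacent_pairs E F - bad) + card bad"
    using card_Un_le[of "adjacent_pairs E F - bad" bad] card_mono[of "(adjacent_pairs E F - bad) \<union> bad" "adjacent_pairs E F"] fin finb by auto
  also have "card (adjacent_pairs E F - bad) \<le> card (adjacent_pairs E F')"
    using card_mono[OF _ img] card_image[OF inj] fin by (simp add: F'_def)
  finally show "card (adjacent_pairs E F) \<le> card (adjacent_pairs E F') + 2 + 2 * card Com" using cbad by simp
qed

text \<open>Mader's argument: in a family with the fewest members among those of edge density at least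
  \<open>2 ^ k\<close>, merging two adjacent members must lose many adjacencies, so any two adjacent members have
  many common neighbours and the neighbourhood of a member is again dense.\<close>

theorem dense_family_has_clique_model:
  assumes "conn_set_family E F" "F \<noteq> {}" "2 ^ k * card F \<le> card (adjacent_pairs E F)"
  shows "\<exists>G. conn_set_family E G \<and> card G = k \<and> (\<forall>B\<in>G. \<forall>B'\<in>G. B \<noteq> B' \<longrightarrow> sets_adjacent E B B') \<and>
     (\<forall>B\<in>G. \<exists>A\<in>F. A \<subseteq> B) \<and> \<Union>G \<subseteq> \<Union>F"
  using assms
proof (induction k arbitrary: F)
  case 0
  show ?case by (rule exI[of _ "{}"]) (simp add: conn_set_family_def)
next
  case (Suc k)
  \<comment> \<open>The containment clause is the invariant that finishes the construction: each
    branch set found inside the neighbourhood of \<open>B\<close> contains a neighbour of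
    \<open>B\<close>, hence is adjacent to \<open>B\<close>.\<close>
  define P where "P H \<longleftrightarrow> conn_set_family E H \<and> H \<noteq> {} \<and> 2 ^ Suc k * card H \<le> card (adjacent_pairs E H) \<and>
     (\<forall>B\<in>H. \<exists>A\<in>F. A \<subseteq> B) \<and> \<Union>H \<subseteq> \<Union>F" for H
  have "P F" using Suc.prems by (auto simp: P_def)
  then obtain H where H: "P H" and min: "\<And>H'. P H' \<Longrightarrow> card H \<le> card H'"
    using ex_has_least_nat[of P F card] by blast
  have fH: "conn_set_family E H" "H \<noteq> {}" "finite H" using H by (auto simp: P_def conn_set_family_def)
  have com: "2 ^ k \<le> card {C \<in> H. C \<noteq> B \<and> C \<noteq> B' \<and> sets_adjacent E C B \<and> sets_adjacent E C B'}"
    if B: "B \<in> H" "B' \<in> H" "B \<noteq> B'" "sets_adjacent E B B'" for B B'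
  proof -
    define H' where "H' = insert (B \<union> B') (H - {B, B'})"
    note mg = conn_set_family_merge[OF fH(1) B, folded H'_def]
    have "\<not> P H'" using min[of H'] mg(2) by auto
    moreover have "\<forall>C\<in>H'. \<exists>A\<in>F. A \<subseteq> C"
    proof
      fix C assume C: "C \<in> H'"
      have ex: "\<And>D. D \<in> H \<Longrightarrow> \<exists>A\<in>F. A \<subseteq> D" using H by (simp add: P_def)
      show "\<exists>A\<in>F. A \<subseteq> C"
      proof (cases "C = B \<union> B'")
        case True
        then show ?thesis using ex[OF B(1)] by blast
      next
        case False
        then show ?thesis using C ex[of C] by (simp add: H'_def)
      qed
    qed
    moreover have "\<Union>H' \<subseteq> \<Union>F"
    proof -
      have "\<Union>H' \<subseteq> \<Union>H" using B(1,2) by (auto simp: H'_def)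
      also have "\<dots> \<subseteq> \<Union>F" using H by (simp add: P_def)
      finally show ?thesis .
    qed
    moreover have "H' \<noteq> {}" by (simp add: H'_def)
    ultimately have "\<not> 2 ^ Suc k * card H' \<le> card (adjacent_pairs E H')" using mg(1) unfolding P_def by blast
    moreover have "2 ^ Suc k * Suc (card H') \<le> card (adjacent_pairs E H)"
      unfolding mg(2) using H by (simp add: P_def)
    \<comment> \<open>More than \<open>2 ^ Suc k\<close> adjacencies are lost, and at most
      \<open>2 + 2 * card\<close> of the common neighbours; parity removes the additive constant and
      leaves \<open>2 ^ k\<close>.\<close>
    ultimately show ?thesis using mg(3) by simp
  qed
  have "card H > 0" using fH by (simp add: card_gt_0_iff)
  then have "0 < 2 ^ Suc k * card H" by simp
  also have "\<dots> \<le> card (adjacent_pairs E H)" using H unfolding P_def by blast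
  finally obtain B B0 where B: "B \<in> H" "B0 \<in> H" "B \<noteq> B0" "sets_adjacent E B B0"
    by (auto simp: card_gt_0_iff adjacent_pairs_def)
  define N where "N = {C \<in> H. C \<noteq> B \<and> sets_adjacent E B C}"
  have N: "conn_set_family E N" "finite N" "N \<noteq> {}" "N \<subseteq> H" using B fH conn_set_family_subset[of E H N] by (auto simp: N_def)
  have "adjacent_pairs E N = (SIGMA C:N. {D \<in> N. C \<noteq> D \<and> sets_adjacent E C D})" by (auto simp: adjacent_pairs_def)
  then have "card (adjacent_pairs E N) = (\<Sum>C\<in>N. card {D \<in> N. C \<noteq> D \<and> sets_adjacent E C D})" using N by simp
  also have "\<dots> \<ge> (\<Sum>C\<in>N. 2 ^ k)"
  proof (rule sum_mono)
    fix C assume C: "C \<in> N"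
    then have "2 ^ k \<le> card {D \<in> H. D \<noteq> B \<and> D \<noteq> C \<and> sets_adjacent E D B \<and> sets_adjacent E D C}"
      using B by (intro com) (auto simp: N_def)
    also have "\<dots> \<le> card {D \<in> N. C \<noteq> D \<and> sets_adjacent E C D}"
    proof (rule card_mono)
      show "finite {D \<in> N. C \<noteq> D \<and> sets_adjacent E C D}" using N(2) by simp
      show "{D \<in> H. D \<noteq> B \<and> D \<noteq> C \<and> sets_adjacent E D B \<and> sets_adjacent E D C} \<subseteq> {D \<in> N. C \<noteq> D \<and> sets_adjacent E C D}"
      proof
        fix D assume D: "D \<in> {D \<in> H. D \<noteq> B \<and> D \<noteq> C \<and> sets_adjacent E D B \<and> sets_adjacent E D C}"
        then have "sets_adjacent E B D" "sets_adjacent E C D" "D \<in> H" "D \<noteq> B" "C \<noteq> D" using iffD1[OF sets_adjacent_sym] by blast+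
        then show "D \<in> {D \<in> N. C \<noteq> D \<and> sets_adjacent E C D}" by (simp add: N_def)
      qed
    qed
    finally show "2 ^ k \<le> card {D \<in> N. C \<noteq> D \<and> sets_adjacent E C D}" .
  qed
  finally have "2 ^ k * card N \<le> card (adjacent_pairs E N)" by (simp add: mult.commute)
  from Suc.IH[OF N(1,3) this] obtain G where GG: "conn_set_family E G \<and> card G = k \<and>
    (\<forall>B\<in>G. \<forall>B'\<in>G. B \<noteq> B' \<longrightarrow> sets_adjacent E B B') \<and> (\<forall>B\<in>G. \<exists>A\<in>N. A \<subseteq> B) \<and> \<Union>G \<subseteq> \<Union>N"
    by (rule exE)
  note G = GG[THEN conjunct1] GG[THEN conjunct2, THEN conjunct1] GG[THEN conjunct2, THEN conjunct2, THEN conjunct1]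
    GG[THEN conjunct2, THEN conjunct2, THEN conjunct2, THEN conjunct1]
    GG[THEN conjunct2, THEN conjunct2, THEN conjunct2, THEN conjunct2]
  have dH: "B \<inter> C = {}" if "C \<in> H" "C \<noteq> B" for C using fH(1) B(1) that unfolding conn_set_family_def by metis
  have dB: "B \<inter> \<Union>N = {}" using dH unfolding N_def by auto
  have Bn: "B \<noteq> {}" using conn_set_family_nonempty[OF fH(1) B(1)] .
  have dG: "B \<inter> A = {}" if "A \<in> G" for A
  proof -
    have "A \<subseteq> \<Union>N" using that G(5) by (meson Sup_upper order_trans)
    then show ?thesis using dB by auto
  qed
  have "B \<notin> G" using dG[of B] Bn by auto
  have adjB: "sets_adjacent E B A" if "A \<in> G" for A
  proof -
    have "\<exists>A'\<in>N. A' \<subseteq> A" using G(4) that by (rule bspec)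
    then obtain A' where "A' \<in> N" "A' \<subseteq> A" by (elim bexE)
    moreover have "sets_adjacent E B A'" using \<open>A' \<in> N\<close> by (simp add: N_def)
    ultimately show ?thesis using sets_adjacent_mono[of E B A' B A] by simp
  qed
  show ?case
  proof (intro exI[of _ "insert B G"] conjI ballI impI)
    have "conn_set E B" using fH(1) B by (simp add: conn_set_family_def)
    moreover have "\<And>A. A \<in> G \<Longrightarrow> A \<inter> B = {}" using dG by (simp add: Int_commute)
    ultimately show "conn_set_family E (insert B G)" using G(1) dG unfolding conn_set_family_def by simp
    show "card (insert B G) = Suc k" using G(1,2) \<open>B \<notin> G\<close> by (simp add: conn_set_family_def)
    show "sets_adjacent E A A'" if "A \<in> insert B G" "A' \<in> insert B G" "A \<noteq> A'" for A A'
    proof (cases "A = B \<or> A' = B")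
      case True
      then show ?thesis using that adjB[of A] adjB[of A'] sets_adjacent_sym[of E A B] by (elim disjE) auto
    next
      case False
      then have "A \<in> G" "A' \<in> G" using that by simp_all
      then show ?thesis using G(3) that(3) by metis
    qed
    show "\<exists>A\<in>F. A \<subseteq> C" if "C \<in> insert B G" for C
    proof (cases "C = B")
      case True
      have "\<forall>D\<in>H. \<exists>A\<in>F. A \<subseteq> D" using H unfolding P_def by (elim conjE)
      then show ?thesis using True B(1) by simp
    next
      case False
      then have "C \<in> G" using that by simp
      with G(4) have "\<exists>A\<in>N. A \<subseteq> C" by (rule bspec)
      then obtain A where "A \<in> N" "A \<subseteq> C" by (elim bexE)
      then have "A \<in> H" "A \<subseteq> C" using N(4) by auto
      moreover have "\<exists>A'\<in>F. A' \<subseteq> A" using H \<open>A \<in> H\<close> by (simp add: P_def)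
      ultimately show ?thesis by (meson order_trans)
    qed
    have "\<Union>N \<subseteq> \<Union>H" by (rule Union_mono[OF N(4)])
    with G(5) have "\<Union>G \<subseteq> \<Union>H" by (rule order_trans)
    moreover have "B \<subseteq> \<Union>H" using B(1) by (rule Union_upper)
    ultimately have "\<Union>(insert B G) \<subseteq> \<Union>H" by simp
    also have "\<dots> \<subseteq> \<Union>F" using H by (simp add: P_def)
    finally show "\<Union>(insert B G) \<subseteq> \<Union>F" .
  qed
qed

text \<open>Let \<open>B\<close> be smallest among the connected sets of at least \<open>m\<close>
  vertices whose complement in \<open>C\<close> is connected or empty, and let \<open>x\<close> be a
  vertex of \<open>B\<close> with a neighbour outside, if there is an outside. Each component of
  \<open>B - {x}\<close> could replace \<open>B\<close>, so by minimality it has fewer than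
  \<open>m\<close> vertices; each contains a neighbour of \<open>x\<close>, so there are at most
  \<open>d\<close> of them.\<close>

lemma conn_set_split_aux:
  assumes C: "finite C" "conn_set E C" and vertex_deg: "\<And>x. x \<in> C \<Longrightarrow> card {y \<in> C. {x, y} \<in> E} \<le> d" 
    and m: "1 \<le> m" "m \<le> card C"
  shows "\<exists>B\<subseteq>C. conn_set E B \<and> (C - B = {} \<or> conn_set E (C - B)) \<and> m \<le> card B \<and> card B \<le> d * m + 1"
proof -
  define P where "P B \<longleftrightarrow> B \<subseteq> C \<and> conn_set E B \<and> (C - B = {} \<or> conn_set E (C - B)) \<and> m \<le> card B" for B
  have "P C" using C m by (simp add: P_def)
  then obtain B where B: "P B" and min: "\<And>B'. P B' \<Longrightarrow> card B \<le> card B'"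
    using ex_has_least_nat[of P C card] by blast
  have BC: "B \<subseteq> C" "conn_set E B" "finite B" "B \<noteq> {}" using B C finite_subset by (auto simp: P_def conn_set_def)
  obtain x where x: "x \<in> B" "C - B \<noteq> {} \<Longrightarrow> \<exists>y\<in>C - B. {x, y} \<in> E"
  proof (cases "C - B = {}")
    case True then show ?thesis using BC that by blast
  next
    case False
    then have "B \<noteq> C" by auto
    then show ?thesis using conn_set_escape[OF C(2) BC(1,4)] that by blast
  qed
  \<comment> \<open>For \<open>y\<close> in \<open>B - {x}\<close> this is the component of
    \<open>y\<close> in the graph induced there.\<close>
  define K where "K y = {z. (y, z) \<in> (rel_within E (B - {x}))\<^sup>*}" for y
  have K_in: "K y \<subseteq> B - {x}" if y: "y \<in> B - {x}" for y
  proof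
    fix z assume "z \<in> K y"
    then have "(y, z) \<in> (rel_within E (B - {x}))\<^sup>*" by (simp add: K_def)
    then show "z \<in> B - {x}" by (induction rule: rtrancl_induct) (use y in \<open>auto simp: rel_within_def\<close>)
  qed
  have K_self: "y \<in> K y" for y by (simp add: K_def)
  have K_eq: "z \<in> K y \<Longrightarrow> K z = K y" for y z
    unfolding K_def using rel_within_sym rtrancl_trans by (metis (no_types, lifting) mem_Collect_eq)
  have K_conn: "conn_set E (K y)" for y
  proof (rule conn_set_rootI[of y])
    fix z assume "z \<in> K y"
    then have "(y, z) \<in> (rel_within E (B - {x}))\<^sup>*" by (simp add: K_def)
    then show "(y, z) \<in> (rel_within E (K y))\<^sup>*"
    proof (induction rule: rtrancl_induct)
      case (step a b)
      then have "a \<in> K y" "b \<in> K y" "{a, b} \<in> E"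
        by (auto simp: K_def rel_within_def dest: rtrancl_into_rtrancl[of y a _ b])
      then have "(a, b) \<in> rel_within E (K y)" by (simp add: rel_within_def)
      with step show ?case by (meson rtrancl_into_rtrancl)
    qed simp
  qed (rule K_self)
  have K_nbr: "\<exists>w\<in>K z. {x, w} \<in> E" if z: "z \<in> B - {x}" for z
  proof -
    have "(z, x) \<in> (rel_within E B)\<^sup>*" using z x(1) conn_set_path[OF BC(2)] by auto
    then have "z = x \<or> (\<exists>w\<in>K z. {x, w} \<in> E)"
    proof (induction rule: converse_rtrancl_induct)
      case (step a b)
      show ?case
      proof (cases "a = x \<or> b = x")
        case True
        then show ?thesis using step K_self by (auto simp: rel_within_def insert_commute)
      next
        case False
        then have "(a, b) \<in> rel_within E (B - {x})" using step by (auto simp: rel_within_def)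
        then have "b \<in> K a" by (auto simp: K_def)
        then show ?thesis using step False K_eq[of b a] by auto
      qed
    qed simp
    then show ?thesis using z by simp
  qed
  have small: "card (K z) < m" if z: "z \<in> B - {x}" for z
  proof (rule ccontr)
    assume "\<not> card (K z) < m"
    have KB: "K z \<subseteq> B - {x}" by (rule K_in[OF z])
    have xin: "x \<in> C - K z" using x(1) BC(1) KB by auto
    \<comment> \<open>What remains hangs together at \<open>x\<close>: the other components of
      \<open>B - {x}\<close> each contain a neighbour of \<open>x\<close>, and \<open>C - B\<close>
      is connected and contains one too.\<close>
    have "conn_set E (C - K z)"
    proof (rule conn_set_rootI[OF xin])
      fix v assume v: "v \<in> C - K z"
      consider "v = x" | "v \<in> B - {x}" | "v \<in> C - B" using v by blast
      then show "(x, v) \<in> (rel_within E (C - K z))\<^sup>*"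
      proof cases
        case 2
        have Kv: "K v \<subseteq> C - K z" 
        proof
          fix u assume u: "u \<in> K v"
          have "u \<notin> K z" using K_eq[OF u] K_eq[of u z] K_self[of v] v by auto
          then show "u \<in> C - K z" using K_in[OF 2] u BC(1) by auto
        qed
        obtain w where w: "w \<in> K v" "{x, w} \<in> E" using K_nbr[OF 2] by blast
        have "(x, w) \<in> rel_within E (C - K z)" using w xin Kv by (auto simp: rel_within_def)
        moreover have "(w, v) \<in> (rel_within E (C - K z))\<^sup>*"
          using conn_set_path[OF K_conn w(1) K_self] rel_within_mono[OF order_refl Kv, of E] by blast
        ultimately show ?thesis by (rule converse_rtrancl_into_rtrancl)
      next
        case 3
        then obtain y where y: "y \<in> C - B" "{x, y} \<in> E" using x(2) by blast
        have sub: "C - B \<subseteq> C - K z" using KB by auto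
        have "conn_set E (C - B)" using B 3 by (auto simp: P_def)
        then have "(y, v) \<in> (rel_within E (C - K z))\<^sup>*"
          using conn_set_path[OF _ y(1) 3] rel_within_mono[OF order_refl sub, of E] by blast
        moreover have "(x, y) \<in> rel_within E (C - K z)" using y xin sub by (auto simp: rel_within_def)
        ultimately show ?thesis by (rule converse_rtrancl_into_rtrancl[rotated])
      qed simp
    qed
    then have "P (K z)" using KB BC(1) K_conn \<open>\<not> card (K z) < m\<close> by (auto simp: P_def)
    then have "card B \<le> card (K z)" by (rule min)
    moreover have "card (K z) < card B" using KB x(1) BC(3) by (intro psubset_card_mono) auto
    ultimately show False by simp
  qed
  define N where "N = {y \<in> B - {x}. {x, y} \<in> E}"
  have "B - {x} \<subseteq> (\<Union>w\<in>N. K w)"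
  proof
    fix z assume z: "z \<in> B - {x}"
    then obtain w where w: "w \<in> K z" "{x, w} \<in> E" using K_nbr by blast
    then have "w \<in> N" using K_in[OF z] by (auto simp: N_def)
    moreover have "z \<in> K w" using K_eq[OF w(1)] K_self[of z] by simp
    ultimately show "z \<in> (\<Union>w\<in>N. K w)" by blast
  qed
  moreover have Nf: "finite N" "\<forall>w\<in>N. finite (K w)"
  proof -
    show "finite N" using BC(3) by (simp add: N_def)
    show "\<forall>w\<in>N. finite (K w)"
    proof
      fix w assume "w \<in> N"
      then have "K w \<subseteq> B - {x}" by (intro K_in) (simp add: N_def)
      then show "finite (K w)" using BC(3) by (meson finite_Diff finite_subset)
    qed
  qed
  ultimately have "card (B - {x}) \<le> card (\<Union>w\<in>N. K w)" by (intro card_mono) auto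
  also have "\<dots> \<le> (\<Sum>w\<in>N. card (K w))" using Nf by (intro card_UN_le) auto
  also have "\<dots> \<le> (\<Sum>w\<in>N. m)" by (intro sum_mono less_imp_le small) (auto simp: N_def)
  also have "\<dots> \<le> d * m"
  proof -
    have "card N \<le> card {y \<in> C. {x, y} \<in> E}" using BC(1) C by (intro card_mono) (auto simp: N_def)
    also have "\<dots> \<le> d" using x(1) BC(1) by (intro vertex_deg) auto
    finally show ?thesis by simp
  qed
  finally have "card B \<le> d * m + 1" using x(1) BC(3) by simp
  then show ?thesis using B unfolding P_def by blast
qed

text \<open>Pieces are peeled off as long as the rest keeps \<open>m\<close> vertices. A smaller
  remainder is left joined to the last piece, which turns \<open>d\<close> into \<open>d + 1\<close>
  in the size bound.\<close>

theorem conn_set_split: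
  assumes "finite C" "conn_set E C" "\<And>x. x \<in> C \<Longrightarrow> card {y \<in> C. {x, y} \<in> E} \<le> d" "1 \<le> m" "m \<le> card C"
  shows "\<exists>F. conn_set_family E F \<and> \<Union>F = C \<and> (\<forall>B\<in>F. m \<le> card B \<and> card B \<le> (d + 1) * m + 1)"
  using assms
proof (induction "card C" arbitrary: C rule: less_induct)
  case less
  obtain B where B: "B \<subseteq> C" "conn_set E B" "C - B = {} \<or> conn_set E (C - B)" "m \<le> card B" "card B \<le> d * m + 1"
    using conn_set_split_aux[OF less.prems] by blast
  have fB: "finite B" using B less.prems finite_subset by blast
  show ?case
  proof (cases "m \<le> card (C - B)")
    case True
    have "card (C - B) < card C"
    proof (rule psubset_card_mono[OF less.prems(1)])
      have "B \<noteq> {}" using B(2) by (simp add: conn_set_def)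
      then show "C - B \<subset> C" using B(1) by blast
    qed
    moreover have "conn_set E (C - B)" using B(3) True less.prems(4) by (metis card.empty not_one_le_zero order_trans)
    moreover have "card {y \<in> C - B. {x, y} \<in> E} \<le> d" if "x \<in> C - B" for x
    proof -
      have "card {y \<in> C - B. {x, y} \<in> E} \<le> card {y \<in> C. {x, y} \<in> E}"
        using less.prems(1) by (intro card_mono) auto
      also have "\<dots> \<le> d" using that by (intro less.prems(3)) auto
      finally show ?thesis .
    qed
    ultimately obtain F where F: "conn_set_family E F" "\<Union>F = C - B" "\<forall>B\<in>F. m \<le> card B \<and> card B \<le> (d + 1) * m + 1"
      using less.hyps[of "C - B"] less.prems(1,4) True by auto
    have dj: "\<And>A. A \<in> F \<Longrightarrow> A \<inter> B = {}" using F(2) by blast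
    then have "conn_set_family E (insert B F)" using F(1) B(2) by (auto simp: conn_set_family_def Int_commute)
    moreover have "card B \<le> (d + 1) * m + 1" using B(5) by simp
    ultimately show ?thesis using F B by (intro exI[of _ "insert B F"]) auto
  next
    case False
    have "card C = card B + card (C - B)"
      using B(1) less.prems(1) fB by (metis card_Diff_subset card_mono le_add_diff_inverse)
    then have "card C \<le> (d + 1) * m + 1" using False B(5) by simp
    then show ?thesis using less.prems by (intro exI[of _ "{C}"]) (auto simp: conn_set_family_def)
  qed
qed

section \<open>Random orderings\<close>

definition edge_seqs :: "nat \<Rightarrow> nat \<Rightarrow> nat set list set" where
  "edge_seqs n t = {xs. length xs = t \<and> distinct xs \<and> set xs \<subseteq> Kn_edges n}"

lemma finite_Kn [simp]: "finite (Kn_edges n)"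
  by (simp add: Kn_edges_eq)

lemma card_Kn: "card (Kn_edges n) = n choose 2"
  by (simp add: Kn_edges_eq card_pairs)

lemma finite_DL [simp]: "finite (edge_seqs n t)"
  by (rule finite_subset[OF _ finite_lists_length_eq[OF finite_Kn[of n], of t]]) (auto simp: edge_seqs_def)

lemma sum_DL_Suc: "(\<Sum>xs\<in>edge_seqs n (Suc t). f xs) = (\<Sum>xs\<in>edge_seqs n t. \<Sum>e\<in>Kn_edges n - set xs. f (xs @ [e]))"
proof -
  have "edge_seqs n (Suc t) = (\<lambda>(xs, e). xs @ [e]) ` (SIGMA xs:edge_seqs n t. Kn_edges n - set xs)" (is "?L = ?R")
  proof
    show "?L \<subseteq> ?R"
    proof
      fix ys assume ys: "ys \<in> edge_seqs n (Suc t)"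
      then obtain xs e where "ys = xs @ [e]" by (cases ys rule: rev_cases) (auto simp: edge_seqs_def)
      then show "ys \<in> ?R" using ys by (intro image_eqI[of _ _ "(xs, e)"]) (auto simp: edge_seqs_def)
    qed
  qed (auto simp: edge_seqs_def)
  moreover have "inj_on (\<lambda>(xs, e). xs @ [e]) (SIGMA xs:edge_seqs n t. Kn_edges n - set xs)"
    by (auto simp: inj_on_def)
  ultimately have "(\<Sum>xs\<in>edge_seqs n (Suc t). f xs) = (\<Sum>(xs, e)\<in>(SIGMA xs:edge_seqs n t. Kn_edges n - set xs). f (xs @ [e]))"
    by (simp add: sum.reindex case_prod_unfold)
  then show ?thesis by (simp add: sum.Sigma)
qed

lemma orderings_eq: "orderings n = edge_seqs n (n choose 2)"
proof -
  have "set es = Kn_edges n \<longleftrightarrow> length es = n choose 2 \<and> set es \<subseteq> Kn_edges n" if "distinct es" for es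
    using distinct_card[OF that] card_subset_eq[OF finite_Kn, of "set es" n] card_Kn by auto
  then show ?thesis by (auto simp: orderings_def edge_seqs_def)
qed

lemma card_Kn_diff: "xs \<in> edge_seqs n t \<Longrightarrow> card (Kn_edges n - set xs) = (n choose 2) - t"
  by (subst card_Diff_subset) (auto simp: edge_seqs_def card_Kn distinct_card)

text \<open>All prefixes have the same number \<open>c\<close> of extensions. Only its independence
  of \<open>f\<close> matters, since means are quotients, so its value stays hidden.\<close>

lemma sum_DL_take:
  "t + d \<le> n choose 2 \<Longrightarrow> \<exists>c>0. \<forall>f::nat set list \<Rightarrow> real. (\<Sum>xs\<in>edge_seqs n (t + d). f (take t xs)) = c * (\<Sum>xs\<in>edge_seqs n t. f xs)"
proof (induction d)
  case 0
  have "(\<Sum>xs\<in>edge_seqs n t. f (take t xs)) = (\<Sum>xs\<in>edge_seqs n t. f xs)" for f :: "nat set list \<Rightarrow> real"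
    by (rule sum.cong) (auto simp: edge_seqs_def)
  then show ?case by (intro exI[of _ 1]) simp
next
  case (Suc d)
  then obtain c where c: "c > 0" "\<And>f::nat set list \<Rightarrow> real. (\<Sum>xs\<in>edge_seqs n (t + d). f (take t xs)) = c * (\<Sum>xs\<in>edge_seqs n t. f xs)"
    by auto
  define r where "r = real ((n choose 2) - (t + d))"
  have "(\<Sum>xs\<in>edge_seqs n (t + Suc d). f (take t xs)) = r * c * (\<Sum>xs\<in>edge_seqs n t. f xs)" for f :: "nat set list \<Rightarrow> real"
  proof -
    have "(\<Sum>xs\<in>edge_seqs n (t + Suc d). f (take t xs)) =
        (\<Sum>xs\<in>edge_seqs n (t + d). \<Sum>e\<in>Kn_edges n - set xs. f (take t (xs @ [e])))"
      by (simp only: add_Suc_right sum_DL_Suc)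
    also have "\<dots> = (\<Sum>xs\<in>edge_seqs n (t + d). r * f (take t xs))"
    proof (rule sum.cong[OF refl])
      fix xs assume xs: "xs \<in> edge_seqs n (t + d)"
      then have "take t (xs @ [e]) = take t xs" for e by (simp add: edge_seqs_def)
      then show "(\<Sum>e\<in>Kn_edges n - set xs. f (take t (xs @ [e]))) = r * f (take t xs)"
        using card_Kn_diff[OF xs] by (simp add: r_def)
    qed
    finally show ?thesis using c(2)[of f] by (simp add: sum_distrib_left[symmetric])
  qed
  moreover have "r * c > 0" using Suc.prems c by (simp add: r_def)
  ultimately show ?case by blast
qed

definition seq_mean :: "nat \<Rightarrow> nat \<Rightarrow> (nat set list \<Rightarrow> real) \<Rightarrow> real" where
  "seq_mean n t f = (\<Sum>xs\<in>edge_seqs n t. f xs) / real (card (edge_seqs n t))"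

lemma orderings_nonempty: "orderings n \<noteq> {}"
  using finite_distinct_list[OF finite_Kn[of n]] by (auto simp: orderings_def)

lemma card_DL_pos: assumes "t \<le> n choose 2" shows "0 < card (edge_seqs n t)"
proof -
  obtain es where "es \<in> orderings n" using orderings_nonempty by blast
  then have "take t es \<in> edge_seqs n t" using assms set_take_subset[of t es] by (auto simp: orderings_eq edge_seqs_def)
  then show ?thesis by (auto simp: card_gt_0_iff)
qed

lemma seq_mean_take:
  assumes "t \<le> t'" "t' \<le> n choose 2"
  shows "seq_mean n t' (\<lambda>xs. f (take t xs)) = seq_mean n t f"
proof -
  obtain c where c: "c > 0" "\<And>f::nat set list \<Rightarrow> real. (\<Sum>xs\<in>edge_seqs n t'. f (take t xs)) = c * (\<Sum>xs\<in>edge_seqs n t. f xs)"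
    using sum_DL_take[of t "t' - t" n] assms by auto
  have "real (card (edge_seqs n t')) = c * real (card (edge_seqs n t))" using c(2)[of "\<lambda>_. 1"] by simp
  then show ?thesis using c by (simp add: seq_mean_def)
qed

lemma prob_ord_avg:
  assumes "t \<le> n choose 2"
  shows "prob_ord n (\<lambda>es. Q (take t es)) = seq_mean n t (\<lambda>xs. of_bool (Q xs))"
proof -
  have "prob_ord n (\<lambda>es. Q (take t es)) = seq_mean n (n choose 2) (\<lambda>es. of_bool (Q (take t es)))"
    unfolding prob_ord_def seq_mean_def orderings_eq[symmetric] by (simp add: orderings_eq Int_def)
  then show ?thesis using seq_mean_take[OF assms order_refl] by simp
qed

lemma seq_mean_mono: "(\<And>xs. xs \<in> edge_seqs n t \<Longrightarrow> f xs \<le> g xs) \<Longrightarrow> seq_mean n t f \<le> seq_mean n t g"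
  unfolding seq_mean_def by (intro divide_right_mono sum_mono) auto

lemma seq_mean_cmult: "seq_mean n t (\<lambda>xs. c * f xs) = c * seq_mean n t f"
  by (simp add: seq_mean_def sum_distrib_left)

lemma seq_mean_const: "t \<le> n choose 2 \<Longrightarrow> seq_mean n t (\<lambda>_. c) = c"
  using card_DL_pos[of t n] by (auto simp: seq_mean_def)

text \<open>The tower property: given the first \<open>t\<close> edges, the next one is uniform
  among those remaining.\<close>

lemma avg_Suc:
  assumes "t < n choose 2"
  shows "seq_mean n (Suc t) f = seq_mean n t (\<lambda>xs. (\<Sum>e\<in>Kn_edges n - set xs. f (xs @ [e])) / real ((n choose 2) - t))"
proof -
  have "real (card (edge_seqs n (Suc t))) = (\<Sum>xs\<in>edge_seqs n (Suc t). 1)" by simp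
  also have "\<dots> = (\<Sum>xs\<in>edge_seqs n t. \<Sum>e\<in>Kn_edges n - set xs. 1)" by (rule sum_DL_Suc)
  also have "\<dots> = (\<Sum>xs\<in>edge_seqs n t. real ((n choose 2) - t))" using card_Kn_diff by (intro sum.cong) auto
  finally have "real (card (edge_seqs n (Suc t))) = real (card (edge_seqs n t)) * real ((n choose 2) - t)" by simp
  then have c: "real (card (edge_seqs n (Suc t))) = real ((n choose 2) - t) * real (card (edge_seqs n t))" by (simp only: mult.commute)
  show ?thesis unfolding seq_mean_def sum_DL_Suc c sum_divide_distrib[symmetric] by simp
qed

lemma prob_ord_mono: "(\<And>es. es \<in> orderings n \<Longrightarrow> Q es \<Longrightarrow> R es) \<Longrightarrow> prob_ord n Q \<le> prob_ord n R"
  unfolding prob_ord_def by (intro divide_right_mono of_nat_mono card_mono) (auto simp: orderings_eq)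

lemma prob_ord_le_1: "prob_ord n Q \<le> 1"
proof -
  have "prob_ord n Q \<le> prob_ord n (\<lambda>_. True)" by (rule prob_ord_mono) simp
  also have "\<dots> = 1" using orderings_nonempty[of n] by (simp add: prob_ord_def orderings_eq card_eq_0_iff)
  finally show ?thesis .
qed

lemma prob_ord_compl: "prob_ord n Q = 1 - prob_ord n (\<lambda>es. \<not> Q es)"
proof -
  have f: "finite (orderings n)" by (simp add: orderings_eq)
  have "{es \<in> orderings n. Q es} = orderings n - {es \<in> orderings n. \<not> Q es}" by auto
  then have "card {es \<in> orderings n. Q es} = card (orderings n) - card {es \<in> orderings n. \<not> Q es}"
    using f by (simp add: card_Diff_subset)
  moreover have "card {es \<in> orderings n. \<not> Q es} \<le> card (orderings n)" using f by (intro card_mono) auto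
  moreover have "card (orderings n) > 0" using f orderings_nonempty by (simp add: card_gt_0_iff)
  ultimately show ?thesis by (simp add: prob_ord_def field_simps of_nat_diff)
qed

lemma prob_ord_union: "prob_ord n (\<lambda>es. Q es \<or> R es) \<le> prob_ord n Q + prob_ord n R"
proof -
  have "{es \<in> orderings n. Q es \<or> R es} = {es \<in> orderings n. Q es} \<union> {es \<in> orderings n. R es}" by auto
  then have "real (card {es \<in> orderings n. Q es \<or> R es}) \<le> real (card {es \<in> orderings n. Q es}) + real (card {es \<in> orderings n. R es})"
    using card_Un_le by (simp flip: of_nat_add)
  then show ?thesis unfolding prob_ord_def add_divide_distrib[symmetric] by (intro divide_right_mono) auto
qed

lemma whpI:
  assumes "\<forall>\<^sub>F n in sequentially. prob_ord n (\<lambda>es. \<not> Q n es) \<le> g n" "g \<longlonglongrightarrow> 0"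
  shows "whp Q"
proof -
  have "\<forall>\<^sub>F n in sequentially. 1 - g n \<le> prob_ord n (Q n)"
    using assms(1)
  proof eventually_elim
    case (elim n)
    then show ?case using prob_ord_compl[of n "Q n"] by linarith
  qed
  moreover have "(\<lambda>n. 1 - g n) \<longlonglongrightarrow> 1"
    using tendsto_diff[OF tendsto_const assms(2), of 1] by simp
  moreover have "\<forall>\<^sub>F n in sequentially. prob_ord n (Q n) \<le> 1" by (simp add: prob_ord_le_1)
  ultimately show ?thesis unfolding whp_def using tendsto_sandwich tendsto_const by fast
qed

lemma sum_DL_set:
  "(\<Sum>xs\<in>edge_seqs n t. g (set xs)) = fact t * (\<Sum>E | E \<subseteq> Kn_edges n \<and> card E = t. g E)" for g :: "nat set set \<Rightarrow> real"
proof -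
  let ?T = "{E. E \<subseteq> Kn_edges n \<and> card E = t}"
  have "(\<Sum>xs\<in>edge_seqs n t. g (set xs)) = (\<Sum>E\<in>?T. \<Sum>xs | xs \<in> edge_seqs n t \<and> set xs = E. g (set xs))"
  proof (rule sum.group[of "edge_seqs n t" ?T set "\<lambda>xs. g (set xs)", symmetric])
    show "finite ?T" by (rule finite_subset[of _ "Pow (Kn_edges n)"]) auto
    show "set ` edge_seqs n t \<subseteq> ?T" by (auto simp: edge_seqs_def distinct_card)
  qed simp
  also have "\<dots> = (\<Sum>E\<in>?T. fact t * g E)"
  proof (rule sum.cong[OF refl])
    fix E assume "E \<in> ?T"
    then have E: "E \<subseteq> Kn_edges n" "card E = t" by simp_all
    then have fE: "finite E" using finite_subset finite_Kn by blast
    have "{xs. xs \<in> edge_seqs n t \<and> set xs = E} = permutations_of_set E"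
      using E distinct_card by (fastforce simp: edge_seqs_def permutations_of_set_def)
    then have c: "card {xs. xs \<in> edge_seqs n t \<and> set xs = E} = fact t"
      using card_permutations_of_set[OF fE] E(2) by simp
    have "(\<Sum>xs | xs \<in> edge_seqs n t \<and> set xs = E. g (set xs)) = (\<Sum>xs | xs \<in> edge_seqs n t \<and> set xs = E. g E)"
      by (rule sum.cong) auto
    then show "(\<Sum>xs | xs \<in> edge_seqs n t \<and> set xs = E. g (set xs)) = fact t * g E"
      unfolding sum_constant c by simp
  qed
  finally show ?thesis by (simp add: sum_distrib_left)
qed

section \<open>Transfer between the binomial model and a fixed number of edges\<close>

abbreviation prob_t :: "nat \<Rightarrow> nat \<Rightarrow> (nat set set \<Rightarrow> bool) \<Rightarrow> real" where
  "prob_t n t Q \<equiv> prob_ord n (\<lambda>es. Q (set (take t es)))"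

lemma prob_t_eq:
  assumes "t \<le> n choose 2"
  shows "real ((n choose 2) choose t) * prob_t n t Q = (\<Sum>E | E \<subseteq> Kn_edges n \<and> card E = t. of_bool (Q E))"
proof -
  have "prob_t n t Q = seq_mean n t (\<lambda>xs. of_bool (Q (set xs)))"
    using prob_ord_avg[OF assms, of "\<lambda>xs. Q (set xs)"] by simp
  moreover have "real (card (edge_seqs n t)) = fact t * real ((n choose 2) choose t)"
    using sum_DL_set[of "\<lambda>_. 1" n t] n_subsets[OF finite_Kn[of n], of t] by (simp add: card_Kn)
  moreover have "(n choose 2) choose t > 0" using assms by simp
  ultimately show ?thesis
    unfolding seq_mean_def sum_DL_set[of "\<lambda>E. of_bool (Q E)"] by simp
qed

text \<open>Given its number of edges, the binomial graph is uniform. The binomial weights are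
  Bernstein polynomials in \<open>p\<close>, whose known moment identities yield Chebyshev's
  inequality in \<open>Bernstein_tail\<close>.\<close>

lemma subset_mean_mixture:
  "subset_mean p (Kn_edges n) (\<lambda>E. of_bool (Q E)) = (\<Sum>t\<le>n choose 2. Bernstein (n choose 2) t p * prob_t n t Q)"
proof -
  let ?N = "n choose 2"
  have im: "card E \<le> ?N" if "E \<subseteq> Kn_edges n" for E
    using card_mono[OF finite_Kn that] by (simp add: card_Kn)
  have "subset_mean p (Kn_edges n) (\<lambda>E. of_bool (Q E)) = 
    (\<Sum>t\<le>?N. \<Sum>E | E \<in> Pow (Kn_edges n) \<and> card E = t. p ^ card E * (1 - p) ^ card (Kn_edges n - E) * of_bool (Q E))"
    unfolding subset_mean_def using im by (intro sum.group[symmetric]) auto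
  also have "\<dots> = (\<Sum>t\<le>?N. p ^ t * (1 - p) ^ (?N - t) * (\<Sum>E | E \<subseteq> Kn_edges n \<and> card E = t. of_bool (Q E)))"
    unfolding sum_distrib_left
  proof (intro sum.cong refl, goal_cases)
    case (2 t E)
    then have "card (Kn_edges n - E) = ?N - t"
      using card_Diff_subset[of E "Kn_edges n"] finite_subset[of E "Kn_edges n"] card_Kn[of n] by auto
    then show ?case using 2 by simp
  qed auto
  also have "\<dots> = (\<Sum>t\<le>?N. Bernstein ?N t p * prob_t n t Q)"
    by (intro sum.cong refl) (simp only: prob_t_eq[symmetric] Bernstein_def mult_ac atMost_iff)
  finally show ?thesis .
qed

lemma Bernstein_tail:
  assumes p: "0 \<le> p" "p \<le> 1" and d: "0 < d" and A: "\<And>k. k \<in> A \<Longrightarrow> k \<le> N \<and> d \<le> \<bar>real k - real N * p\<bar>"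
  shows "(\<Sum>k\<in>A. Bernstein N k p) \<le> real N * p / d\<^sup>2"
proof -
  have "(\<Sum>k\<in>A. Bernstein N k p) \<le> (\<Sum>k\<in>A. ((real k - real N * p) / d)\<^sup>2 * Bernstein N k p)"
  proof (rule sum_mono)
    fix k assume "k \<in> A"
    then have "d\<^sup>2 \<le> \<bar>real k - real N * p\<bar>\<^sup>2" using A d by (intro power_mono) auto
    then have "1 \<le> ((real k - real N * p) / d)\<^sup>2" using d by (simp add: power_divide)
    then have "1 * Bernstein N k p \<le> ((real k - real N * p) / d)\<^sup>2 * Bernstein N k p"
      using Bernstein_nonneg[OF p] by (intro mult_right_mono) auto
    then show "Bernstein N k p \<le> ((real k - real N * p) / d)\<^sup>2 * Bernstein N k p" by simp
  qed
  also have "\<dots> \<le> (\<Sum>k\<le>N. ((real k - real N * p) / d)\<^sup>2 * Bernstein N k p)"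
    using A Bernstein_nonneg[OF p] by (intro sum_mono2) auto
  also have "\<dots> = (\<Sum>k\<le>N. (real k - real N * p)\<^sup>2 * Bernstein N k p) / d\<^sup>2"
    by (simp add: sum_divide_distrib power_divide)
  also have "(\<Sum>k\<le>N. (real k - real N * p)\<^sup>2 * Bernstein N k p) =
     (\<Sum>k\<le>N. real k * (real k - 1) * Bernstein N k p + (1 - 2 * (real N * p)) * (real k * Bernstein N k p) + (real N * p)\<^sup>2 * Bernstein N k p)"
    by (intro sum.cong refl) (simp add: power2_eq_square algebra_simps)
  also have "\<dots> = (\<Sum>k\<le>N. real k * (real k - 1) * Bernstein N k p) + (1 - 2 * (real N * p)) * (\<Sum>k\<le>N. real k * Bernstein N k p)
      + (real N * p)\<^sup>2 * (\<Sum>k\<le>N. Bernstein N k p)"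
    unfolding sum.distrib sum_distrib_left ..
  also have "\<dots> = real N * (real N - 1) * p\<^sup>2 + (1 - 2 * (real N * p)) * (real N * p) + (real N * p)\<^sup>2"
    unfolding sum_Bernstein sum_k_Bernstein sum_kk_Bernstein by simp
  also have "\<dots> = real N * p * (1 - p)" by (simp add: power2_eq_square algebra_simps)
  also have "real N * p * (1 - p) / d\<^sup>2 \<le> real N * p * 1 / d\<^sup>2"
    using p by (intro divide_right_mono mult_left_mono) auto
  finally show ?thesis by simp
qed

text \<open>It is enough that the edge counts in \<open>A\<close> carry weight 1/4: a constant
  factor is harmless, because the probabilities to be transferred tend to 0.\<close>

lemma prob_t_mixture:
  assumes p: "0 \<le> p" "p \<le> 1" and A: "A \<subseteq> {..n choose 2}" 
    and mono: "\<And>k. k \<in> A \<Longrightarrow> prob_t n t Q \<le> prob_t n k Q"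
    and tail: "(\<Sum>k\<in>{..n choose 2} - A. Bernstein (n choose 2) k p) \<le> 3 / 4"
  shows "prob_t n t Q \<le> 4 * subset_mean p (Kn_edges n) (\<lambda>E. of_bool (Q E))"
proof -
  let ?N = "n choose 2"
  have p0: "0 \<le> prob_t n k Q" for k by (simp add: prob_ord_def)
  have "(\<Sum>k\<in>A. Bernstein ?N k p) + (\<Sum>k\<in>{..?N} - A. Bernstein ?N k p) = 1"
    using sum.subset_diff[OF A, of "\<lambda>k. Bernstein ?N k p"] sum_Bernstein[of ?N p] by simp
  then have "1 / 4 \<le> (\<Sum>k\<in>A. Bernstein ?N k p)" using tail by simp
  then have "1 / 4 * prob_t n t Q \<le> (\<Sum>k\<in>A. Bernstein ?N k p) * prob_t n t Q"
    using p0 by (intro mult_right_mono) auto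
  also have "\<dots> = (\<Sum>k\<in>A. Bernstein ?N k p * prob_t n t Q)" by (rule sum_distrib_right)
  also have "\<dots> \<le> (\<Sum>k\<in>A. Bernstein ?N k p * prob_t n k Q)"
    using mono Bernstein_nonneg[OF p] by (intro sum_mono mult_left_mono) auto
  also have "\<dots> \<le> (\<Sum>k\<le>?N. Bernstein ?N k p * prob_t n k Q)"
    using A p0 Bernstein_nonneg[OF p] by (intro sum_mono2) auto
  finally show ?thesis by (simp add: subset_mean_mixture)
qed

lemma prob_t_mono:
  assumes "\<And>E E'. E \<subseteq> E' \<Longrightarrow> E' \<subseteq> Kn_edges n \<Longrightarrow> Q E \<Longrightarrow> Q E'" "t \<le> k"
  shows "prob_t n t Q \<le> prob_t n k Q"
proof (rule prob_ord_mono)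
  fix es assume es: "es \<in> orderings n" "Q (set (take t es))"
  have "set (take k es) \<subseteq> Kn_edges n" using es(1) set_take_subset[of k es] by (simp add: orderings_def)
  then show "Q (set (take k es))" by (rule assms(1)[OF set_take_subset_set_take[OF assms(2)] _ es(2)])
qed

lemma prob_t_antimono:
  assumes "\<And>E E'. E \<subseteq> E' \<Longrightarrow> E' \<subseteq> Kn_edges n \<Longrightarrow> Q E' \<Longrightarrow> Q E" "k \<le> t"
  shows "prob_t n t Q \<le> prob_t n k Q"
proof (rule prob_ord_mono)
  fix es assume es: "es \<in> orderings n" "Q (set (take t es))"
  have "set (take t es) \<subseteq> Kn_edges n" using es(1) set_take_subset[of t es] by (simp add: orderings_def)
  then show "Q (set (take k es))" by (rule assms(1)[OF set_take_subset_set_take[OF assms(2)] _ es(2)])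
qed

text \<open>The mean edge count is placed \<open>2 * sqrt t\<close> above \<open>t\<close>.
  Chebyshev leaves weight at most (t + 2 sqrt t) / (4 t), hence at most 3/4, on counts below
  \<open>t\<close>.\<close>

lemma prob_t_increasing:
  assumes inc: "\<And>E E'. E \<subseteq> E' \<Longrightarrow> E' \<subseteq> Kn_edges n \<Longrightarrow> Q E \<Longrightarrow> Q E'"
    and t: "1 \<le> t" "real t + 2 * sqrt (real t) \<le> real (n choose 2)"
  shows "prob_t n t Q \<le> 4 * subset_mean ((real t + 2 * sqrt (real t)) / real (n choose 2)) (Kn_edges n) (\<lambda>E. of_bool (Q E))"
proof -
  let ?N = "n choose 2" let ?p = "(real t + 2 * sqrt (real t)) / real ?N"
  have s0: "0 < sqrt (real t)" using t by simp
  have N0: "real ?N > 0" using t s0 by linarith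
  then have p: "0 \<le> ?p" "?p \<le> 1" using t s0 by (auto simp: field_simps)
  have Np: "real ?N * ?p = real t + 2 * sqrt (real t)" using N0 by simp
  have "1 \<le> sqrt (real t)" using t by simp
  then have "1 * sqrt (real t) \<le> sqrt (real t) * sqrt (real t)" using s0 by (intro mult_right_mono) auto
  then have st: "sqrt (real t) \<le> real t" by simp
  have "(\<Sum>k\<in>{..?N} - {t..?N}. Bernstein ?N k ?p) \<le> real ?N * ?p / (2 * sqrt (real t))\<^sup>2"
  proof (rule Bernstein_tail[OF p])
    show "k \<le> ?N \<and> 2 * sqrt (real t) \<le> \<bar>real k - real ?N * ?p\<bar>" if "k \<in> {..?N} - {t..?N}" for k
      unfolding Np using that s0 by auto
  qed (use s0 in simp)
  also have "(2 * sqrt (real t))\<^sup>2 = 4 * real t" by (simp add: power_mult_distrib)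
  also have "real ?N * ?p / (4 * real t) \<le> 3 / 4"
    unfolding Np using st t by (intro divide_le_eq[THEN iffD2]) auto
  finally have "(\<Sum>k\<in>{..?N} - {t..?N}. Bernstein ?N k ?p) \<le> 3 / 4" .
  then show ?thesis
  proof (rule prob_t_mixture[OF p, rotated 2])
    show "prob_t n t Q \<le> prob_t n k Q" if "k \<in> {t..?N}" for k
      by (rule prob_t_mono[OF inc]) (use that in simp_all)
  qed simp
qed

text \<open>The mirror image, with the mean edge count below \<open>t\<close>;
  \<open>4 \<le> t\<close> keeps that mean nonnegative.\<close>

lemma prob_t_decreasing:
  assumes dec: "\<And>E E'. E \<subseteq> E' \<Longrightarrow> E' \<subseteq> Kn_edges n \<Longrightarrow> Q E' \<Longrightarrow> Q E"
    and t: "4 \<le> t" "t \<le> n choose 2"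
  shows "prob_t n t Q \<le> 4 * subset_mean ((real t - 2 * sqrt (real t)) / real (n choose 2)) (Kn_edges n) (\<lambda>E. of_bool (Q E))"
proof -
  let ?N = "n choose 2" let ?p = "(real t - 2 * sqrt (real t)) / real ?N"
  have "0 < ?N" using t by linarith
  then have N0: "real ?N > 0" by (rule of_nat_0_less_iff[THEN iffD2])
  have s0: "2 \<le> sqrt (real t)" using t by (intro real_le_rsqrt) simp
  then have "2 * sqrt (real t) \<le> sqrt (real t) * sqrt (real t)" by (intro mult_right_mono) auto
  then have st: "2 * sqrt (real t) \<le> real t" by simp
  have "real t \<le> real ?N" using t by simp
  then have "real t - 2 * sqrt (real t) \<le> real ?N" using s0 by linarith
  then have p: "0 \<le> ?p" "?p \<le> 1" using st N0 by (auto simp: field_simps)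
  have Np: "real ?N * ?p = real t - 2 * sqrt (real t)" using N0 by simp
  have "(\<Sum>k\<in>{..?N} - {..t}. Bernstein ?N k ?p) \<le> real ?N * ?p / (2 * sqrt (real t))\<^sup>2"
  proof (rule Bernstein_tail[OF p])
    show "k \<le> ?N \<and> 2 * sqrt (real t) \<le> \<bar>real k - real ?N * ?p\<bar>" if "k \<in> {..?N} - {..t}" for k
      unfolding Np using that s0 by auto
  qed (use s0 t in simp)
  also have "(2 * sqrt (real t))\<^sup>2 = 4 * real t" by (simp add: power_mult_distrib)
  also have "real ?N * ?p / (4 * real t) \<le> 3 / 4"
    unfolding Np using s0 t by (intro divide_le_eq[THEN iffD2]) auto
  finally have "(\<Sum>k\<in>{..?N} - {..t}. Bernstein ?N k ?p) \<le> 3 / 4" .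
  then show ?thesis
  proof (rule prob_t_mixture[OF p, rotated 2])
    show "prob_t n t Q \<le> prob_t n k Q" if "k \<in> {..t}" for k
      by (rule prob_t_antimono[OF dec]) (use that in simp_all)
  qed (use t in simp)
qed

section \<open>The constrained process\<close>

definition proc_graph :: "graph set \<Rightarrow> nat \<Rightarrow> nat set list \<Rightarrow> graph" where
  "proc_graph P n xs = foldl (proc_step P) ({1..n}, {}) xs"

definition proc_edges :: "graph set \<Rightarrow> nat \<Rightarrow> nat set list \<Rightarrow> nat set set" where
  "proc_edges P n xs = snd (proc_graph P n xs)"

lemma proc_graph_eq: "proc_graph P n xs = ({1..n}, proc_edges P n xs)"
proof -
  have "fst (proc_graph P n xs) = {1..n}"
    by (induction xs rule: rev_induct) (auto simp: proc_graph_def proc_step_def)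
  then show ?thesis unfolding proc_edges_def by (simp add: prod_eq_iff)
qed

lemma proc_eq: "proc P n es t = ({1..n}, proc_edges P n (take t es))"
  unfolding proc_graph_eq[symmetric] by (simp add: proc_def proc_graph_def)

lemma PE_Nil [simp]: "proc_edges P n [] = {}"
  by (simp add: proc_edges_def proc_graph_def)

lemma proc_edges_snoc: "proc_edges P n (xs @ [e]) = (if ({1..n}, insert e (proc_edges P n xs)) \<in> P then insert e (proc_edges P n xs) else proc_edges P n xs)"
proof -
  have "proc_graph P n (xs @ [e]) = proc_step P ({1..n}, proc_edges P n xs) e"
    unfolding proc_graph_eq[symmetric] by (simp add: proc_graph_def)
  then show ?thesis unfolding proc_edges_def[of P n "xs @ [e]"] by (simp add: proc_step_def)
qed

lemma proc_edges_subset: "proc_edges P n xs \<subseteq> set xs"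
  by (induction xs rule: rev_induct) (auto simp: proc_edges_snoc)

text \<open>Edges already present count as open, so that the forbidden pairs are exactly the
  complement in \<open>Kn_edges n\<close>.\<close>

definition open_pairs :: "graph set \<Rightarrow> nat \<Rightarrow> nat set list \<Rightarrow> nat set set" where
  "open_pairs P n xs = {e \<in> Kn_edges n. ({1..n}, insert e (proc_edges P n xs)) \<in> P}"

lemma finite_Opn [simp]: "finite (open_pairs P n xs)"
  by (simp add: open_pairs_def)

locale constrained_process =
  fixes P :: "graph set"
  assumes constrained_process: "admissible_class P"
begin

lemma edgeless: "finite V \<Longrightarrow> (V, {}) \<in> P"
proof -
  have "\<forall>V. finite V \<longrightarrow> (V, {}) \<in> P" using constrained_process unfolding admissible_class_def by (elim conjE)
  then show "finite V \<Longrightarrow> (V, {}) \<in> P" by (elim allE impE)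
qed

lemma minor_closed:
  assumes "G \<in> P" "is_graph H" "is_minor H G" shows "H \<in> P"
proof -
  have "\<forall>G H. G \<in> P \<and> is_graph H \<and> is_minor H G \<longrightarrow> H \<in> P"
    using constrained_process unfolding admissible_class_def by (elim conjE)
  from this[rule_format, of G H] show ?thesis using assms by simp
qed

lemma weakly_addable: "(V, E) \<in> P \<Longrightarrow> u \<in> V \<Longrightarrow> v \<in> V \<Longrightarrow> \<not> same_component (V, E) u v \<Longrightarrow> (V, insert {u, v} E) \<in> P"
proof -
  assume *: "(V, E) \<in> P" "u \<in> V" "v \<in> V" "\<not> same_component (V, E) u v"
  have "\<forall>G u v. G \<in> P \<and> u \<in> fst G \<and> v \<in> fst G \<and> \<not> same_component G u v \<longrightarrow> add_edge G u v \<in> P"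
    using constrained_process unfolding admissible_class_def by (elim conjE)
  from this[rule_format, of "(V, E)" u v] * show "(V, insert {u, v} E) \<in> P" by (simp add: add_edge_def)
qed

lemma is_graph_iff: "is_graph (V, E) \<longleftrightarrow> finite V \<and> E \<subseteq> pairs V"
  by (simp add: is_graph_def pairs_def)

lemma excluded: obtains V0 E0 where "finite V0" "E0 \<subseteq> pairs V0" "(V0, E0) \<notin> P"
proof -
  have "\<exists>G. is_graph G \<and> G \<notin> P" using constrained_process unfolding admissible_class_def by (elim conjE)
  then obtain G where "is_graph G \<and> G \<notin> P" by (rule exE)
  then show ?thesis using that[of "fst G" "snd G"] is_graph_iff[of "fst G" "snd G"] by simp
qed

lemma subgraph_closed:
  assumes "(V, E) \<in> P" "finite V" "E' \<subseteq> E" "E' \<subseteq> pairs V"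
  shows "(V, E') \<in> P"
proof (rule minor_closed[OF assms(1)])
  show "is_graph (V, E')" using assms by (simp add: is_graph_iff)
  show "is_minor (V, E') (V, E)"
    unfolding is_minor_def fst_conv snd_conv
  proof (intro exI[of _ "\<lambda>v. {v}"] conjI ballI impI)
    fix v assume v: "v \<in> V"
    then show "{v} \<subseteq> V" by simp
    have "fst (induced (V, E) {v}) = {v}" using v by (simp add: induced_def)
    then show "connected_graph (induced (V, E) {v})" by (simp add: connected_graph_def)
  next
    fix u v assume "{u, v} \<in> E'"
    then have "{u, v} \<in> E" using assms(3) by (rule subsetD[rotated])
    then show "\<exists>x\<in>{u}. \<exists>y\<in>{v}. {x, y} \<in> E" by simp
  qed simp
qed

lemma proc_edges_in: "({1..n}, proc_edges P n xs) \<in> P"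
  by (induction xs rule: rev_induct) (auto simp: proc_edges_snoc edgeless)

lemma proc_edges_mono_snoc: "proc_edges P n xs \<subseteq> proc_edges P n (xs @ [e])"
  by (auto simp: proc_edges_snoc)

lemma proc_edges_mono_append: "proc_edges P n xs \<subseteq> proc_edges P n (xs @ ys)"
proof (induction ys rule: rev_induct)
  case (snoc e ys)
  then show ?case using proc_edges_mono_snoc[of n "xs @ ys" e] by (simp del: append_assoc add: append_assoc[symmetric])
qed simp

lemma adj_rel_eq: "E \<subseteq> pairs V \<Longrightarrow> adj_rel (V, E) = edge_rel E"
proof -
  assume E: "E \<subseteq> pairs V"
  have "x \<in> V \<and> y \<in> V \<and> x \<noteq> y" if "{x, y} \<in> E" for x y
    using subsetD[OF E that] by (simp add: in_pairs_iff)
  then show "adj_rel (V, E) = edge_rel E" by (auto simp: adj_rel_def edge_rel_def)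
qed

lemma edge_rel_insert: "edge_rel (insert {u, v} E) = {(u, v), (v, u)} \<union> edge_rel E"
  by (auto simp: edge_rel_def doubleton_eq_iff)

text \<open>By weak addability a rejected edge has both ends in one component, so accepting it would
  not have changed reachability.\<close>

lemma proc_edges_same_components:
  "set xs \<subseteq> Kn_edges n \<Longrightarrow> (edge_rel (proc_edges P n xs))\<^sup>* = (edge_rel (set xs))\<^sup>*"
proof (induction xs rule: rev_induct)
  case (snoc e xs)
  then have IH: "(edge_rel (proc_edges P n xs))\<^sup>* = (edge_rel (set xs))\<^sup>*" and e: "e \<in> pairs {1..n}" by (auto simp: Kn_edges_eq)
  have sub: "proc_edges P n xs \<subseteq> pairs {1..n}" using proc_edges_subset[of P n xs] snoc.prems by (auto simp: Kn_edges_eq)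
  obtain u v where uv: "e = {u, v}" "u \<in> {1..n}" "v \<in> {1..n}" using e by (rule pairs_cases)
  have set: "edge_rel (set (xs @ [e])) = {(u, v), (v, u)} \<union> edge_rel (set xs)"
    using edge_rel_insert[of u v "set xs"] uv by simp
  have "({(u, v), (v, u)} \<union> edge_rel (proc_edges P n xs))\<^sup>* = ({(u, v), (v, u)} \<union> (edge_rel (proc_edges P n xs))\<^sup>*)\<^sup>*"
    by (metis rtrancl_Un_rtrancl rtrancl_idemp)
  also have "\<dots> = ({(u, v), (v, u)} \<union> (edge_rel (set xs))\<^sup>*)\<^sup>*" by (simp only: IH)
  also have "\<dots> = (edge_rel (set (xs @ [e])))\<^sup>*" unfolding set by (metis rtrancl_Un_rtrancl rtrancl_idemp)
  finally have *: "({(u, v), (v, u)} \<union> edge_rel (proc_edges P n xs))\<^sup>* = (edge_rel (set (xs @ [e])))\<^sup>*" .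
  show ?case
  proof (cases "({1..n}, insert e (proc_edges P n xs)) \<in> P")
    case True
    then show ?thesis using * edge_rel_insert[of u v "proc_edges P n xs"] uv by (simp add: proc_edges_snoc)
  next
    case False
    have "same_component ({1..n}, proc_edges P n xs) u v"
      using False weakly_addable[OF proc_edges_in] uv by metis
    then have uv': "(u, v) \<in> (edge_rel (proc_edges P n xs))\<^sup>*" unfolding same_component_def adj_rel_eq[OF sub] by simp
    then have "({(u, v), (v, u)} \<union> edge_rel (proc_edges P n xs))\<^sup>* = (edge_rel (proc_edges P n xs))\<^sup>*"
      using edge_rel_rtrancl_sym[OF uv'] by (intro rtrancl_subset) auto
    then show ?thesis using * False by (simp add: proc_edges_snoc)
  qed
qed simp

lemma reach_PE: "set xs \<subseteq> Kn_edges n \<Longrightarrow> reach (proc_edges P n xs) A = reach (set xs) A"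
  by (simp add: reach_def proc_edges_same_components)

lemma proc_edges_pairs: "set xs \<subseteq> Kn_edges n \<Longrightarrow> proc_edges P n xs \<subseteq> pairs {1..n}"
  using proc_edges_subset[of P n xs] by (auto simp: Kn_edges_eq)

lemma open_pairs_antimono_snoc:
  assumes "set (xs @ [e]) \<subseteq> Kn_edges n"
  shows "open_pairs P n (xs @ [e]) \<subseteq> open_pairs P n xs"
proof
  fix a assume a: "a \<in> open_pairs P n (xs @ [e])"
  then have "({1..n}, insert a (proc_edges P n (xs @ [e]))) \<in> P" "a \<in> Kn_edges n" by (auto simp: open_pairs_def)
  moreover have "insert a (proc_edges P n xs) \<subseteq> insert a (proc_edges P n (xs @ [e]))" using proc_edges_mono_snoc by (intro insert_mono)
  moreover have "insert a (proc_edges P n xs) \<subseteq> pairs {1..n}"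
    using proc_edges_pairs[of xs n] assms calculation(2) by (auto simp: Kn_edges_eq)
  ultimately show "a \<in> open_pairs P n xs" using subgraph_closed[of "{1..n}"] by (simp add: open_pairs_def)
qed

lemma forb_eq:
  assumes "set (take t es) \<subseteq> Kn_edges n"
  shows "forb P (proc P n es t) = card (Kn_edges n - open_pairs P n (take t es))"
proof -
  have K: "(\<exists>u\<in>{1..n}. \<exists>v\<in>{1..n}. u \<noteq> v \<and> e = {u, v}) \<longleftrightarrow> e \<in> Kn_edges n" for e
    unfolding Kn_edges_def by blast
  have "{e. e \<in> Kn_edges n \<and> e \<notin> proc_edges P n (take t es) \<and> ({1..n}, insert e (proc_edges P n (take t es))) \<notin> P}
      = Kn_edges n - open_pairs P n (take t es)"
    using proc_edges_in[of n "take t es"] unfolding open_pairs_def by (auto simp: insert_absorb)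
  then show ?thesis unfolding forb_def proc_eq fst_conv snd_conv K by simp
qed

lemma card_ordered_pairs:
  assumes "finite F" "F \<subseteq> pairs V" shows "card {(u, v). {u, v} \<in> F} = 2 * card F"
  using assms
proof (induction F rule: finite_induct)
  case (insert e F)
  then obtain a b where ab: "e = {a, b}" "a \<noteq> b" using pairs_cases[of e V] by (metis insert_subset)
  have "{(u, v). {u, v} \<in> insert e F} = {(a, b), (b, a)} \<union> {(u, v). {u, v} \<in> F}"
    using ab by (auto simp: doubleton_eq_iff)
  moreover have "{(a, b), (b, a)} \<inter> {(u, v). {u, v} \<in> F} = {}"
    using insert(2) ab by (auto simp: insert_commute)
  moreover have "finite {(u, v). {u, v} \<in> F}"
  proof -
    have "\<Union>F \<times> \<Union>F \<supseteq> {(u, v). {u, v} \<in> F}" by auto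
    moreover have "finite (\<Union>F)" using insert(1,4) by (intro finite_Union) (auto simp: pairs_def)
    ultimately show ?thesis using finite_subset by blast
  qed
  ultimately have "card {(u, v). {u, v} \<in> insert e F} = card {(a, b), (b, a)} + card {(u, v). {u, v} \<in> F}"
    by (metis card_Un_disjoint finite.emptyI finite_insert)
  then show ?case using insert ab by simp
qed simp

lemma forb_upper:
  assumes "set (take t es) \<subseteq> Kn_edges n"
  shows "2 * real (forb P (proc P n es t)) \<le> (\<Sum>v\<in>{1..n}. real (comp_size (set (take t es)) v))"
proof -
  define xs where "xs = take t es"
  have xs: "set xs \<subseteq> Kn_edges n" using assms by (simp add: xs_def)
  let ?F = "Kn_edges n - open_pairs P n xs"
  have sub: "reach (set xs) {u} \<subseteq> {1..n}" if "u \<in> {1..n}" for u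
    using xs that by (intro reach_subset_verts) (auto simp: Kn_edges_eq)
  have "{(u, v). {u, v} \<in> ?F} \<subseteq> (SIGMA u:{1..n}. reach (set xs) {u})"
  proof (rule subrelI)
    fix u v assume "(u, v) \<in> {(u, v). {u, v} \<in> ?F}"
    then have uv: "{u, v} \<in> Kn_edges n" "{u, v} \<notin> open_pairs P n xs" by simp_all
    then have 1: "u \<in> {1..n}" "v \<in> {1..n}" by (simp_all add: Kn_edges_eq in_pairs_iff)
    have "({1..n}, insert {u, v} (proc_edges P n xs)) \<notin> P" using uv by (simp add: open_pairs_def)
    then have "same_component ({1..n}, proc_edges P n xs) u v" using weakly_addable[OF proc_edges_in 1] by blast
    then have "v \<in> reach (proc_edges P n xs) {u}" 
      unfolding same_component_def adj_rel_eq[OF proc_edges_pairs[OF xs]] reach_def by simp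
    then show "(u, v) \<in> (SIGMA u:{1..n}. reach (set xs) {u})" using 1 by (simp add: reach_PE[OF xs])
  qed
  then have "card {(u, v). {u, v} \<in> ?F} \<le> card (SIGMA u:{1..n}. reach (set xs) {u})"
    using sub finite_subset by (intro card_mono finite_SigmaI) blast+
  also have "\<dots> = (\<Sum>u\<in>{1..n}. comp_size (set xs) u)" using sub finite_subset unfolding comp_size_def by (intro card_SigmaI) blast+
  also have "card {(u, v). {u, v} \<in> ?F} = 2 * card ?F"
    by (rule card_ordered_pairs[of _ "{1..n}"]) (auto simp: Kn_edges_eq)
  finally show ?thesis unfolding forb_eq[OF assms] xs_def by (simp flip: of_nat_sum)
qed

text \<open>A denser family would contain a clique model with as many branch sets as
  \<open>V0\<close> has vertices, and a clique of that order has the excluded graph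
  \<open>(V0, E0)\<close> as a subgraph.\<close>

lemma card_adjR_bound:
  assumes G: "finite V0" "E0 \<subseteq> pairs V0" "(V0, E0) \<notin> P" and xs: "set xs \<subseteq> Kn_edges n"
    and F: "conn_set_family (proc_edges P n xs) F" "\<Union>F \<subseteq> {1..n}" "card F \<le> M"
  shows "card (adjacent_pairs (proc_edges P n xs) F) \<le> 2 ^ card V0 * M"
proof (rule ccontr)
  assume c: "\<not> ?thesis"
  let ?E = "proc_edges P n xs"
  have "F \<noteq> {}"
  proof
    assume "F = {}" then have "adjacent_pairs ?E F = {}" by (simp add: adjacent_pairs_def)
    then show False using c by simp
  qed
  moreover have "2 ^ card V0 * card F \<le> 2 ^ card V0 * M" using F(3) by simp
  ultimately have "\<exists>H. conn_set_family ?E H \<and> card H = card V0 \<and> (\<forall>B\<in>H. \<forall>B'\<in>H. B \<noteq> B' \<longrightarrow> sets_adjacent ?E B B') \<and>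
     (\<forall>B\<in>H. \<exists>A\<in>F. A \<subseteq> B) \<and> \<Union>H \<subseteq> \<Union>F"
  proof (intro dense_family_has_clique_model[OF F(1)])
    assume "2 ^ card V0 * card F \<le> 2 ^ card V0 * M"
    then show "2 ^ card V0 * card F \<le> card (adjacent_pairs ?E F)" using c by linarith
  qed
  then obtain H where H0: "conn_set_family ?E H \<and> card H = card V0 \<and> (\<forall>B\<in>H. \<forall>B'\<in>H. B \<noteq> B' \<longrightarrow> sets_adjacent ?E B B') \<and>
     (\<forall>B\<in>H. \<exists>A\<in>F. A \<subseteq> B) \<and> \<Union>H \<subseteq> \<Union>F"
    by (rule exE)
  then have H: "conn_set_family ?E H" "card H = card V0" "\<And>B B'. B \<in> H \<Longrightarrow> B' \<in> H \<Longrightarrow> B \<noteq> B' \<Longrightarrow> sets_adjacent ?E B B'" and "\<Union>H \<subseteq> \<Union>F"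
    by simp_all
  then have H4: "\<Union>H \<subseteq> {1..n}" using F(2) order_trans by blast
  have "finite H" using H(1) by (simp add: conn_set_family_def)
  then obtain b where b: "bij_betw b V0 H" using finite_same_card_bij[OF G(1)] H(2) by metis
  have bH: "b v \<in> H" if "v \<in> V0" for v using b that by (auto simp: bij_betw_def)
  have bne: "b u \<noteq> b v" if "u \<in> V0" "v \<in> V0" "u \<noteq> v" for u v using b that by (auto simp: bij_betw_def inj_on_def)
  have "is_minor (V0, E0) ({1..n}, ?E)"
    unfolding is_minor_def fst_conv snd_conv
  proof (intro exI[of _ b] conjI ballI impI)
    fix v assume v: "v \<in> V0"
    have "b v \<subseteq> \<Union>H" using bH[OF v] by (rule Union_upper)
    then show s: "b v \<subseteq> {1..n}" using H4 by (rule order_trans)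
    have "conn_set ?E (b v)" using H(1) bH[OF v] by (simp add: conn_set_family_def)
    then show "connected_graph (induced ({1..n}, ?E) (b v))" by (rule conn_set_connected_graph[OF _ s proc_edges_pairs[OF xs]])
  next
    fix u v assume "u \<in> V0" "v \<in> V0" "u \<noteq> v"
    then show "b u \<inter> b v = {}" using H(1) bH bne by (simp add: conn_set_family_def)
  next
    fix u v assume uv: "u \<in> V0" "v \<in> V0" "{u, v} \<in> E0"
    then have "{u, v} \<in> pairs V0" using G(2) by auto
    then have "u \<noteq> v" by (simp add: in_pairs_iff)
    then have "sets_adjacent ?E (b u) (b v)" using H(3) bH bne uv by simp
    then show "\<exists>x\<in>b u. \<exists>y\<in>b v. {x, y} \<in> ?E" by (simp add: sets_adjacent_def)
  qed
  then have "(V0, E0) \<in> P" using minor_closed[OF proc_edges_in] G(1,2) is_graph_iff by simp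
  then show False using G(3) by simp
qed


text \<open>A rejected edge stays forbidden while the graph grows. Hence an open pair that is not
  yet an edge has not been drawn and is still among the edges to come.\<close>

lemma set_PE_or_not_open:
  "set xs \<subseteq> Kn_edges n \<Longrightarrow> e \<in> set xs \<Longrightarrow> e \<in> proc_edges P n xs \<or> e \<notin> open_pairs P n xs"
proof (induction xs rule: rev_induct)
  case (snoc a xs)
  show ?case
  proof (cases "e \<in> set xs")
    case True
    then have "e \<in> proc_edges P n xs \<or> e \<notin> open_pairs P n xs" using snoc by simp
    then show ?thesis using proc_edges_mono_snoc[of n xs a] open_pairs_antimono_snoc[OF snoc.prems(1)] by auto
  next
    case False
    then have "e = a" using snoc.prems by simp
    then show ?thesis using open_pairs_antimono_snoc[OF snoc.prems(1)] by (auto simp: proc_edges_snoc open_pairs_def split: if_splits)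
  qed
qed simp

lemma (in -) cross_pairs_bound:
  assumes F: "finite F" "\<And>B. B \<in> F \<Longrightarrow> finite B \<and> card B \<le> b" and R: "R \<subseteq> F \<times> F" "finite R"
  shows "card (\<Union>(B, B')\<in>R. (\<lambda>(x, y). {x, y}) ` (B \<times> B')) \<le> card R * b\<^sup>2"
proof -
  have "card (\<Union>(B, B')\<in>R. (\<lambda>(x, y). {x, y}) ` (B \<times> B')) \<le> (\<Sum>q\<in>R. card (case q of (B, B') \<Rightarrow> (\<lambda>(x, y). {x, y}) ` (B \<times> B')))"
    by (rule card_UN_le[OF R(2)])
  also have "\<dots> \<le> (\<Sum>q\<in>R. b\<^sup>2)"
  proof (rule sum_mono)
    fix q assume "q \<in> R"
    then obtain B B' where q: "q = (B, B')" "B \<in> F" "B' \<in> F" using R by (cases q) auto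
    have "card ((\<lambda>(x, y). {x, y}) ` (B \<times> B')) \<le> card (B \<times> B')" using F(2) q by (intro card_image_le) simp
    also have "\<dots> = card B * card B'" by (rule card_cartesian_product)
    also have "\<dots> \<le> b * b" using F(2) q by (intro mult_le_mono) auto
    finally show "card (case q of (B, B') \<Rightarrow> (\<lambda>(x, y). {x, y}) ` (B \<times> B')) \<le> b\<^sup>2"
      using q by (simp add: power2_eq_square)
  qed
  finally show ?thesis by simp
qed


section \<open>Connected pieces and sprinkling\<close>

definition new_open :: "nat \<Rightarrow> nat set list \<Rightarrow> nat set set \<Rightarrow> nat set set" where
  "new_open n xs F = {e \<in> open_pairs P n xs. \<exists>B\<in>F. \<exists>B'\<in>F. B \<noteq> B' \<and> \<not> sets_adjacent (proc_edges P n xs) B B' \<and> (\<exists>x\<in>B. \<exists>y\<in>B'. e = {x, y})}"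

lemma new_open_props:
  assumes "set xs \<subseteq> Kn_edges n" "conn_set_family E F" "e \<in> new_open n xs F"
  shows "e \<in> Kn_edges n - set xs" "card (adjacent_pairs (proc_edges P n xs) F) < card (adjacent_pairs (proc_edges P n (xs @ [e])) F)"
proof -
  from assms(3) obtain B B' x y where B: "B \<in> F" "B' \<in> F" "B \<noteq> B'" "\<not> sets_adjacent (proc_edges P n xs) B B'" "x \<in> B" "y \<in> B'" "e = {x, y}"
    and e: "e \<in> open_pairs P n xs" unfolding new_open_def by auto
  have "e \<notin> proc_edges P n xs" using B by (auto simp: sets_adjacent_def)
  then show "e \<in> Kn_edges n - set xs" using set_PE_or_not_open[OF assms(1)] e by (auto simp: open_pairs_def)
  have "e \<in> proc_edges P n (xs @ [e])" using e by (simp add: proc_edges_snoc open_pairs_def)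
  then have "sets_adjacent (proc_edges P n (xs @ [e])) B B'" using B unfolding sets_adjacent_def by auto
  then have "(B, B') \<in> adjacent_pairs (proc_edges P n (xs @ [e])) F - adjacent_pairs (proc_edges P n xs) F" using B by (simp add: adjacent_pairs_def)
  moreover have "adjacent_pairs (proc_edges P n xs) F \<subseteq> adjacent_pairs (proc_edges P n (xs @ [e])) F"
    using proc_edges_mono_snoc[of n xs e] unfolding adjacent_pairs_def sets_adjacent_def by blast
  ultimately have "adjacent_pairs (proc_edges P n xs) F \<subset> adjacent_pairs (proc_edges P n (xs @ [e])) F" by auto
  then show "card (adjacent_pairs (proc_edges P n xs) F) < card (adjacent_pairs (proc_edges P n (xs @ [e])) F)"
    using assms(2) by (intro psubset_card_mono) (auto simp: conn_set_family_def)
qed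

text \<open>The exceptions are pairs within one piece or between two adjacent pieces: at most
  \<open>M + a\<close> pairs of pieces, each with at most b^2 pairs of vertices.\<close>

lemma card_new_open:
  assumes F: "finite F" "\<Union>F \<subseteq> {1..n}" "\<And>B. B \<in> F \<Longrightarrow> card B \<le> b" "card F \<le> M"
    and a: "card (adjacent_pairs (proc_edges P n xs) F) \<le> a"
  shows "card (open_pairs P n xs \<inter> pairs (\<Union>F)) \<le> card (new_open n xs F) + (M + a) * b\<^sup>2"
proof -
  let ?R = "adjacent_pairs (proc_edges P n xs) F \<union> (\<lambda>B. (B, B)) ` F"
  let ?X = "\<Union>(B, B')\<in>?R. (\<lambda>(x, y). {x, y}) ` (B \<times> B')"
  have fB: "finite B" if "B \<in> F" for B using that F(2) finite_subset[of B "{1..n}"] by auto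
  have fR: "finite ?R" using F(1) by simp
  have "open_pairs P n xs \<inter> pairs (\<Union>F) \<subseteq> new_open n xs F \<union> ?X"
  proof
    fix e assume e: "e \<in> open_pairs P n xs \<inter> pairs (\<Union>F)"
    then have "e \<in> pairs (\<Union>F)" by simp
    then obtain x y where xy: "e = {x, y}" "x \<in> \<Union>F" "y \<in> \<Union>F" by (rule pairs_cases)
    then obtain B B' where B: "B \<in> F" "B' \<in> F" "x \<in> B" "y \<in> B'" by auto
    show "e \<in> new_open n xs F \<union> ?X"
    proof (cases "(B, B') \<in> ?R")
      case True
      moreover have "e \<in> (\<lambda>(x, y). {x, y}) ` (B \<times> B')" using B xy by (intro image_eqI[of _ _ "(x, y)"]) auto
      ultimately have "e \<in> ?X" by (intro UN_I[of "(B, B')"]) auto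
      then show ?thesis by simp
    next
      case False
      then have "B \<noteq> B'" "\<not> sets_adjacent (proc_edges P n xs) B B'" using B by (auto simp: adjacent_pairs_def)
      then have "e \<in> new_open n xs F" using B xy e unfolding new_open_def by auto
      then show ?thesis by simp
    qed
  qed
  moreover have "finite ?X"
  proof (rule finite_UN_I[OF fR])
    fix q assume "q \<in> ?R"
    then obtain B B' where "q = (B, B')" "B \<in> F" "B' \<in> F" by (auto simp: adjacent_pairs_def)
    then show "finite (case q of (B, B') \<Rightarrow> (\<lambda>(x, y). {x, y}) ` (B \<times> B'))" using fB by simp
  qed
  moreover have fin_new: "finite (new_open n xs F)" by (rule finite_subset[OF _ finite_Opn[of P n xs]]) (auto simp: new_open_def)
  ultimately have "card (open_pairs P n xs \<inter> pairs (\<Union>F)) \<le> card (new_open n xs F \<union> ?X)"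
    by (intro card_mono finite_UnI)
  also have "\<dots> \<le> card (new_open n xs F) + card ?X" by (rule card_Un_le)
  also have "card ?X \<le> card ?R * b\<^sup>2"
  proof (rule cross_pairs_bound[OF F(1)])
    show "?R \<subseteq> F \<times> F" by (auto simp: adjacent_pairs_def)
  qed (use F(3) fB fR in auto)
  also have "card ?R * b\<^sup>2 \<le> (M + a) * b\<^sup>2"
  proof (rule mult_le_mono1)
    have "card ?R \<le> card (adjacent_pairs (proc_edges P n xs) F) + card ((\<lambda>B. (B, B)) ` F)" by (rule card_Un_le)
    also have "card ((\<lambda>B. (B, B)) ` F) \<le> card F" by (rule card_image_le[OF F(1)])
    finally show "card ?R \<le> M + a" using F(4) a by simp
  qed
  finally show ?thesis by simp
qed

text \<open>Connectivity is required in the constrained graph itself, so that contracting the pieces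
  gives a minor of a member of the class; it persists when further edges arrive.\<close>

definition pieces :: "nat \<Rightarrow> nat \<Rightarrow> nat \<Rightarrow> nat \<Rightarrow> nat set list \<Rightarrow> nat set set \<Rightarrow> bool" where
  "pieces n b M \<mu> xs F \<longleftrightarrow> conn_set_family (proc_edges P n xs) F \<and> \<Union>F \<subseteq> {1..n} \<and> (\<forall>B\<in>F. card B \<le> b) \<and> card F \<le> M \<and> \<mu> \<le> card (\<Union>F)"

lemma conn_set_family_mono: "conn_set_family E F \<Longrightarrow> E \<subseteq> E' \<Longrightarrow> conn_set_family E' F"
  unfolding conn_set_family_def by (auto intro: conn_set_mono)


text \<open>Sprinkling: each time a pair between two non-adjacent pieces is still open, the next edge has a
  fair chance of making these pieces adjacent, but the number of adjacent pairs of pieces is bounded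
  because the graph has no large clique minor.  The supermartingale weighs an
  outcome by \<open>(1/2)\<close> to the number of adjacent pairs as long as many pairs are open.\<close>

theorem sprinkling:
  fixes Q :: real and n b M \<mu> t1 t k :: nat
  assumes G: "finite V0" "E0 \<subseteq> pairs V0" "(V0, E0) \<notin> P"
    and t: "t1 \<le> t" "t \<le> n choose 2"
  defines "a \<equiv> 2 ^ card V0 * M"
  defines "q \<equiv> Q - real ((M + a) * b\<^sup>2)"
  assumes q0: "0 \<le> q"
  shows "prob_ord n (\<lambda>es. (\<exists>F. pieces n b M \<mu> (take t1 es) F) \<and> real (forb P (proc P n es t)) < real (\<mu> choose 2) - Q)
     \<le> 2 ^ a * exp (- q * real (t - t1) / (2 * real (n choose 2)))"
proof -
  let ?N = "n choose 2"
  \<comment> \<open>The family is selected from the first \<open>t1\<close> edges only, so it stays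
    fixed while the later edges are drawn.\<close>
  define ff where "ff xs = (SOME F. pieces n b M \<mu> (take t1 xs) F)" for xs
  define good where "good xs \<longleftrightarrow> (\<exists>F. pieces n b M \<mu> (take t1 xs) F) \<and> Q \<le> real (card (open_pairs P n xs \<inter> pairs (\<Union>(ff xs))))" for xs
  define f :: "nat set list \<Rightarrow> real" where "f xs = of_bool (good xs) * (1/2) ^ card (adjacent_pairs (proc_edges P n xs) (ff xs))" for xs
  have f01: "0 \<le> f xs" "f xs \<le> 1" for xs by (auto simp: f_def power_le_one)
  have ffP: "pieces n b M \<mu> (take t1 xs) (ff xs)" if "\<exists>F. pieces n b M \<mu> (take t1 xs) F" for xs
    unfolding ff_def using that by (rule someI_ex)
  have good_pieces: "pieces n b M \<mu> xs (ff xs)" if "good xs" for xs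
  proof -
    have p: "pieces n b M \<mu> (take t1 xs) (ff xs)" using that ffP by (simp add: good_def)
    have "proc_edges P n (take t1 xs) \<subseteq> proc_edges P n xs" using proc_edges_mono_append[of n "take t1 xs" "drop t1 xs"] by simp
    with p show ?thesis unfolding pieces_def by (auto dest: conn_set_family_mono)
  qed
  have adj_a: "card (adjacent_pairs (proc_edges P n xs) (ff xs)) \<le> a" if "good xs" "set xs \<subseteq> Kn_edges n" for xs
    using good_pieces[OF that(1)] unfolding a_def pieces_def by (intro card_adjR_bound[OF G that(2)]) auto
  \<comment> \<open>Factor per draw: as long as the history is good, at least \<open>q\<close> of at
    most \<open>?N\<close> remaining edges create a new adjacency, and each of them at least halves
    the weight.\<close>
  define r where "r = exp (- q / (2 * real ?N))"
  have step: "(\<Sum>e\<in>Kn_edges n - set xs. f (xs @ [e])) / real (?N - s) \<le> r * f xs"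
    if s: "t1 \<le> s" "s < ?N" and xs: "xs \<in> edge_seqs n s" for s xs
  proof -
    have len: "length xs = s" and sub: "set xs \<subseteq> Kn_edges n" using xs by (auto simp: edge_seqs_def)
    have sub': "set (xs @ [e]) \<subseteq> Kn_edges n" if "e \<in> Kn_edges n - set xs" for e using sub that by simp
    have tk: "take t1 (xs @ [e]) = take t1 xs" for e using len s by simp
    have ff_eq: "ff (xs @ [e]) = ff xs" for e unfolding ff_def tk ..
    have good_anti: "good xs" if "good (xs @ [e])" "e \<in> Kn_edges n - set xs" for e
    proof -
      have "card (open_pairs P n (xs @ [e]) \<inter> pairs (\<Union>(ff xs))) \<le> card (open_pairs P n xs \<inter> pairs (\<Union>(ff xs)))"
        using open_pairs_antimono_snoc[OF sub'[OF that(2)]] by (intro card_mono) auto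
      then have "real (card (open_pairs P n (xs @ [e]) \<inter> pairs (\<Union>(ff xs)))) \<le> real (card (open_pairs P n xs \<inter> pairs (\<Union>(ff xs))))"
        by (rule of_nat_mono)
      then show ?thesis using that(1) unfolding good_def ff_eq tk by (elim conjE) (intro conjI, assumption, linarith)
    qed
    show ?thesis
    proof (cases "good xs")
      case False
      then have "f (xs @ [e]) = 0" if "e \<in> Kn_edges n - set xs" for e using good_anti that by (auto simp: f_def)
      then show ?thesis using f01 by (simp add: r_def)
    next
      case True
      define F where "F = ff xs"
      have pF: "pieces n b M \<mu> xs F" using good_pieces[OF True] by (simp add: F_def)
      then have fF: "conn_set_family (proc_edges P n xs) F" by (simp add: pieces_def)
      define w :: real where "w = (1/2) ^ card (adjacent_pairs (proc_edges P n xs) F)"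
      have w0: "0 < w" by (simp add: w_def)
      have fx: "f xs = w" using True by (simp add: f_def w_def F_def)
      let ?A = "Kn_edges n - set xs" let ?O = "new_open n xs F"
      have OA: "?O \<subseteq> ?A" using new_open_props(1)[OF sub fF] by blast
      have cA: "card ?A = ?N - s" by (rule card_Kn_diff[OF xs])
      have le: "f (xs @ [e]) \<le> w - w / 2 * of_bool (e \<in> ?O)" if e: "e \<in> ?A" for e
      proof -
        have f1: "f (xs @ [e]) \<le> (1/2) ^ card (adjacent_pairs (proc_edges P n (xs @ [e])) F)"
          by (simp add: f_def ff_eq F_def)
        show ?thesis
        proof (cases "e \<in> ?O")
          case True
          have "Suc (card (adjacent_pairs (proc_edges P n xs) F)) \<le> card (adjacent_pairs (proc_edges P n (xs @ [e])) F)"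
            using new_open_props(2)[OF sub fF True] by simp
          then have "(1/2::real) ^ card (adjacent_pairs (proc_edges P n (xs @ [e])) F) \<le> (1/2) ^ Suc (card (adjacent_pairs (proc_edges P n xs) F))"
            by (intro power_decreasing) auto
          then show ?thesis using f1 True by (simp add: w_def)
        next
          case False
          have "adjacent_pairs (proc_edges P n xs) F \<subseteq> adjacent_pairs (proc_edges P n (xs @ [e])) F"
            using proc_edges_mono_snoc[of n xs e] unfolding adjacent_pairs_def sets_adjacent_def by blast
          then have "card (adjacent_pairs (proc_edges P n xs) F) \<le> card (adjacent_pairs (proc_edges P n (xs @ [e])) F)"
            using fF by (intro card_mono finite_adjR) (auto simp: conn_set_family_def)
          then have "(1/2::real) ^ card (adjacent_pairs (proc_edges P n (xs @ [e])) F) \<le> w"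
            unfolding w_def by (intro power_decreasing) auto
          then show ?thesis using f1 False by simp
        qed
      qed
      have "Q \<le> real (card (open_pairs P n xs \<inter> pairs (\<Union>F)))" using True by (simp add: good_def F_def)
      also have "\<dots> \<le> real (card ?O + (M + a) * b\<^sup>2)"
        using pF adj_a[OF True sub] unfolding F_def[symmetric]
        by (intro of_nat_mono card_new_open) (auto simp: pieces_def conn_set_family_def)
      finally have Oq: "q \<le> real (card ?O)" by (simp add: q_def)
      have "(\<Sum>e\<in>?A. f (xs @ [e])) \<le> (\<Sum>e\<in>?A. w - w / 2 * of_bool (e \<in> ?O))"
        by (intro sum_mono le)
      also have "\<dots> = w * real (card ?A) - w / 2 * real (card ?O)"
      proof -
        have "(\<Sum>e\<in>?A. of_bool (e \<in> ?O)) = real (card (?A \<inter> ?O))" by (simp add: Int_def)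
        also have "?A \<inter> ?O = ?O" using OA by blast
        finally have O: "(\<Sum>e\<in>?A. of_bool (e \<in> ?O)) = real (card ?O)" .
        have "(\<Sum>e\<in>?A. w - w / 2 * of_bool (e \<in> ?O)) = (\<Sum>e\<in>?A. w) - (\<Sum>e\<in>?A. w / 2 * of_bool (e \<in> ?O))"
          by (rule sum_subtractf)
        also have "(\<Sum>e\<in>?A. w / 2 * of_bool (e \<in> ?O)) = w / 2 * (\<Sum>e\<in>?A. of_bool (e \<in> ?O))"
          by (rule sum_distrib_left[symmetric])
        also have "(\<Sum>e\<in>?A. w) = w * real (card ?A)" unfolding sum_constant by (rule mult.commute)
        finally show ?thesis unfolding O .
      qed
      also have "\<dots> \<le> w * real (?N - s) - w / 2 * q"
        unfolding cA using Oq w0 by (intro diff_left_mono mult_left_mono) auto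
      also have "\<dots> \<le> real (?N - s) * (w * (1 - q / (2 * real ?N)))"
      proof -
        have "real (?N - s) * q \<le> real ?N * q" using q0 by (intro mult_right_mono) auto
        moreover have N0: "0 < real ?N" using s by linarith
        ultimately have "real (?N - s) * q / (2 * real ?N) \<le> real ?N * q / (2 * real ?N)"
          by (intro divide_right_mono) auto
        also have "\<dots> = q / 2" using N0 by simp
        finally have "real (?N - s) * q / (2 * real ?N) \<le> q / 2" .
        then have "w * (real (?N - s) * q / (2 * real ?N)) \<le> w * (q / 2)" using w0 by (intro mult_left_mono) auto
        then show ?thesis by (simp add: algebra_simps)
      qed
      also have "\<dots> \<le> real (?N - s) * (w * r)"
        using w0 exp_ge_add_one_self[of "- q / (2 * real ?N)"] unfolding r_def by (intro mult_left_mono) auto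
      finally show ?thesis unfolding fx using s by (simp add: field_simps)
    qed
  qed
  have seq_mean_le: "seq_mean n (t1 + d) f \<le> r ^ d" if "t1 + d \<le> ?N" for d
    using that
  proof (induction d)
    case 0
    have "seq_mean n t1 f \<le> seq_mean n t1 (\<lambda>_. 1)" by (rule seq_mean_mono) (rule f01)
    then show ?case using seq_mean_const[of t1 n 1] 0 by simp
  next
    case (Suc d)
    have "seq_mean n (t1 + Suc d) f = seq_mean n (t1 + d) (\<lambda>xs. (\<Sum>e\<in>Kn_edges n - set xs. f (xs @ [e])) / real (?N - (t1 + d)))"
      using avg_Suc[of "t1 + d" n f] Suc.prems by simp
    also have "\<dots> \<le> seq_mean n (t1 + d) (\<lambda>xs. r * f xs)"
      using Suc.prems by (intro seq_mean_mono step) auto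
    also have "\<dots> = r * seq_mean n (t1 + d) f" by (rule seq_mean_cmult)
    also have "\<dots> \<le> r * r ^ d" using Suc by (intro mult_left_mono) (auto simp: r_def)
    finally show ?case by simp
  qed
  define R where "R xs \<longleftrightarrow> (\<exists>F. pieces n b M \<mu> (take t1 xs) F) \<and> real (card (Kn_edges n - open_pairs P n xs)) < real (\<mu> choose 2) - Q" for xs
  have "prob_ord n (\<lambda>es. (\<exists>F. pieces n b M \<mu> (take t1 es) F) \<and> real (forb P (proc P n es t)) < real (\<mu> choose 2) - Q)
      \<le> prob_ord n (\<lambda>es. R (take t es))"
  proof (rule prob_ord_mono)
    fix es assume es: "es \<in> orderings n" and "(\<exists>F. pieces n b M \<mu> (take t1 es) F) \<and> real (forb P (proc P n es t)) < real (\<mu> choose 2) - Q"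
    moreover have "set (take t es) \<subseteq> Kn_edges n" using es set_take_subset[of t es] by (simp add: orderings_def)
    moreover have "take t1 (take t es) = take t1 es" using t by (simp add: min_absorb1)
    ultimately show "R (take t es)" unfolding R_def by (simp add: forb_eq)
  qed
  also have "\<dots> = seq_mean n t (\<lambda>xs. of_bool (R xs))" by (rule prob_ord_avg[OF t(2)])
  also have "\<dots> \<le> seq_mean n t (\<lambda>xs. 2 ^ a * f xs)"
  proof (rule seq_mean_mono)
    fix xs assume xs: "xs \<in> edge_seqs n t"
    show "of_bool (R xs) \<le> 2 ^ a * f xs"
    proof (cases "R xs")
      case True
      then have ex: "\<exists>F. pieces n b M \<mu> (take t1 xs) F" and lt: "real (card (Kn_edges n - open_pairs P n xs)) < real (\<mu> choose 2) - Q"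
        by (simp_all add: R_def)
      let ?U = "\<Union>(ff xs)"
      note fam_U = ffP[OF ex, unfolded pieces_def]
      note U = fam_U[THEN conjunct2, THEN conjunct1] fam_U[THEN conjunct2, THEN conjunct2, THEN conjunct2, THEN conjunct2]
      have fU: "finite ?U" using U(1) by (rule finite_subset) simp
      have pU: "pairs ?U \<subseteq> Kn_edges n"
      proof
        fix e assume "e \<in> pairs ?U"
        then obtain u v where "e = {u, v}" "u \<in> ?U" "v \<in> ?U" "u \<noteq> v" by (rule pairs_cases)
        then show "e \<in> Kn_edges n" unfolding Kn_edges_eq using subsetD[OF U(1)] in_pairs_iff by metis
      qed
      \<comment> \<open>The covered set spans at least \<open>\<mu> choose 2\<close> pairs. If fewer
        than this number minus \<open>Q\<close> are forbidden, more than \<open>Q\<close> of them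
        are open, so the history is good and its weight is at least
        \<open>(1/2) ^ a\<close>.\<close>
      have "\<mu> choose 2 \<le> card ?U choose 2" by (rule binomial_right_mono[OF U(2)])
      also have "\<dots> = card (pairs ?U)" by (rule card_pairs[OF fU, symmetric])
      also have "\<dots> \<le> card ((Kn_edges n - open_pairs P n xs) \<union> (open_pairs P n xs \<inter> pairs ?U))"
        using pU by (intro card_mono) auto
      also have "\<dots> \<le> card (Kn_edges n - open_pairs P n xs) + card (open_pairs P n xs \<inter> pairs ?U)" by (rule card_Un_le)
      finally have "real (\<mu> choose 2) \<le> real (card (Kn_edges n - open_pairs P n xs)) + real (card (open_pairs P n xs \<inter> pairs ?U))"
        by (simp flip: of_nat_add)
      then have g: "good xs" unfolding good_def using ex lt by simp
      have "card (adjacent_pairs (proc_edges P n xs) (ff xs)) \<le> a" using xs by (intro adj_a[OF g]) (simp add: edge_seqs_def)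
      then have "(1/2::real) ^ a \<le> f xs" using g by (simp add: f_def power_decreasing)
      then have "2 ^ a * (1/2::real) ^ a \<le> 2 ^ a * f xs" by (intro mult_left_mono) auto
      then show ?thesis using True by (simp add: power_mult_distrib[symmetric])
    qed (simp add: f01)
  qed
  also have "\<dots> = 2 ^ a * seq_mean n t f" by (rule seq_mean_cmult)
  also have "\<dots> \<le> 2 ^ a * r ^ (t - t1)" using seq_mean_le[of "t - t1"] t by (intro mult_left_mono) auto
  also have "r ^ (t - t1) = exp (- q * real (t - t1) / (2 * real ?N))"
    unfolding r_def by (simp add: exp_of_nat_mult[symmetric] mult.commute)
  finally show ?thesis .
qed

end

section \<open>Component sizes near the critical point\<close>

lemma exp_quadratic_upper: "0 \<le> z \<Longrightarrow> exp (- z) \<le> 1 - z + z\<^sup>2 / 2" for z :: real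
proof -
  assume z: "0 \<le> z"
  have 1: "1 + z + z\<^sup>2 / 2 \<le> exp z" by (rule exp_lower_Taylor_quadratic[OF z])
  have pos: "0 \<le> 1 - z + z\<^sup>2 / 2"
  proof -
    have "0 \<le> ((1 - z)\<^sup>2 + 1) / 2" by simp
    also have "\<dots> = 1 - z + z\<^sup>2 / 2" by (simp add: power2_eq_square field_simps)
    finally show ?thesis .
  qed
  have "1 \<le> 1 + (z\<^sup>2 / 2)\<^sup>2" by simp
  also have "\<dots> = (1 - z + z\<^sup>2 / 2) * (1 + z + z\<^sup>2 / 2)" by (simp add: power2_eq_square algebra_simps)
  also have "\<dots> \<le> (1 - z + z\<^sup>2 / 2) * exp z" using 1 pos by (intro mult_left_mono)
  finally have "exp (- z) * 1 \<le> exp (- z) * ((1 - z + z\<^sup>2 / 2) * exp z)" by (intro mult_left_mono) auto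
  also have "\<dots> = (1 - z + z\<^sup>2 / 2) * (exp (- z) * exp z)" by simp
  also have "exp (- z) * exp z = 1" by (simp add: exp_minus)
  finally show ?thesis by simp
qed

text \<open>The quadratic term is indispensable at criticality, where the first-order terms of the
  branching equation cancel.\<close>

lemma one_minus_le_exp: "0 \<le> x \<Longrightarrow> x < 1 \<Longrightarrow> 1 - x \<le> exp (- x - x\<^sup>2 / 2)" for x :: real
proof -
  assume x: "0 \<le> x" "x < 1"
  have "exp (x + x\<^sup>2 / 2) * (1 - x) \<le> 1"
  proof -
    define g where "g x = exp (x + x\<^sup>2 / 2) * (1 - x)" for x :: real
    have d: "(g has_real_derivative (- (y\<^sup>2) * exp (y + y\<^sup>2 / 2))) (at y)" for y
      unfolding g_def by (auto intro!: derivative_eq_intros simp: power2_eq_square algebra_simps)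
    have "g x \<le> g 0"
      by (rule DERIV_nonpos_imp_nonincreasing[OF x(1)]) (use d in \<open>auto intro!: exI mult_nonneg_nonneg\<close>)
    then show ?thesis by (simp add: g_def)
  qed
  then have "exp (- (x + x\<^sup>2 / 2)) * (exp (x + x\<^sup>2 / 2) * (1 - x)) \<le> exp (- (x + x\<^sup>2 / 2)) * 1"
    by (intro mult_left_mono) auto
  then show ?thesis by (simp add: exp_minus mult.assoc[symmetric] exp_diff exp_add[symmetric] flip: exp_minus)
qed

lemma one_minus_ge_exp: "0 \<le> y \<Longrightarrow> y \<le> 1/4 \<Longrightarrow> exp (- y - y\<^sup>2) \<le> 1 - y" for y :: real
proof -
  assume y: "0 \<le> y" "y \<le> 1/4"
  have "exp (- (y + y\<^sup>2)) \<le> 1 - (y + y\<^sup>2) + (y + y\<^sup>2)\<^sup>2 / 2"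
    using y by (intro exp_quadratic_upper) simp
  also have "\<dots> = 1 - y - y\<^sup>2 * (1 - 2 * y - y\<^sup>2) / 2" by (simp add: power2_eq_square field_simps)
  also have "\<dots> \<le> 1 - y"
  proof -
    have "y\<^sup>2 \<le> (1/4)\<^sup>2" using y by (intro power_mono) auto
    then have "0 \<le> 1 - 2 * y - y\<^sup>2" using y by (simp add: power2_eq_square)
    then have "0 \<le> y\<^sup>2 * (1 - 2 * y - y\<^sup>2)" by simp
    then show ?thesis by simp
  qed
  finally show ?thesis by simp
qed

lemma power_exp_lower:
  assumes "0 \<le> y" "y \<le> 1/4" shows "exp (real n * (- y - y\<^sup>2)) \<le> (1 - y) ^ n"
  using power_mono[OF one_minus_ge_exp[OF assms], of n] by (simp add: exp_of_nat_mult[symmetric])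

lemma power_exp_upper:
  assumes "0 \<le> y" "y \<le> 1" shows "(1 - y) ^ n \<le> exp (- real n * y)"
proof -
  have "1 - y \<le> exp (- y)" using exp_ge_add_one_self[of "- y"] by simp
  then have "(1 - y) ^ n \<le> exp (- y) ^ n" using assms by (intro power_mono) auto
  then show ?thesis by (simp add: exp_of_nat_mult[symmetric])
qed

text \<open>With \<open>x = 4 * d\<close> the inequality required is
  \<open>l + n p x (1 + p x) \<le> x + x^2 / 2\<close>. The left side is at most 4 d + 7 d^2 and the
  right side equals 4 d + 8 d^2, which motivates the factor 4.\<close>

lemma comp_rec_critical:
  assumes d: "0 < d" "d \<le> 1/4" and p: "0 \<le> p" "p \<le> 1/10" "real n * p \<le> 1 + d"
  shows "comp_rec p (d\<^sup>2) (1 - 4 * d) n"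
proof
  show "1 - 4 * d \<le> exp (- d\<^sup>2) * (1 - p + p * (1 - 4 * d)) ^ n"
  \<comment> \<open>At \<open>d = 1/4\<close> the value \<open>x = 1\<close> is outside the range of
    \<open>one_minus_le_exp\<close>, but then \<open>f = 0\<close> is trivially a
    subsolution.\<close>
  proof (cases "d = 1/4")
    case True
    then have "1 - 4 * d = 0" by simp
    then show ?thesis using p by simp
  next
    case False
    define x where "x = 4 * d"
    have x: "0 \<le> x" "x < 1" using d False by (auto simp: x_def)
    have px: "0 \<le> p * x" "p * x \<le> 1/4"
      using p x mult_mono[of p "1/10" x 1] by auto
    have "1 - x \<le> exp (- x - x\<^sup>2 / 2)" using x by (rule one_minus_le_exp)
    also have "\<dots> \<le> exp (- d\<^sup>2 + real n * (- (p * x) - (p * x)\<^sup>2))"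
    proof -
      define A B where "A = real n * p * x" and "B = real n * p * (p * x\<^sup>2)"
      have x2: "x\<^sup>2 = 16 * d\<^sup>2" "d * x = 4 * d\<^sup>2" by (auto simp: x_def power2_eq_square)
      have "A \<le> (1 + d) * x" unfolding A_def using p x by (intro mult_right_mono) auto
      also have "\<dots> = x + 4 * d\<^sup>2" using x2 by (simp add: algebra_simps)
      finally have A: "A \<le> x + 4 * d\<^sup>2" .
      have "B \<le> (1 + 1/4) * (1/10 * x\<^sup>2)" unfolding B_def using p d x by (intro mult_mono) auto
      also have "\<dots> = 2 * d\<^sup>2" unfolding x2 by simp
      finally have B: "B \<le> 2 * d\<^sup>2" .
      have "d\<^sup>2 + real n * (p * x + (p * x)\<^sup>2) = d\<^sup>2 + A + B"
        by (simp add: A_def B_def power2_eq_square algebra_simps)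
      also have "\<dots> \<le> x + x\<^sup>2 / 2" unfolding x2 using A B zero_le_power2[of d] by linarith
      finally have "d\<^sup>2 + real n * (p * x + (p * x)\<^sup>2) \<le> x + x\<^sup>2 / 2" .
      then show ?thesis by (simp add: algebra_simps)
    qed
    also have "\<dots> = exp (- d\<^sup>2) * exp (real n * (- (p * x) - (p * x)\<^sup>2))" by (rule exp_add)
    also have "\<dots> \<le> exp (- d\<^sup>2) * (1 - p * x) ^ n"
      using px by (intro mult_left_mono power_exp_lower) auto
    finally show ?thesis by (simp add: x_def algebra_simps)
  qed
qed (use d p in auto)

text \<open>Below criticality the gain \<open>e * x\<close> is linear in \<open>x\<close>: half of
  it is spent on \<open>l\<close>, the other half on the second-order term. The size of
  \<open>x\<close> stays free, to be tuned later.\<close>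

lemma comp_rec_subcritical:
  assumes e: "0 < e" "e \<le> 1" and p: "0 \<le> p" "p \<le> 1/4" "real n * p \<le> 1 - e" and x: "0 < x" "x \<le> 1" "p * x \<le> e / 2"
  shows "comp_rec p (e * x / 2) (1 - x) n"
proof
  show "1 - x \<le> exp (- (e * x / 2)) * (1 - p + p * (1 - x)) ^ n"
  proof -
    have px: "0 \<le> p * x" "p * x \<le> 1/4"
      using p x mult_mono[of p "1/4" x 1] by auto
    have "1 - x \<le> exp (- x)" using exp_ge_add_one_self[of "- x"] by simp
    also have "\<dots> \<le> exp (- (e * x / 2) + real n * (- (p * x) - (p * x)\<^sup>2))"
    proof -
      have "real n * p * x \<le> (1 - e) * x" using p x by (intro mult_right_mono) auto
      moreover have "real n * p * (p * x * x) \<le> 1 * (e / 2 * x)"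
        using p e x by (intro mult_mono mult_right_mono) auto
      ultimately have "e * x / 2 + real n * (p * x + (p * x)\<^sup>2) \<le> x"
        by (simp add: power2_eq_square algebra_simps)
      then show ?thesis by (simp add: algebra_simps)
    qed
    also have "\<dots> = exp (- (e * x / 2)) * exp (real n * (- (p * x) - (p * x)\<^sup>2))" by (rule exp_add)
    also have "\<dots> \<le> exp (- (e * x / 2)) * (1 - p * x) ^ n"
      using px by (intro mult_left_mono power_exp_lower) auto
    finally show ?thesis by (simp add: algebra_simps)
  qed
qed (use e p x in auto)

lemma comp_laplace_le_n: "0 < l \<Longrightarrow> comp_laplace l n E \<le> real n"
proof -
  assume l: "0 < l"
  have "comp_laplace l n E \<le> (\<Sum>v\<in>{1..n}. 1)" unfolding comp_laplace_def using l by (intro sum_mono) auto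
  then show ?thesis by simp
qed

context comp_rec begin

text \<open>The variance bound obtained in \<open>EP_W_deviation\<close>.\<close>

definition "V = real n + (real n)\<^sup>2 * ((p * (1 - f)\<^sup>2 / l + p * (1 - f)) * (1 - f) / l)"

lemma EP_X_markov:
  assumes "1 \<le> n" "0 < z"
  shows "subset_mean p (Kn_edges n) (\<lambda>E. of_bool (z \<le> real n - comp_laplace l n E)) \<le> real n * (1 - f) / z"
proof -
  have "subset_mean p (Kn_edges n) (\<lambda>E. of_bool (z \<le> real n - comp_laplace l n E)) \<le> subset_mean p (Kn_edges n) (\<lambda>E. real n - comp_laplace l n E) / z"
    by (rule subset_mean_markov[OF p0 p1 assms(2)]) (use comp_laplace_le_n l0 in auto)
  also have "subset_mean p (Kn_edges n) (\<lambda>E. real n - comp_laplace l n E) = real n - real n * \<psi> n 1"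
    unfolding subset_mean_diff Kn_edges_eq EP_W by simp
  also have "\<dots> / z \<le> real n * (1 - f) / z"
    using psi_1_ge[of n] assms by (intro divide_right_mono) (auto simp: algebra_simps mult_left_mono)
  finally show ?thesis .
qed

lemma EP_X_upper:
  assumes "2 \<le> n" "0 < d"
  shows "subset_mean p (Kn_edges n) (\<lambda>E. of_bool (real n * (1 - f) + d \<le> real n - comp_laplace l n E)) \<le> V / d\<^sup>2"
proof -
  have "real n * f \<le> real n * \<psi> n 1" using psi_1_ge[of n] assms by (intro mult_left_mono) auto
  then have "subset_mean p (Kn_edges n) (\<lambda>E. of_bool (real n * (1 - f) + d \<le> real n - comp_laplace l n E))
     \<le> subset_mean p (Kn_edges n) (\<lambda>E. of_bool (d \<le> \<bar>comp_laplace l n E - real n * \<psi> n 1\<bar>))"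
    by (intro subset_mean_mono[OF p0 p1]) (auto simp: algebra_simps)
  also have "\<dots> \<le> V / d\<^sup>2" unfolding V_def Kn_edges_eq by (rule EP_W_deviation[OF assms])
  finally show ?thesis .
qed

lemma EP_X_lower:
  assumes "2 \<le> n" "0 < d" "\<psi> n 1 \<le> 1 - y"
  shows "subset_mean p (Kn_edges n) (\<lambda>E. of_bool (real n - comp_laplace l n E \<le> real n * y - d)) \<le> V / d\<^sup>2"
proof -
  have "real n * \<psi> n 1 \<le> real n * (1 - y)" using assms by (intro mult_left_mono) auto
  then have "subset_mean p (Kn_edges n) (\<lambda>E. of_bool (real n - comp_laplace l n E \<le> real n * y - d))
     \<le> subset_mean p (Kn_edges n) (\<lambda>E. of_bool (d \<le> \<bar>comp_laplace l n E - real n * \<psi> n 1\<bar>))"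
    by (intro subset_mean_mono[OF p0 p1]) (auto simp: algebra_simps)
  also have "\<dots> \<le> V / d\<^sup>2" unfolding V_def Kn_edges_eq by (rule EP_W_deviation[OF assms(1,2)])
  finally show ?thesis .
qed

end

lemma choose_two_real: "real (n choose 2) = real n * (real n - 1) / 2"
proof (cases n)
  case (Suc m)
  have "even (n * (n - 1))" unfolding Suc by simp
  then have "real (n * (n - 1) div 2) = real (n * (n - 1)) / 2" by (simp add: real_of_nat_div)
  then show ?thesis using Suc by (simp add: choose_two algebra_simps)
qed simp

text \<open>Compared with the squared scale \<open>(n d)^2\<close> of the mean this is of relative
  order \<open>1 / (n d^3)\<close>, so concentration holds as soon as \<open>d\<close> is large
  against n^(-1/3).\<close>

lemma V_critical:
  assumes d: "0 < d" "d \<le> 1/4" and p: "0 \<le> p" "p \<le> 1/10" "real n * p \<le> 1 + d" 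
  shows "comp_rec.V p (d\<^sup>2) (1 - 4 * d) n \<le> 101 * real n / d"
proof -
  interpret comp_rec p "d\<^sup>2" "1 - 4 * d" n by (rule comp_rec_critical[OF assms])
  have "(p * (4 * d)\<^sup>2 / d\<^sup>2 + p * (4 * d)) * (4 * d) / d\<^sup>2 = (64 * p + 16 * p * d) / d"
    using d by (simp add: power2_eq_square field_simps)
  then have "V = real n + real n * (real n * p * (64 + 16 * d)) / d"
    unfolding V_def by (simp add: power2_eq_square algebra_simps)
  also have "real n * p * (64 + 16 * d) \<le> 5/4 * 68"
    using p d by (intro mult_mono) auto
  \<comment> \<open>101 = 85 + 16: the correlation term gives 5/4 * 68 = 85, and the diagonal
    \<open>n\<close> is crudely bounded by \<open>16 * n / d\<close>.\<close>
  also have "real n + real n * (5/4 * 68) / d \<le> 101 * real n / d"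
    using d mult_left_mono[of d 16 "real n"] by (simp add: field_simps)
  finally show ?thesis using d by (simp add: divide_right_mono mult_left_mono)
qed

lemma prob_X_increasing:
  assumes l: "0 < l" and t: "1 \<le> t" "real t + 2 * sqrt (real t) \<le> real (n choose 2)"
  shows "prob_t n t (\<lambda>E. z \<le> real n - comp_laplace l n E) \<le> 4 * subset_mean ((real t + 2 * sqrt (real t)) / real (n choose 2)) (Kn_edges n) (\<lambda>E. of_bool (z \<le> real n - comp_laplace l n E))"
proof (rule prob_t_increasing[OF _ t])
  fix E E' assume "E \<subseteq> E'" "E' \<subseteq> Kn_edges n" "z \<le> real n - comp_laplace l n E"
  then show "z \<le> real n - comp_laplace l n E'" using comp_laplace_antimono[OF l, of E E' n] by (simp add: Kn_edges_eq)
qed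

lemma prob_X_decreasing:
  assumes l: "0 < l" and t: "4 \<le> t" "t \<le> n choose 2"
  shows "prob_t n t (\<lambda>E. real n - comp_laplace l n E \<le> z) \<le> 4 * subset_mean ((real t - 2 * sqrt (real t)) / real (n choose 2)) (Kn_edges n) (\<lambda>E. of_bool (real n - comp_laplace l n E \<le> z))"
proof (rule prob_t_decreasing[OF _ t])
  fix E E' assume "E \<subseteq> E'" "E' \<subseteq> Kn_edges n" "real n - comp_laplace l n E' \<le> z"
  then show "real n - comp_laplace l n E \<le> z" using comp_laplace_antimono[OF l, of E E' n] by (simp add: Kn_edges_eq)
qed

lemma N_mult:
  assumes "2 \<le> n" shows "real n * (x / real (n choose 2)) = 2 * x / (real n - 1)"
  using assms by (simp add: choose_two_real field_simps)

lemma p_bounds: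
  assumes n: "13 \<le> n" and y: "0 \<le> y" "2 * y \<le> c * (real n - 1)" "c \<le> 5/4"
  defines "p \<equiv> y / real (n choose 2)"
  shows "0 \<le> p" "p \<le> 1/10" "real n * p \<le> c" "y \<le> real (n choose 2)"
proof -
  have n1: "0 < real n - 1" using n by simp
  show "0 \<le> p" using y by (simp add: p_def)
  have "real n * p = 2 * y / (real n - 1)" unfolding p_def using n by (intro N_mult) simp
  then show np: "real n * p \<le> c" using y n1 by (simp add: pos_divide_le_eq)
  \<comment> \<open>13 is the least integer for which \<open>n p \<le> 5/4\<close> forces
    \<open>p \<le> 1/10\<close>.\<close>
  have "13 * p \<le> real n * p" using n \<open>0 \<le> p\<close> by (intro mult_right_mono) auto
  then show p10: "p \<le> 1/10" using np y by simp
  have "0 < real (n choose 2)" using n1 n by (simp add: choose_two_real)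
  then have "y = p * real (n choose 2)" by (simp add: p_def)
  also have "\<dots> \<le> 1 * real (n choose 2)" using p10 by (intro mult_right_mono) auto
  finally show "y \<le> real (n choose 2)" by simp
qed

text \<open>Chebyshev serves beyond the window, where \<open>n d^3\<close> tends to infinity. Markov
  serves inside it, where only a slowly growing factor in \<open>z\<close> is available.\<close>

lemma prob_X_critical:
  assumes n: "13 \<le> n" and d: "0 < d" "d \<le> 1/4" and t: "1 \<le> t" "2 * (real t + 2 * sqrt (real t)) \<le> (1 + d) * (real n - 1)"
  shows "prob_t n t (\<lambda>E. 5 * real n * d \<le> real n - comp_laplace (d\<^sup>2) n E) \<le> 404 / (real n * d ^ 3)"
    and "0 < z \<Longrightarrow> prob_t n t (\<lambda>E. z \<le> real n - comp_laplace (d\<^sup>2) n E) \<le> 16 * real n * d / z"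
proof -
  define p where "p = (real t + 2 * sqrt (real t)) / real (n choose 2)"
  have y0: "0 \<le> real t + 2 * sqrt (real t)" by simp
  have pb: "0 \<le> p" "p \<le> 1/10" "real n * p \<le> 1 + d" "real t + 2 * sqrt (real t) \<le> real (n choose 2)"
    unfolding p_def by (intro p_bounds[OF n y0 t(2)]; use d in simp)+
  interpret comp_rec p "d\<^sup>2" "1 - 4 * d" n by (rule comp_rec_critical[OF d pb(1-3)])
  have nd: "0 < real n * d" using n d by simp
  have f: "real n * (1 - (1 - 4 * d)) + real n * d = 5 * real n * d" by (simp add: algebra_simps)
  have "prob_t n t (\<lambda>E. 5 * real n * d \<le> real n - comp_laplace (d\<^sup>2) n E) \<le> 4 * subset_mean p (Kn_edges n) (\<lambda>E. of_bool (5 * real n * d \<le> real n - comp_laplace (d\<^sup>2) n E))"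
    unfolding p_def by (rule prob_X_increasing[OF l0 t(1) pb(4)])
  also have "subset_mean p (Kn_edges n) (\<lambda>E. of_bool (5 * real n * d \<le> real n - comp_laplace (d\<^sup>2) n E)) \<le> V / (real n * d)\<^sup>2"
    using EP_X_upper[of "real n * d"] n nd unfolding f by simp
  also have "\<dots> \<le> (101 * real n / d) / (real n * d)\<^sup>2"
    using V_critical[OF d pb(1-3)] by (intro divide_right_mono) auto
  also have "\<dots> = 101 / (real n * d ^ 3)" using n d by (simp add: power2_eq_square power3_eq_cube field_simps)
  finally show "prob_t n t (\<lambda>E. 5 * real n * d \<le> real n - comp_laplace (d\<^sup>2) n E) \<le> 404 / (real n * d ^ 3)" by simp
  assume z: "0 < z"
  have "prob_t n t (\<lambda>E. z \<le> real n - comp_laplace (d\<^sup>2) n E) \<le> 4 * subset_mean p (Kn_edges n) (\<lambda>E. of_bool (z \<le> real n - comp_laplace (d\<^sup>2) n E))"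
    unfolding p_def by (rule prob_X_increasing[OF l0 t(1) pb(4)])
  also have "\<dots> \<le> 4 * (real n * (1 - (1 - 4 * d)) / z)" using EP_X_markov[OF _ z] n by (intro mult_left_mono) auto
  finally show "prob_t n t (\<lambda>E. z \<le> real n - comp_laplace (d\<^sup>2) n E) \<le> 16 * real n * d / z" by simp
qed

lemma prob_X_subcritical:
  assumes n: "13 \<le> n" and e: "0 < e" "e \<le> 1" and x: "0 < x" "x \<le> 1" "2 * x \<le> e * real n"
    and t: "1 \<le> t" "2 * (real t + 2 * sqrt (real t)) \<le> (1 - e) * (real n - 1)" and z: "0 < z"
  shows "prob_t n t (\<lambda>E. z \<le> real n - comp_laplace (e * x / 2) n E) \<le> 4 * real n * x / z"
proof -
  define p where "p = (real t + 2 * sqrt (real t)) / real (n choose 2)"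
  have y0: "0 \<le> real t + 2 * sqrt (real t)" by simp
  have pb: "0 \<le> p" "p \<le> 1/10" "real n * p \<le> 1 - e" "real t + 2 * sqrt (real t) \<le> real (n choose 2)"
    unfolding p_def by (intro p_bounds[OF n y0 t(2)]; use e in simp)+
  have "real n * p * x \<le> 1 * x" using pb e x by (intro mult_right_mono) auto
  also have "\<dots> \<le> real n * (e / 2)" using x by (simp add: mult.commute)
  finally have "real n * (p * x) \<le> real n * (e / 2)" by (simp add: mult.assoc)
  then have px: "p * x \<le> e / 2" using n by (subst (asm) mult_le_cancel_left_pos) auto
  interpret comp_rec p "e * x / 2" "1 - x" n by (rule comp_rec_subcritical) (use e pb x px in auto)
  have "prob_t n t (\<lambda>E. z \<le> real n - comp_laplace (e * x / 2) n E) \<le> 4 * subset_mean p (Kn_edges n) (\<lambda>E. of_bool (z \<le> real n - comp_laplace (e * x / 2) n E))"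
    unfolding p_def by (rule prob_X_increasing[OF l0 t(1) pb(4)])
  also have "\<dots> \<le> 4 * (real n * (1 - (1 - x)) / z)" using EP_X_markov[OF _ z] n by (intro mult_left_mono) auto
  finally show ?thesis by simp
qed

lemma exp_4: "exp (- 4) \<le> (1/32 :: real)"
proof -
  have "5/2 \<le> exp (1::real)" using exp_lower_Taylor_quadratic[of 1] by simp
  then have "(5/2) ^ 4 \<le> exp (1::real) ^ 4" by (intro power_mono) auto
  also have "exp (1::real) ^ 4 = exp 4" using exp_of_nat_mult[of 4 "1::real"] by simp
  finally have "32 \<le> exp (4::real)" by (simp add: power4_eq_xxxx)
  then have "inverse (exp 4) \<le> inverse (32::real)" by (intro le_imp_inverse_le) auto
  then show ?thesis by (simp add: exp_minus)
qed

text \<open>The density may even be slightly below critical: the killing rate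
  \<open>l = \<eta>^2\<close> alone makes \<open>1 - \<eta> / 2\<close> a supersolution. The
  truncation error is at most 2 * (1/32) * 4 \<eta> = \<eta> / 4, so the mean of \<open>X\<close> is
  at least \<open>n \<eta> / 4\<close>, and Chebyshev gives away half of it.\<close>

lemma prob_X_lower:
  assumes n: "13 \<le> n" and h: "0 < \<eta>" "\<eta> \<le> 1/4" "10 \<le> real n * \<eta> ^ 3" and t: "4 \<le> t" 
    "2 * (real t - 2 * sqrt (real t)) \<le> (1 + \<eta>) * (real n - 1)" "(1 - \<eta> / 4) * (real n - 1) \<le> 2 * (real t - 2 * sqrt (real t))"
    "t \<le> n choose 2"
  shows "prob_t n t (\<lambda>E. real n - comp_laplace (\<eta>\<^sup>2) n E \<le> real n * \<eta> / 8) \<le> 25856 / (real n * \<eta> ^ 3)"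
proof -
  define p where "p = (real t - 2 * sqrt (real t)) / real (n choose 2)"
  have "2 \<le> sqrt (real t)" using t by (intro real_le_rsqrt) simp
  then have "2 * sqrt (real t) \<le> sqrt (real t) * sqrt (real t)" by (intro mult_right_mono) auto
  then have y0: "0 \<le> real t - 2 * sqrt (real t)" by simp
  have pb: "0 \<le> p" "p \<le> 1/10" "real n * p \<le> 1 + \<eta>"
    unfolding p_def by (intro p_bounds[OF n y0 t(2)]; use h in simp)+
  have npl: "1 - \<eta> / 4 \<le> real n * p"
    unfolding p_def using n t(3) by (subst N_mult) (auto simp: pos_le_divide_eq)
  interpret comp_rec p "\<eta>\<^sup>2" "1 - 4 * \<eta>" n by (rule comp_rec_critical[OF h(1,2) pb])
  \<comment> \<open>Large enough for the discount \<open>exp (- \<eta>^2 K)\<close> to be small, yet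
    removing \<open>K\<close> vertices lowers \<open>n p\<close> only by a multiple of
    \<open>\<eta>\<close>.\<close>
  define K where "K = nat \<lfloor>\<eta> * real n / 2\<rfloor>"
  have en: "0 \<le> \<eta> * real n / 2" using h by simp
  have K1: "real K \<le> \<eta> * real n / 2" unfolding K_def by (rule of_nat_floor[OF en])
  have K2: "\<eta> * real n / 2 - 1 \<le> real K" unfolding K_def using en by linarith
  have "\<eta> * real n / 2 \<le> 1 * real n" using h mult_right_mono[of \<eta> 2 "real n"] by simp
  then have Kn: "K \<le> n" using K1 by simp
  \<comment> \<open>The hypothesis on \<open>n \<eta>^3\<close> gives
    \<open>\<eta>^2 K \<ge> 5 - 1\<close>; the 1 covers the rounding of \<open>K\<close>.\<close>
  have "4 \<le> real n * \<eta> ^ 3 / 2 - \<eta>\<^sup>2"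
  proof -
    have "\<eta>\<^sup>2 \<le> 1\<^sup>2" using h by (intro power_mono) auto
    then show ?thesis using h(3) by simp
  qed
  also have "\<dots> = \<eta>\<^sup>2 * (\<eta> * real n / 2 - 1)" by (simp add: power2_eq_square power3_eq_cube algebra_simps)
  also have "\<dots> \<le> \<eta>\<^sup>2 * real K" using K2 by (intro mult_left_mono) auto
  finally have "exp (- \<eta>\<^sup>2 * real K) \<le> exp (- 4)" by simp
  then have eK: "exp (- \<eta>\<^sup>2 * real K) \<le> 1/32" using exp_4 by linarith
  define y where "y = \<eta> / 2"
  have py: "0 \<le> p * y" "p * y \<le> 1" using pb h mult_mono[of p 1 y 1] by (auto simp: y_def)
  have "\<psi> n 1 \<le> (1 - y) + 2 * exp (- \<eta>\<^sup>2 * real K) * (1 - (1 - 4 * \<eta>))"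
  proof (rule psi_1_le)
    have "exp (- \<eta>\<^sup>2) * (1 - p + p * (1 - y)) ^ (n - K) = exp (- \<eta>\<^sup>2) * (1 - p * y) ^ (n - K)"
      by (simp add: algebra_simps)
    also have "\<dots> \<le> exp (- \<eta>\<^sup>2) * exp (- real (n - K) * (p * y))"
      by (intro mult_left_mono power_exp_upper py) simp
    also have "\<dots> = exp (- \<eta>\<^sup>2 - real (n - K) * (p * y))" by (simp add: exp_add[symmetric])
    also have "\<dots> \<le> exp (- y - y\<^sup>2)"
    proof -
      have "real K * p \<le> \<eta> * real n / 2 * p" using K1 pb by (intro mult_right_mono) auto
      also have "\<dots> = \<eta> / 2 * (real n * p)" by simp
      also have "\<dots> \<le> \<eta> / 2 * (5/4)" using pb h by (intro mult_left_mono) auto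
      finally have "1 - \<eta> \<le> real (n - K) * p" using npl Kn h(1) by (simp add: of_nat_diff algebra_simps)
      moreover have "0 \<le> y" using h by (simp add: y_def)
      ultimately have 1: "(1 - \<eta>) * y \<le> real (n - K) * p * y" by (rule mult_right_mono)
      have "y + y\<^sup>2 \<le> \<eta>\<^sup>2 + (1 - \<eta>) * y"
        using zero_le_power2[of \<eta>] by (simp add: y_def power2_eq_square field_simps)
      also have "\<dots> \<le> \<eta>\<^sup>2 + real (n - K) * p * y" using 1 by simp
      finally have "- \<eta>\<^sup>2 - real (n - K) * (p * y) \<le> - y - y\<^sup>2"
        unfolding mult.assoc by linarith
      then show ?thesis by (rule exp_le_cancel_iff[THEN iffD2])
    qed
    also have "\<dots> \<le> 1 - y" using h by (intro one_minus_ge_exp) (auto simp: y_def)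
    finally show "exp (- \<eta>\<^sup>2) * (1 - p + p * (1 - y)) ^ (n - K) \<le> 1 - y" .
  qed (use h n eK in \<open>auto simp: y_def\<close>)
  also have "\<dots> \<le> (1 - y) + 2 * (1/32) * (1 - (1 - 4 * \<eta>))"
    using eK h by (intro add_left_mono mult_right_mono mult_left_mono) auto
  also have "\<dots> = 1 - \<eta> / 4" by (simp add: y_def)
  finally have psi: "\<psi> n 1 \<le> 1 - \<eta> / 4" .
  have nd: "0 < real n * \<eta> / 8" using n h by simp
  have "prob_t n t (\<lambda>E. real n - comp_laplace (\<eta>\<^sup>2) n E \<le> real n * \<eta> / 8) \<le> 4 * subset_mean p (Kn_edges n) (\<lambda>E. of_bool (real n - comp_laplace (\<eta>\<^sup>2) n E \<le> real n * \<eta> / 8))"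
    unfolding p_def by (rule prob_X_decreasing[OF l0 t(1,4)])
  also have "subset_mean p (Kn_edges n) (\<lambda>E. of_bool (real n - comp_laplace (\<eta>\<^sup>2) n E \<le> real n * \<eta> / 8)) \<le> V / (real n * \<eta> / 8)\<^sup>2"
    using EP_X_lower[OF _ nd psi] n by (simp add: field_simps)
  also have "\<dots> \<le> (101 * real n / \<eta>) / (real n * \<eta> / 8)\<^sup>2"
    using V_critical[OF h(1,2) pb] by (intro divide_right_mono) auto
  also have "\<dots> = 6464 / (real n * \<eta> ^ 3)" using n h by (simp add: power2_eq_square power3_eq_cube field_simps)
  finally show ?thesis by simp
qed

section \<open>Upper bounds for forbidden pairs below, inside and just above the window\<close>

context constrained_process begin

lemma forb_from_X:
  assumes "es \<in> orderings n" "0 < l" "real n - comp_laplace l n (set (take t es)) \<le> z"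
  shows "2 * real (forb P (proc P n es t)) \<le> 2 * z / l + (2 * z)\<^sup>2"
proof -
  have s: "set (take t es) \<subseteq> Kn_edges n" using assms(1) set_take_subset[of t es] by (simp add: orderings_def)
  show ?thesis
    using forb_upper[OF s] sum_comp_size_le_X[OF s[unfolded Kn_edges_eq] assms(2,3)] by linarith
qed

lemma prob_forb_gt:
  assumes "0 < l" "2 * z / l + (2 * z)\<^sup>2 \<le> 2 * b"
  shows "prob_ord n (\<lambda>es. \<not> real (forb P (proc P n es t)) \<le> b) \<le> prob_t n t (\<lambda>E. z \<le> real n - comp_laplace l n E)"
proof (rule prob_ord_mono)
  fix es assume es: "es \<in> orderings n" and nb: "\<not> real (forb P (proc P n es t)) \<le> b"
  show "z \<le> real n - comp_laplace l n (set (take t es))"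
  proof (rule ccontr)
    assume "\<not> z \<le> real n - comp_laplace l n (set (take t es))"
    then have "real n - comp_laplace l n (set (take t es)) \<le> z" by simp
    from forb_from_X[OF es assms(1) this] show False using assms(2) nb by linarith
  qed
qed

end

lemma cbrt_facts:
  assumes "1 \<le> n"
  defines "u \<equiv> real n powr (1/3)"
  shows "1 \<le> u" "real n = u ^ 3" "real n powr (2/3) = u\<^sup>2" "real n powr (4/3) = u ^ 4" "sqrt (real n) \<le> u\<^sup>2"
proof -
  have n: "0 < real n" "1 \<le> real n" using assms by auto
  then show u1: "1 \<le> u" unfolding u_def by (intro ge_one_powr_ge_zero) auto
  have k: "u ^ k = real n powr (real k / 3)" for k
    unfolding u_def using n by (simp add: powr_realpow[symmetric] powr_powr)
  show u3: "real n = u ^ 3" using k[of 3] n by simp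
  show u2: "real n powr (2/3) = u\<^sup>2" using k[of 2] by simp
  show "real n powr (4/3) = u ^ 4" using k[of 4] by simp
  have "real n powr (1/2) \<le> real n powr (2/3)" using n by (intro powr_mono) auto
  then show "sqrt (real n) \<le> u\<^sup>2" using n u2 by (simp add: powr_half_sqrt)
qed

lemma sqrt_t_le: "real t \<le> real n \<Longrightarrow> sqrt (real t) \<le> sqrt (real n)"
  by simp

lemma inverse_sqrt_tendsto:
  assumes "filterlim h at_top sequentially"
  shows "(\<lambda>n. c / sqrt (h n)) \<longlonglongrightarrow> (0::real)"
  by (intro tendsto_divide_0[OF tendsto_const] filterlim_at_top_imp_at_infinity
      filterlim_compose[OF sqrt_at_top assms])

lemma inverse_cube_tendsto:
  assumes "filterlim r at_top sequentially"
  shows "(\<lambda>n. c / r n ^ 3) \<longlonglongrightarrow> (0::real)"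
  by (intro tendsto_divide_0[OF tendsto_const] filterlim_at_top_imp_at_infinity
      filterlim_pow_at_top assms) simp

lemma eventually_ratio_ge:
  fixes s :: "nat \<Rightarrow> real"
  assumes "filterlim (\<lambda>n. s n / real n powr (2/3)) at_top sequentially"
  shows "\<forall>\<^sub>F n in sequentially. K * real n powr (2/3) \<le> s n"
proof -
  have "\<forall>\<^sub>F n in sequentially. K \<le> s n / real n powr (2/3)" using assms by (simp add: filterlim_at_top)
  then show ?thesis using eventually_gt_at_top[of 0]
    by eventually_elim (simp add: pos_le_divide_eq)
qed

context constrained_process begin

lemma part_subcritical:
  fixes h :: "nat \<Rightarrow> real" and t :: "nat \<Rightarrow> nat" and s :: "nat \<Rightarrow> real"
  assumes h: "filterlim h at_top sequentially"
    and t: "\<forall>\<^sub>F n in sequentially. 1 \<le> t n \<and> t n \<le> n choose 2 \<and> real (t n) = real n / 2 - s n"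
    and s: "filterlim (\<lambda>n. s n / real n powr (2/3)) at_top sequentially"
  shows "whp (\<lambda>n es. real (forb P (proc P n es (t n))) \<le> 4 * h n * real n ^ 2 / s n)"
proof (rule whpI)
  show "(\<lambda>n. 4 / sqrt (h n)) \<longlonglongrightarrow> 0" by (rule inverse_sqrt_tendsto[OF h])
  have h1: "\<forall>\<^sub>F n in sequentially. 1 \<le> h n" using h by (simp add: filterlim_at_top)
  show "\<forall>\<^sub>F n in sequentially. prob_ord n (\<lambda>es. \<not> real (forb P (proc P n es (t n))) \<le> 4 * h n * real n ^ 2 / s n) \<le> 4 / sqrt (h n)"
    using h1 t eventually_ratio_ge[OF s, of 10] eventually_ge_at_top[of 13]
  proof eventually_elim
    case (elim n)
    define S where "S = s n"
    define H where "H = sqrt (h n)"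
    have H: "1 \<le> H" "H\<^sup>2 = h n" using elim(1) by (auto simp: H_def)
    then have HH: "H \<le> H\<^sup>2" using self_le_power[of H 2] by simp
    define u where "u = real n powr (1/3)"
    have u: "1 \<le> u" "real n powr (2/3) = u\<^sup>2" "sqrt (real n) \<le> u\<^sup>2"
      using cbrt_facts[of n] elim(4) by (auto simp: u_def)
    have tn: "1 \<le> t n" "real (t n) = real n / 2 - S" using elim(2) by (auto simp: S_def)
    have u2: "1 \<le> u\<^sup>2" using u(1) by (simp add: power_le_one_iff)
    have S10: "10 * u\<^sup>2 \<le> S" using elim(3) u(2) by (simp add: S_def)
    then have S0: "10 \<le> S" using u2 by linarith
    have n13: "13 \<le> n" "13 \<le> real n" using elim(4) by auto
    have Sn: "S \<le> real n / 2" using tn by linarith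
    have st: "sqrt (real (t n)) \<le> u\<^sup>2" using u(3) sqrt_t_le[of "t n" n] tn S0 by linarith
    \<comment> \<open>\<open>e\<close> is half of the true gap 2 S / n; the other half absorbs the
      square-root terms of the transfer. \<open>x = 1 / sqrt S\<close> balances the two terms of
      \<open>sum_comp_size_le_X\<close>: apart from powers of \<open>H\<close> both equal 4 n^2 /
      S.\<close>
    define e x where "e = S / real n" and "x = 1 / sqrt S"
    have sq: "1 \<le> sqrt S" "sqrt S * sqrt S = S" using S0 by auto
    have e: "0 < e" "e \<le> 1" "e * real n = S" using S0 Sn n13 by (auto simp: e_def field_simps)
    have x: "0 < x" "x \<le> 1" using sq S0 by (auto simp: x_def)
    have x2: "2 * x \<le> e * real n" using e(3) x S0 by linarith
    have tt: "2 * (real (t n) + 2 * sqrt (real (t n))) \<le> (1 - e) * (real n - 1)"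
    proof -
      have eq: "(1 - e) * (real n - 1) = real n - 1 - S + e" using e(3) by (simp add: algebra_simps)
      have "2 * (T + 2 * q) \<le> real n - 1 - S + e" if "T = real n / 2 - S" "q \<le> v" "10 * v \<le> S" "0 < e" "1 \<le> v" for T q v
        using that by auto
      from this[OF tn(2) st S10 e(1) u2] show ?thesis unfolding eq .
    qed
    \<comment> \<open>Markov fails with probability of order \<open>1 / H\<close>, while
      \<open>z\<close> enters the bound squared; hence \<open>H\<close> is the square root of
      \<open>h n\<close>.\<close>
    define z where "z = real n * x * H"
    have z0: "0 < z" using n13 x H by (simp add: z_def)
    have l0: "0 < e * x / 2" using e x by simp
    have ne: "real n / e = (real n)\<^sup>2 / S" using n13 S0 by (simp add: e_def power2_eq_square)
    have "2 * z / (e * x / 2) = 4 * H * (real n / e)" using x e by (simp add: z_def field_simps)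
    also have "\<dots> = 4 * H * ((real n)\<^sup>2 / S)" by (simp add: ne)
    also have "\<dots> \<le> 4 * H\<^sup>2 * ((real n)\<^sup>2 / S)"
      using mult_right_mono[of "4 * H" "4 * H\<^sup>2" "(real n)\<^sup>2 / S"] HH S0 by simp
    finally have z1: "2 * z / (e * x / 2) \<le> 4 * H\<^sup>2 * ((real n)\<^sup>2 / S)" .
    have "x\<^sup>2 = 1 / S" using sq S0 by (simp add: x_def power_divide power2_eq_square)
    then have z2: "(2 * z)\<^sup>2 = 4 * H\<^sup>2 * ((real n)\<^sup>2 / S)" by (simp add: z_def power_mult_distrib)
    have "2 * z / (e * x / 2) + (2 * z)\<^sup>2 \<le> 2 * (4 * h n * (real n)\<^sup>2 / s n)"
      using z1 z2 H(2) by (simp add: S_def)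
    from prob_forb_gt[OF l0 this]
    have "prob_ord n (\<lambda>es. \<not> real (forb P (proc P n es (t n))) \<le> 4 * h n * (real n)\<^sup>2 / s n)
      \<le> prob_t n (t n) (\<lambda>E. z \<le> real n - comp_laplace (e * x / 2) n E)" .
    also have "\<dots> \<le> 4 * real n * x / z" by (rule prob_X_subcritical[OF n13(1) e(1,2) x x2 tn(1) tt z0])
    also have "\<dots> = 4 / H" using n13 x by (simp add: z_def)
    finally show ?case by (simp add: H_def)
  qed
qed

lemma part_critical:
  fixes h :: "nat \<Rightarrow> real" and t :: "nat \<Rightarrow> nat" and s :: "nat \<Rightarrow> real"
  assumes h: "filterlim h at_top sequentially"
    and t: "\<forall>\<^sub>F n in sequentially. 1 \<le> t n \<and> t n \<le> n choose 2 \<and> real (t n) = real n / 2 + s n"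
    and s: "s \<in> O(\<lambda>n. real n powr (2/3))"
  shows "\<exists>C>0. whp (\<lambda>n es. real (forb P (proc P n es (t n))) \<le> C * h n * real n powr (4/3))"
proof -
  obtain B where B: "0 < B" "\<forall>\<^sub>F n in sequentially. norm (s n) \<le> B * norm (real n powr (2/3))"
    using landau_o.bigE[OF s] by blast
  \<comment> \<open>\<open>2 * B\<close> covers the displacement 2 s of twice the time, and 6 covers
    the transfer term 4 sqrt t together with the rounding.\<close>
  define A where "A = 2 * B + 6"
  have h1: "\<forall>\<^sub>F n in sequentially. 1 \<le> h n" using h by (simp add: filterlim_at_top)
  have big_comps: "\<forall>\<^sub>F n in sequentially. 4 * A \<le> real n powr (1/3)" by real_asymp
  have "whp (\<lambda>n es. real (forb P (proc P n es (t n))) \<le> (1 + 4 * A\<^sup>2) * h n * real n powr (4/3))"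
  proof (rule whpI)
    show "(\<lambda>n. 16 / sqrt (h n)) \<longlonglongrightarrow> 0" by (rule inverse_sqrt_tendsto[OF h])
    show "\<forall>\<^sub>F n in sequentially. prob_ord n (\<lambda>es. \<not> real (forb P (proc P n es (t n))) \<le> (1 + 4 * A\<^sup>2) * h n * real n powr (4/3)) \<le> 16 / sqrt (h n)"
      using h1 t B(2) eventually_ge_at_top[of 13] big_comps
    proof eventually_elim
      case (elim n)
      define H where "H = sqrt (h n)"
      have H: "1 \<le> H" "H\<^sup>2 = h n" using elim(1) by (auto simp: H_def)
      then have HH: "H \<le> H\<^sup>2" using self_le_power[of H 2] by simp
      define u where "u = real n powr (1/3)"
      have u: "1 \<le> u" "real n = u ^ 3" "real n powr (2/3) = u\<^sup>2" "real n powr (4/3) = u ^ 4" "sqrt (real n) \<le> u\<^sup>2"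
        using cbrt_facts[of n] elim(4) by (auto simp: u_def)
      have u2: "1 \<le> u\<^sup>2" using u(1) by (simp add: power_le_one_iff)
      have A: "6 \<le> A" "4 * A \<le> u" using B(1) elim(5) by (auto simp: A_def u_def)
      have sB: "\<bar>s n\<bar> \<le> B * u\<^sup>2" using elim(3) u(3) by simp
      have tn: "1 \<le> t n" "real (t n) = real n / 2 + s n" using elim(2) by auto
      have n13: "13 \<le> n" "13 \<le> real n" using elim(4) by auto
      have "B * u\<^sup>2 \<le> real n / 2"
      proof -
        have "2 * B * u\<^sup>2 \<le> u * u\<^sup>2" using A B(1) by (intro mult_right_mono) (auto simp: A_def)
        then show ?thesis using u(2) by (simp add: power3_eq_cube power2_eq_square)
      qed
      then have "real (t n) \<le> real n" using tn sB by linarith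
      then have st: "sqrt (real (t n)) \<le> u\<^sup>2" using u(5) sqrt_t_le[of "t n" n] by linarith
      define d where "d = A / u"
      have d: "0 < d" "d \<le> 1/4" using A u(1) by (auto simp: d_def field_simps)
      have dn: "d * real n = A * u\<^sup>2" using u(1) unfolding d_def u(2) by (simp add: power3_eq_cube power2_eq_square)
      have tt: "2 * (real (t n) + 2 * sqrt (real (t n))) \<le> (1 + d) * (real n - 1)"
      proof -
        have eq: "(1 + d) * (real n - 1) = real n - 1 + A * u\<^sup>2 - d" using dn by (simp add: algebra_simps)
        have eq2: "A * u\<^sup>2 = 2 * (B * u\<^sup>2) + 6 * u\<^sup>2" by (simp add: A_def algebra_simps)
        have "2 * (T + 2 * q) \<le> real n - 1 + (2 * b + 6 * v) - d" if "T = real n / 2 + s n" "q \<le> v" "\<bar>s n\<bar> \<le> b" "d \<le> 1 / 4" "1 \<le> v" for T q v b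
          using that by auto
        from this[OF tn(2) st sB d(2) u2] show ?thesis unfolding eq eq2 .
      qed
      define z where "z = real n * d * H"
      have z0: "0 < z" using n13 d H by (simp add: z_def)
      have l0: "0 < d\<^sup>2" using d by simp
      have "2 * z / d\<^sup>2 = 2 * H * (real n / d)" using d by (simp add: z_def power2_eq_square field_simps)
      also have "real n / d = u ^ 4 / A" using u(1) A unfolding d_def u(2) by (simp add: power3_eq_cube power4_eq_xxxx)
      also have "2 * H * (u ^ 4 / A) \<le> 2 * H * (u ^ 4 / 1)" using A H by (intro mult_left_mono divide_left_mono) auto
      also have "\<dots> \<le> 2 * H\<^sup>2 * u ^ 4" using mult_right_mono[of "2 * H" "2 * H\<^sup>2" "u ^ 4"] HH by simp
      finally have z1: "2 * z / d\<^sup>2 \<le> 2 * H\<^sup>2 * u ^ 4" .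
      have "(2 * z)\<^sup>2 = 4 * (d * real n)\<^sup>2 * H\<^sup>2" by (simp add: z_def power_mult_distrib)
      also have "\<dots> = 4 * A\<^sup>2 * H\<^sup>2 * u ^ 4" unfolding dn by (simp add: power_mult_distrib power2_eq_square power4_eq_xxxx)
      finally have z2: "(2 * z)\<^sup>2 = 4 * A\<^sup>2 * H\<^sup>2 * u ^ 4" .
      have "0 \<le> 4 * A\<^sup>2 * H\<^sup>2 * u ^ 4" by simp
      moreover have "2 * ((1 + 4 * A\<^sup>2) * H\<^sup>2 * u ^ 4) = 2 * H\<^sup>2 * u ^ 4 + 2 * (4 * A\<^sup>2 * H\<^sup>2 * u ^ 4)"
        by (simp add: algebra_simps)
      ultimately have "2 * z / d\<^sup>2 + (2 * z)\<^sup>2 \<le> 2 * ((1 + 4 * A\<^sup>2) * H\<^sup>2 * u ^ 4)"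
        using z1 z2 by linarith
      then have "2 * z / d\<^sup>2 + (2 * z)\<^sup>2 \<le> 2 * ((1 + 4 * A\<^sup>2) * h n * real n powr (4/3))"
        unfolding H(2) u(4) .
      from prob_forb_gt[OF l0 this]
      have "prob_ord n (\<lambda>es. \<not> real (forb P (proc P n es (t n))) \<le> (1 + 4 * A\<^sup>2) * h n * real n powr (4/3))
        \<le> prob_t n (t n) (\<lambda>E. z \<le> real n - comp_laplace (d\<^sup>2) n E)" .
      also have "\<dots> \<le> 16 * real n * d / z" by (rule prob_X_critical(2)[OF n13(1) d tn(1) tt z0])
      also have "\<dots> = 16 / H" using n13 d by (simp add: z_def)
      finally show ?case by (simp add: H_def)
    qed
  qed
  moreover have "0 < 1 + 4 * A\<^sup>2" using zero_le_power2[of A] by linarith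
  ultimately show ?thesis by blast
qed

lemma prob_supercritical_upper:
  fixes t :: "nat \<Rightarrow> nat" and s :: "nat \<Rightarrow> real"
  assumes t: "\<forall>\<^sub>F n in sequentially. 1 \<le> t n \<and> t n \<le> n choose 2 \<and> real (t n) = real n / 2 + s n"
    and s: "filterlim (\<lambda>n. s n / real n powr (2/3)) at_top sequentially"
    and s0: "(\<lambda>n. s n / real n) \<longlonglongrightarrow> 0"
  shows "\<forall>\<^sub>F n in sequentially. prob_ord n (\<lambda>es. \<not> real (forb P (proc P n es (t n))) \<le> 802 * (s n)\<^sup>2) \<le> 7 / (s n / real n powr (2/3)) ^ 3"
proof -
  have small: "\<forall>\<^sub>F n in sequentially. s n / real n < 1/16" using s0 by (rule order_tendstoD) simp
  show ?thesis
    using t eventually_ratio_ge[OF s, of 10] eventually_ge_at_top[of 13] small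
  proof eventually_elim
    case (elim n)
    define S where "S = s n"
    define u where "u = real n powr (1/3)"
    have u: "1 \<le> u" "real n = u ^ 3" "real n powr (2/3) = u\<^sup>2" "sqrt (real n) \<le> u\<^sup>2"
      using cbrt_facts[of n] elim(3) by (auto simp: u_def)
    have u2: "1 \<le> u\<^sup>2" using u(1) by (simp add: power_le_one_iff)
    have tn: "1 \<le> t n" "real (t n) = real n / 2 + S" using elim(1) by (auto simp: S_def)
    have S10: "10 * u\<^sup>2 \<le> S" using elim(2) u(3) by (simp add: S_def)
    then have S0: "10 \<le> S" using u2 by linarith
    have n13: "13 \<le> n" "13 \<le> real n" using elim(3) by auto
    \<comment> \<open>Twice the true excess 2 S / n, the surplus absorbing the transfer. Then
      \<open>z = 20 * S\<close>, and 802 dominates (1600 + 5/2) / 2.\<close>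
    define d where "d = 4 * S / real n"
    have d: "0 < d" "d \<le> 1/4" using S0 n13 elim(4) by (auto simp: d_def S_def field_simps)
    have dn: "d * real n = 4 * S" using n13 by (simp add: d_def)
    have "real (t n) \<le> real n" using tn elim(4) n13 by (simp add: S_def field_simps)
    then have st: "sqrt (real (t n)) \<le> u\<^sup>2" using u(4) sqrt_t_le[of "t n" n] by linarith
    have tt: "2 * (real (t n) + 2 * sqrt (real (t n))) \<le> (1 + d) * (real n - 1)"
    proof -
      have eq: "(1 + d) * (real n - 1) = real n - 1 + 4 * S - d" using dn by (simp add: algebra_simps)
      have "2 * (T + 2 * q) \<le> real n - 1 + 4 * S - d" if "T = real n / 2 + S" "q \<le> v" "10 * v \<le> S" "d \<le> 1 / 4" "1 \<le> v" for T q v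
        using that by auto
      from this[OF tn(2) st S10 d(2) u2] show ?thesis unfolding eq .
    qed
    have l0: "0 < d\<^sup>2" using d by simp
    define z where "z = 5 * real n * d"
    have z: "z = 20 * S" using dn by (simp add: z_def algebra_simps)
    \<comment> \<open>Beyond the window the contribution of small components, of order n^2 / S, is
      dominated by S^2.\<close>
    have S3: "(real n)\<^sup>2 \<le> S ^ 3"
    proof -
      have "(u\<^sup>2) ^ 3 \<le> S ^ 3" using S10 u2 by (intro power_mono) auto
      then show ?thesis unfolding u(2) by (simp add: power_mult[symmetric])
    qed
    have "2 * z / d\<^sup>2 = 5 / 2 * ((real n)\<^sup>2 / S)"
      using S0 n13 unfolding z d_def by (simp add: power2_eq_square field_simps)
    also have "\<dots> \<le> 5 / 2 * S\<^sup>2"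
      using S3 S0 by (intro mult_left_mono) (auto simp: pos_divide_le_eq power2_eq_square power3_eq_cube)
    finally have z1: "2 * z / d\<^sup>2 \<le> 5 / 2 * S\<^sup>2" .
    have "2 * z / d\<^sup>2 + (2 * z)\<^sup>2 \<le> 2 * (802 * (s n)\<^sup>2)"
    proof -
      have "(2 * z)\<^sup>2 = 1600 * S\<^sup>2" by (simp add: z power_mult_distrib)
      then show ?thesis unfolding S_def[symmetric] using z1 zero_le_power2[of S] by linarith
    qed
    from prob_forb_gt[OF l0 this]
    have "prob_ord n (\<lambda>es. \<not> real (forb P (proc P n es (t n))) \<le> 802 * (s n)\<^sup>2) \<le> prob_t n (t n) (\<lambda>E. z \<le> real n - comp_laplace (d\<^sup>2) n E)" .
    also have "\<dots> \<le> 404 / (real n * d ^ 3)" unfolding z_def by (rule prob_X_critical(1)[OF n13(1) d tn(1) tt])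
    also have "real n * d ^ 3 = 64 * (S / u\<^sup>2) ^ 3"
    proof -
      have "(u\<^sup>2) ^ 3 = (real n)\<^sup>2" unfolding u(2) by (simp add: power_mult[symmetric])
      then show ?thesis using n13 by (simp add: d_def power_divide power_mult_distrib power2_eq_square power3_eq_cube)
    qed
    also have "404 / (64 * (S / u\<^sup>2) ^ 3) \<le> 7 / (S / u\<^sup>2) ^ 3"
    proof -
      have "0 < (S / u\<^sup>2) ^ 3" using S0 u(1) by (intro zero_less_power divide_pos_pos) auto
      moreover have "404 / (64 * Y) \<le> 7 / Y" if "0 < Y" for Y :: real using that by (simp add: field_simps)
      ultimately show ?thesis by blast
    qed
    finally show ?case by (simp add: S_def u(3))
  qed
qed

end

section \<open>The lower bound just above the window\<close>

lemma card_big_le: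
  assumes "0 < l" "real n - comp_laplace l n E \<le> z" shows "real (card (big_comps n (1 / l) E)) \<le> 2 * z"
proof -
  have "1 / 2 * real (card (big_comps n (1 / l) E)) \<le> (1 - exp (- l * (1 / l))) * real (card (big_comps n (1 / l) E))"
    using assms exp_lower[of 1] by (intro mult_right_mono) auto
  also have "\<dots> \<le> z" using X_big[OF assms(1), of "1 / l" n E] assms(2) by simp
  finally show ?thesis by simp
qed

lemma finite_big [simp]: "finite (big_comps n k E)"
  by (simp add: big_comps_def)

lemma big_comps_antimono: "k \<le> k' \<Longrightarrow> big_comps n k' E \<subseteq> big_comps n k E"
  by (auto simp: big_comps_def)

lemma big_comps_component:
  assumes "E \<subseteq> pairs {1..n}" "v \<in> {1..n}" "u \<in> reach E {v}"
  shows "u \<in> big_comps n k E \<longleftrightarrow> v \<in> big_comps n k E"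
proof -
  have "reach E {v} \<subseteq> {1..n}" using assms by (intro reach_subset_verts) auto
  then have "u \<in> {1..n}" using assms(3) by auto
  moreover have "comp_size E u = comp_size E v" using reach_eq[OF assms(3)] by (simp add: comp_size_def)
  ultimately show ?thesis using assms(2) by (simp add: big_comps_def)
qed

context constrained_process begin

lemma conn_set_family_components:
  assumes "set xs \<subseteq> Kn_edges n" and fin: "finite A"
  shows "conn_set_family (proc_edges P n xs) ((\<lambda>v. reach (set xs) {v}) ` A)"
  unfolding conn_set_family_def
proof (intro conjI ballI impI)
  fix B assume "B \<in> (\<lambda>v. reach (set xs) {v}) ` A"
  then obtain v where "B = reach (proc_edges P n xs) {v}" using reach_PE[OF assms(1)] by auto
  then show "conn_set (proc_edges P n xs) B" by (simp add: conn_set_reach)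
next
  fix B B' assume "B \<in> (\<lambda>v. reach (set xs) {v}) ` A" "B' \<in> (\<lambda>v. reach (set xs) {v}) ` A" and ne: "B \<noteq> B'"
  then obtain v v' where v: "B = reach (set xs) {v}" "B' = reach (set xs) {v'}" by auto
  show "B \<inter> B' = {}"
  proof (rule ccontr)
    assume "B \<inter> B' \<noteq> {}"
    then obtain w where w: "w \<in> B" "w \<in> B'" by auto
    have "B = B'" using reach_eq[of w "set xs" v] reach_eq[of w "set xs" v'] w v by simp
    then show False using ne by simp
  qed
qed (use fin in simp)

lemma conn_set_family_card_Union:
  assumes "conn_set_family E F" "\<And>B. B \<in> F \<Longrightarrow> finite B \<and> k \<le> real (card B)"
  shows "k * real (card F) \<le> real (card (\<Union>F))"
proof -
  have "card (\<Union>F) = (\<Sum>B\<in>F. card B)"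
    using assms by (intro card_Union_disjoint) (auto simp: conn_set_family_def pairwise_def disjnt_def)
  then have "real (card (\<Union>F)) = (\<Sum>B\<in>F. real (card B))" by simp
  also have "\<dots> \<ge> (\<Sum>B\<in>F. k)" using assms by (intro sum_mono) auto
  finally show ?thesis by (simp add: mult.commute)
qed

text \<open>The pieces are whole components with sizes in a band: the lower end bounds their number,
  the upper end their size.\<close>

lemma pieces_band:
  assumes xs: "set xs \<subseteq> Kn_edges n" and k: "0 < k0" "k0 \<le> k1" "k1 \<le> real b"
    and M: "real (card (big_comps n k0 (set xs))) < k0 * (real M + 1)"
    and \<mu>: "real \<mu> + real (card (big_comps n k1 (set xs))) \<le> real (card (big_comps n k0 (set xs)))"
  shows "\<exists>F. pieces n b M \<mu> xs F"
proof -
  let ?E = "set xs"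
  have E: "?E \<subseteq> pairs {1..n}" using xs by (simp add: Kn_edges_eq)
  define A where "A = big_comps n k0 ?E - big_comps n k1 ?E"
  have A1: "A \<subseteq> {1..n}" "finite A" by (auto simp: A_def big_comps_def)
  define F where "F = (\<lambda>v. reach ?E {v}) ` A"
  have fF: "conn_set_family (proc_edges P n xs) F" unfolding F_def by (rule conn_set_family_components[OF xs A1(2)])
  have UF: "\<Union>F = A"
  proof
    show "\<Union>F \<subseteq> A"
    proof
      fix u assume "u \<in> \<Union>F"
      then obtain v where v: "v \<in> A" "u \<in> reach ?E {v}" by (auto simp: F_def)
      then have "v \<in> {1..n}" using A1 by auto
      from big_comps_component[OF E this v(2)] show "u \<in> A" using v(1) by (simp add: A_def)
    qed
    show "A \<subseteq> \<Union>F" unfolding F_def using reach_superset by fastforce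
  qed
  have B: "finite B \<and> k0 \<le> real (card B) \<and> real (card B) < k1" if BF: "B \<in> F" for B
  proof -
    obtain v where v: "v \<in> A" "B = reach ?E {v}" using BF by (auto simp: F_def)
    have "B \<subseteq> A" using UF BF by auto
    then have "finite B" using A1(2) finite_subset by auto
    then show ?thesis using v by (auto simp: A_def big_comps_def comp_size_def)
  qed
  have "k0 * real (card F) \<le> real (card (\<Union>F))" using B by (intro conn_set_family_card_Union[OF fF]) auto
  also have "\<dots> \<le> real (card (big_comps n k0 ?E))" unfolding UF by (intro of_nat_mono card_mono) (auto simp: A_def)
  also have "\<dots> < k0 * (real M + 1)" by (rule M)
  finally have "card F \<le> M" using k(1) by simp
  moreover have "card B \<le> b" if "B \<in> F" for B using B[OF that] k(3) by linarith
  moreover have "\<mu> \<le> card (\<Union>F)"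
  proof -
    have "card A = card (big_comps n k0 ?E) - card (big_comps n k1 ?E)"
      unfolding A_def using big_comps_antimono[OF k(2)] by (intro card_Diff_subset) auto
    then show ?thesis using \<mu> unfolding UF by linarith
  qed
  ultimately show ?thesis unfolding pieces_def using fF UF A1(1) by (intro exI[of _ F]) simp
qed

text \<open>The constants come from two optimisations. \<open>\<eta> = d / 160\<close> maximises
  \<open>\<eta> n / 8 - 10 \<eta>^2 n / d\<close>, the lower bound for the number of vertices in
  components of size at least \<open>1 / d^2\<close>, with value n d / 2560.
  \<open>d3 = d / 51200\<close> makes the upper bound \<open>10 n d3\<close>, for components of size
  at least \<open>1 / d3^2\<close>, half of that; the band keeps the other half.\<close>

lemma prob_no_band:
  fixes d r :: real
  defines "d3 \<equiv> d / 51200" and "\<eta> \<equiv> d / 160"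
  assumes n: "13 \<le> n" and d: "0 < d" "d \<le> 1/4" and r: "sqrt (real n) \<le> r" "1 \<le> r" "r ^ 3 = (real n)\<^sup>2" "20 * r \<le> d3 * real n"
    and b: "1 / d3\<^sup>2 \<le> real b" and M: "10 * real n * d ^ 3 < real M + 1" and \<mu>: "real \<mu> \<le> real n * d / 5120"
  shows "prob_ord n (\<lambda>es. \<not> (\<exists>F. pieces n b M \<mu> (take (n div 2) es) F))
    \<le> (404 + 404 * 51200 ^ 3 + 25856 * 160 ^ 3) / (real n * d ^ 3)"
proof -
  let ?t = "n div 2"
  have n13: "13 \<le> real n" using n by simp
  have t: "real n / 2 - 1/2 \<le> real ?t" "real ?t \<le> real n / 2" "4 \<le> ?t" using n by linarith+
  have tN: "?t \<le> n choose 2"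
  proof -
    have "real n * 1 \<le> real n * (real n - 1)" using n13 by (intro mult_left_mono) auto
    then have "real n / 2 \<le> real (n choose 2)" by (simp add: choose_two_real)
    then show ?thesis using t(2) by linarith
  qed
  have st: "sqrt (real ?t) \<le> r" using r(1) sqrt_t_le[of ?t n] t(2) by linarith
  have d3: "0 < d3" "d3 \<le> 1/4" "d3 \<le> d" using d by (auto simp: d3_def)
  have eta: "0 < \<eta>" "\<eta> \<le> 1/4" using d by (auto simp: \<eta>_def)
  have dn: "20 * r \<le> d * real n" using r(4) mult_right_mono[OF d3(3), of "real n"] by linarith
  have en: "20 * r \<le> \<eta> * real n"
  proof -
    have "d3 \<le> \<eta>" using d by (simp add: d3_def \<eta>_def)
    then show ?thesis using r(4) mult_right_mono[of d3 \<eta> "real n"] by linarith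
  qed
  have up: "2 * (real ?t + 2 * sqrt (real ?t)) \<le> (1 + x) * (real n - 1)" if "0 < x" "x \<le> 1/4" "20 * r \<le> x * real n" for x
  proof -
    have eq: "(1 + x) * (real n - 1) = real n - 1 + x * real n - x" by (simp add: algebra_simps)
    show ?thesis unfolding eq using that t(2) st r(2) by auto
  qed
  have lo1: "2 * (real ?t - 2 * sqrt (real ?t)) \<le> (1 + \<eta>) * (real n - 1)"
  proof -
    have eq: "(1 + \<eta>) * (real n - 1) = real n - 1 + \<eta> * real n - \<eta>" by (simp add: algebra_simps)
    have "2 * (T - 2 * q) \<le> real n - 1 + \<eta> * real n - \<eta>" if "T \<le> real n / 2" "0 \<le> q" for T q
      using that en r(2) eta by auto
    from this[OF t(2), of "sqrt (real ?t)"] show ?thesis unfolding eq by simp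
  qed
  have lo2: "(1 - \<eta> / 4) * (real n - 1) \<le> 2 * (real ?t - 2 * sqrt (real ?t))"
  proof -
    have eq: "(1 - \<eta> / 4) * (real n - 1) = real n - 1 - \<eta> * real n / 4 + \<eta> / 4" by (simp add: field_simps)
    show ?thesis unfolding eq using t(1) st en r(2) eta by auto
  qed
  have cube: "10 \<le> real n * \<eta> ^ 3"
  proof -
    have "r ^ 3 * 20 ^ 3 \<le> (\<eta> * real n) ^ 3" using power_mono[OF en, of 3] r(2) by (simp add: power_mult_distrib mult.commute)
    then have "(real n)\<^sup>2 * 20 ^ 3 \<le> (real n)\<^sup>2 * (real n * \<eta> ^ 3)"
      unfolding r(3) by (simp add: power_mult_distrib power2_eq_square power3_eq_cube algebra_simps)
    then have "20 ^ 3 \<le> real n * \<eta> ^ 3" using n13 by (subst (asm) mult_le_cancel_left_pos) auto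
    then show ?thesis by simp
  qed
  let ?X = "\<lambda>l es. real n - comp_laplace l n (set (take ?t es))"
  let ?Q1 = "\<lambda>es. 5 * real n * d \<le> ?X (d\<^sup>2) es"
  let ?Q2 = "\<lambda>es. 5 * real n * d3 \<le> ?X (d3\<^sup>2) es"
  let ?Q3 = "\<lambda>es. ?X (\<eta>\<^sup>2) es \<le> real n * \<eta> / 8"
  have P1: "prob_ord n ?Q1 \<le> 404 / (real n * d ^ 3)"
    by (rule prob_X_critical(1)[OF n d _ up[OF d dn]]) (use t in linarith)
  have P2: "prob_ord n ?Q2 \<le> 404 / (real n * d3 ^ 3)"
    by (rule prob_X_critical(1)[OF n d3(1,2) _ up[OF d3(1,2) r(4)]]) (use t in linarith)
  have P3: "prob_ord n ?Q3 \<le> 25856 / (real n * \<eta> ^ 3)"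
    by (rule prob_X_lower[OF n eta cube t(3) lo1 lo2 tN])
  have "prob_ord n (\<lambda>es. \<not> (\<exists>F. pieces n b M \<mu> (take ?t es) F)) \<le> prob_ord n (\<lambda>es. (?Q1 es \<or> ?Q2 es) \<or> ?Q3 es)"
  proof (rule prob_ord_mono, rule ccontr)
    fix es assume es: "es \<in> orderings n" and no: "\<not> (\<exists>F. pieces n b M \<mu> (take ?t es) F)" and nq: "\<not> ((?Q1 es \<or> ?Q2 es) \<or> ?Q3 es)"
    let ?E = "set (take ?t es)"
    have sub: "?E \<subseteq> Kn_edges n" using es set_take_subset[of ?t es] by (simp add: orderings_def)
    have q: "?X (d\<^sup>2) es \<le> 5 * real n * d" "?X (d3\<^sup>2) es \<le> 5 * real n * d3" "real n * \<eta> / 8 \<le> ?X (\<eta>\<^sup>2) es"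
      using nq by auto
    have d2: "0 < d\<^sup>2" "0 < d3\<^sup>2" "0 < \<eta>\<^sup>2" using d d3 eta by auto
    have b1: "real (card (big_comps n (1 / d\<^sup>2) ?E)) \<le> 10 * real n * d" using card_big_le[OF d2(1) q(1)] by simp
    have b3: "real (card (big_comps n (1 / d3\<^sup>2) ?E)) \<le> real n * d / 5120" 
    proof -
      have "2 * (5 * real n * d3) = real n * d / 5120" by (simp add: d3_def)
      then show ?thesis using card_big_le[OF d2(2) q(2)] by linarith
    qed
    \<comment> \<open>Failure of \<open>?Q3\<close> makes \<open>X\<close> large at rate
      \<open>\<eta>^2\<close>. Failure of \<open>?Q1\<close> limits the share of the components
      below \<open>1 / d^2\<close>, so the rest must come from larger ones.\<close>
    have "real n * \<eta> / 8 \<le> \<eta>\<^sup>2 * (\<Sum>v\<in>{1..n} - big_comps n (1 / d\<^sup>2) ?E. real (comp_size ?E v)) + real (card (big_comps n (1 / d\<^sup>2) ?E))"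
      using q(3) X_le[OF d2(3), of n ?E "1 / d\<^sup>2"] by linarith
    also have "(\<Sum>v\<in>{1..n} - big_comps n (1 / d\<^sup>2) ?E. real (comp_size ?E v)) \<le> 2 * (5 * real n * d) / d\<^sup>2"
      using X_small[OF d2(1), where n = n and E = ?E] divide_right_mono[OF mult_left_mono[OF q(1), of 2], of "d\<^sup>2"] by simp
    finally have "real n * \<eta> / 8 \<le> \<eta>\<^sup>2 * (2 * (5 * real n * d) / d\<^sup>2) + real (card (big_comps n (1 / d\<^sup>2) ?E))"
      using d2 by (simp add: mult_left_mono)
    note est = this
    have e1: "\<eta>\<^sup>2 * (2 * (5 * real n * d) / d\<^sup>2) = real n * d / 2560"
      using d by (simp add: \<eta>_def power2_eq_square field_simps)
    have e2: "real n * \<eta> / 8 = real n * d / 1280" by (simp add: \<eta>_def)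
    have b2: "real n * d / 2560 \<le> real (card (big_comps n (1 / d\<^sup>2) ?E))" using est unfolding e1 e2 by linarith
    have "\<exists>F. pieces n b M \<mu> (take ?t es) F"
    proof (rule pieces_band[OF sub, of "1 / d\<^sup>2" "1 / d3\<^sup>2"])
      show "0 < 1 / d\<^sup>2" using d by simp
      have "d3\<^sup>2 \<le> d\<^sup>2" using d3 by (intro power_mono) auto
      then show "1 / d\<^sup>2 \<le> 1 / d3\<^sup>2" using d2 by (intro divide_left_mono) auto
      show "1 / d3\<^sup>2 \<le> real b" by (rule b)
      have "10 * real n * d = 1 / d\<^sup>2 * (10 * real n * d ^ 3)" using d by (simp add: power2_eq_square power3_eq_cube)
      also have "\<dots> < 1 / d\<^sup>2 * (real M + 1)" using M d by (intro mult_strict_left_mono) auto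
      finally show "real (card (big_comps n (1 / d\<^sup>2) ?E)) < 1 / d\<^sup>2 * (real M + 1)" using b1 by linarith
      show "real \<mu> + real (card (big_comps n (1 / d3\<^sup>2) ?E)) \<le> real (card (big_comps n (1 / d\<^sup>2) ?E))"
        using \<mu> b2 b3 by linarith
    qed
    then show False using no by simp
  qed
  also have "\<dots> \<le> prob_ord n (\<lambda>es. ?Q1 es \<or> ?Q2 es) + prob_ord n ?Q3" by (rule prob_ord_union)
  also have "\<dots> \<le> (prob_ord n ?Q1 + prob_ord n ?Q2) + prob_ord n ?Q3" by (intro add_right_mono prob_ord_union)
  also have "\<dots> \<le> (404 / (real n * d ^ 3) + 404 / (real n * d3 ^ 3)) + 25856 / (real n * \<eta> ^ 3)"
    by (intro add_mono P1 P2 P3)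
  also have "\<dots> = (404 + 404 * 51200 ^ 3 + 25856 * 160 ^ 3) / (real n * d ^ 3)"
    using d n13 by (simp add: d3_def \<eta>_def field_simps)
  finally show ?thesis .
qed

text \<open>Sprinkling in the form in which it is applied: \<open>A\<close> bounds the number of
  possible adjacencies, so the cost is at most \<open>exp A\<close> against a gain of
  \<open>exp (- 2 A)\<close>. The difference between \<open>Q\<close> and \<open>q\<close> makes
  room for the pairs inside pieces or between adjacent ones.\<close>

lemma prob_forb_lower:
  assumes G: "finite V0" "E0 \<subseteq> pairs V0" "(V0, E0) \<notin> P" and t: "t1 \<le> t" "t \<le> n choose 2"
    and \<mu>: "\<beta> + Q \<le> real (\<mu> choose 2)"
    and M: "2 ^ card V0 * real M \<le> A" and q: "0 \<le> q" "q + (real M + 2 ^ card V0 * real M) * (real b)\<^sup>2 \<le> Q"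
    and ex: "2 * A \<le> q * real (t - t1) / (2 * real (n choose 2))"
  shows "prob_ord n (\<lambda>es. \<not> \<beta> \<le> real (forb P (proc P n es t)))
    \<le> prob_ord n (\<lambda>es. \<not> (\<exists>F. pieces n b M \<mu> (take t1 es) F)) + exp (- A)"
proof -
  let ?a = "2 ^ card V0 * M" let ?q = "Q - real ((M + ?a) * b\<^sup>2)"
  let ?p = "\<lambda>es. \<exists>F. pieces n b M \<mu> (take t1 es) F"
  let ?R = "\<lambda>es. ?p es \<and> real (forb P (proc P n es t)) < real (\<mu> choose 2) - Q"
  have qq: "q \<le> ?q" using q(2) by simp
  have "prob_ord n (\<lambda>es. \<not> \<beta> \<le> real (forb P (proc P n es t))) \<le> prob_ord n (\<lambda>es. \<not> ?p es \<or> ?R es)"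
  proof (rule prob_ord_mono)
    fix es assume "\<not> \<beta> \<le> real (forb P (proc P n es t))"
    then have "real (forb P (proc P n es t)) < real (\<mu> choose 2) - Q" using \<mu> by linarith
    then show "\<not> ?p es \<or> ?R es" by blast
  qed
  also have "\<dots> \<le> prob_ord n (\<lambda>es. \<not> ?p es) + prob_ord n ?R" by (rule prob_ord_union)
  also have "prob_ord n ?R \<le> 2 ^ ?a * exp (- ?q * real (t - t1) / (2 * real (n choose 2)))"
    by (rule sprinkling[OF G t]) (use qq q(1) in linarith)
  also have "\<dots> \<le> exp A * exp (- (2 * A))"
  proof (rule mult_mono)
    have "(2::real) \<le> exp 1" using exp_ge_add_one_self[of 1] by simp
    then have "(2::real) ^ ?a \<le> exp 1 ^ ?a" by (intro power_mono) auto
    also have "\<dots> = exp (real ?a)" using exp_of_nat_mult[of ?a "1::real"] by simp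
    also have "\<dots> \<le> exp A" using M by simp
    finally show "(2::real) ^ ?a \<le> exp A" .
    have "q * real (t - t1) / (2 * real (n choose 2)) \<le> ?q * real (t - t1) / (2 * real (n choose 2))"
      using qq by (intro divide_right_mono mult_right_mono) auto
    then have "2 * A \<le> ?q * real (t - t1) / (2 * real (n choose 2))" using ex by linarith
    moreover have "- ?q * real (t - t1) / (2 * real (n choose 2)) = - (?q * real (t - t1) / (2 * real (n choose 2)))"
      by (simp only: mult_minus_left minus_divide_left)
    ultimately have "- ?q * real (t - t1) / (2 * real (n choose 2)) \<le> - (2 * A)" by linarith
    then show "exp (- ?q * real (t - t1) / (2 * real (n choose 2))) \<le> exp (- (2 * A))"
      by (rule exp_le_cancel_iff[THEN iffD2])
  qed auto
  also have "exp A * exp (- (2 * A)) = exp (- A)" by (simp add: exp_add[symmetric])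
  finally show ?thesis by simp
qed

end

lemma choose_two_floor:
  fixes m :: real
  assumes "6 \<le> m" shows "m\<^sup>2 / 4 \<le> real (nat \<lfloor>m\<rfloor> choose 2)"
proof -
  have fl: "m - 1 \<le> real (nat \<lfloor>m\<rfloor>)" using assms by linarith
  have "0 \<le> m * (m - 6)" using assms by simp
  then have "m\<^sup>2 / 4 \<le> (m - 1) * (m - 2) / 2" by (simp add: power2_eq_square field_simps)
  also have "\<dots> \<le> k * (k - 1) / 2" if "m - 1 \<le> k" for k
    using that assms by (intro divide_right_mono mult_mono) auto
  note this[OF fl]
  finally show ?thesis by (simp add: choose_two_real)
qed

lemma exp_minus_le_inverse: "0 < x \<Longrightarrow> exp (- x) \<le> 1 / x" for x :: real
proof -
  assume x: "0 < x"
  have "x \<le> exp x" using exp_ge_add_one_self[of x] by linarith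
  then have "inverse (exp x) \<le> inverse x" using x by (intro le_imp_inverse_le)
  then show ?thesis by (simp add: exp_minus divide_inverse)
qed

context constrained_process begin

theorem part_supercritical:
  fixes t :: "nat \<Rightarrow> nat" and s :: "nat \<Rightarrow> real"
  assumes t: "\<forall>\<^sub>F n in sequentially. 1 \<le> t n \<and> t n \<le> n choose 2 \<and> real (t n) = real n / 2 + s n"
    and s: "filterlim (\<lambda>n. s n / real n powr (2/3)) at_top sequentially"
    and s0: "(\<lambda>n. s n / real n) \<longlonglongrightarrow> 0"
  shows "\<exists>c>0. \<exists>C>0. whp (\<lambda>n es. c * (s n)\<^sup>2 \<le> real (forb P (proc P n es (t n))) \<and> real (forb P (proc P n es (t n))) \<le> C * (s n)\<^sup>2)"
proof -
  obtain V0 E0 where G: "finite V0" "E0 \<subseteq> pairs V0" "(V0, E0) \<notin> P" by (rule excluded)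
  define D :: real where "D = 2 ^ card V0"
  have D1: "1 \<le> D" unfolding D_def by simp
  \<comment> \<open>This value settles the race: for \<open>d = L S / n\<close> the required
    exponent \<open>2 A\<close> is 20 D L^3 S^3 / n^2, the guaranteed gain is L^2 S^3 / (16 * 5120^2
    n^2), and the two agree exactly.\<close>
  define L where "L = 1 / (320 * 5120\<^sup>2 * D)"
  have L: "0 < L" "L \<le> 1" "320 * 5120\<^sup>2 * D * L = 1" using D1 by (auto simp: L_def field_simps)
  define c where "c = (L / 5120)\<^sup>2 / 8"
  define c1 where "c1 = 40 * (1 + D) * 51200 ^ 4"
  define c2 where "c2 = 16 * 5120\<^sup>2 * c1 / L ^ 3"
  \<comment> \<open>The first summand provides \<open>20 * r \<le> d3 * n\<close>; the second makes
    the exceptional pairs of \<open>card_new_open\<close> negligible.\<close>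
  define K0 where "K0 = 20 * 51200 / L + c2"
  define C3 :: real where "C3 = 404 + 404 * 51200 ^ 3 + 25856 * 160 ^ 3"
  define Ctot where "Ctot = C3 / L ^ 3 + 1 / (10 * D * L ^ 3) + 7"
  have c2: "0 \<le> c2" "0 \<le> c1" using D1 L by (auto simp: c2_def c1_def)
  have small: "\<forall>\<^sub>F n in sequentially. s n / real n < 1/16" using s0 by (rule order_tendstoD) simp
  have "whp (\<lambda>n es. c * (s n)\<^sup>2 \<le> real (forb P (proc P n es (t n))) \<and> real (forb P (proc P n es (t n))) \<le> 802 * (s n)\<^sup>2)"
  proof (rule whpI)
    show "(\<lambda>n. Ctot / (s n / real n powr (2/3)) ^ 3) \<longlonglongrightarrow> 0" by (rule inverse_cube_tendsto[OF s])
    show "\<forall>\<^sub>F n in sequentially. prob_ord n (\<lambda>es. \<not> (c * (s n)\<^sup>2 \<le> real (forb P (proc P n es (t n))) \<and> real (forb P (proc P n es (t n))) \<le> 802 * (s n)\<^sup>2))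
       \<le> Ctot / (s n / real n powr (2/3)) ^ 3"
      using t eventually_ratio_ge[OF s, of K0] eventually_ge_at_top[of 13] small prob_supercritical_upper[OF t s s0]
    proof eventually_elim
      case (elim n)
      define S where "S = s n"
      define r where "r = real n powr (2/3)"
      note cb = cbrt_facts[of n]
      have r: "sqrt (real n) \<le> r" "1 \<le> r" "r ^ 3 = (real n)\<^sup>2"
      proof -
        show "sqrt (real n) \<le> r" using cb(3,5) elim(3) by (simp add: r_def)
        show "1 \<le> r" using cb(1,3) elim(3) by (simp add: r_def power_le_one_iff)
        have "r ^ 3 = (real n powr (1/3)) ^ 6" using cb(3) elim(3) by (simp add: r_def power_mult[symmetric])
        also have "\<dots> = ((real n powr (1/3)) ^ 3)\<^sup>2" by (simp add: power_mult[symmetric])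
        also have "(real n powr (1/3)) ^ 3 = real n" using cb(2) elim(3) by simp
        finally show "r ^ 3 = (real n)\<^sup>2" .
      qed
      have n13: "13 \<le> n" "13 \<le> real n" using elim(3) by auto
      have SK: "K0 * r \<le> S" using elim(2) by (simp add: S_def r_def)
      have S1: "20 * 51200 / L * r \<le> S"
      proof -
        have "20 * 51200 / L * r \<le> K0 * r" using c2 r by (intro mult_right_mono) (auto simp: K0_def)
        then show ?thesis using SK by linarith
      qed
      have rS: "r \<le> S"
      proof -
        have "1 \<le> 20 * 51200 / L" using L by (simp add: field_simps)
        then have "1 * r \<le> 20 * 51200 / L * r" using r by (intro mult_right_mono) auto
        then show ?thesis using S1 by linarith
      qed
      have c2S: "c2 * r \<le> S"
      proof -
        have "c2 * r \<le> K0 * r" using L r by (intro mult_right_mono) (auto simp: K0_def)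
        then show ?thesis using SK by linarith
      qed
      have S0: "0 < S" using r rS by linarith
      define d where "d = L * S / real n"
      have dn: "d * real n = L * S" using n13 by (simp add: d_def)
      have d: "0 < d" "d \<le> 1/4"
      proof -
        show "0 < d" using L S0 n13 by (simp add: d_def)
        have "d = L * (S / real n)" by (simp add: d_def)
        also have "\<dots> \<le> 1 * (1/16)" using L S0 elim(4) n13 by (intro mult_mono) (auto simp: S_def)
        finally show "d \<le> 1/4" by simp
      qed
      define d3 where "d3 = d / 51200"
      have d3: "0 < d3" "d3 \<le> 1" using d by (auto simp: d3_def)
      have r20: "20 * r \<le> d3 * real n"
      proof -
        have "L * (20 * 51200 / L * r) \<le> L * S" using S1 L by (intro mult_left_mono) auto
        then have "20 * 51200 * r \<le> L * S" using L by simp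
        moreover have "d3 * real n = L * S / 51200" using dn by (simp add: d3_def)
        ultimately show ?thesis by simp
      qed
      define m where "m = real n * d / 5120"
      have m: "m = L * S / 5120" using dn by (simp add: m_def mult.commute)
      have m6: "6 \<le> m"
      proof -
        have "d3 * real n = L * S / 51200" using dn by (simp add: d3_def)
        then show ?thesis using r20 r(2) unfolding m by linarith
      qed
      define b where "b = nat \<lceil>1 / d3\<^sup>2\<rceil>"
      define M where "M = nat \<lfloor>10 * real n * d ^ 3\<rfloor>"
      define \<mu> where "\<mu> = nat \<lfloor>m\<rfloor>"
      have b1: "1 / d3\<^sup>2 \<le> real b" unfolding b_def by (rule of_nat_ceiling)
      have M0: "0 \<le> 10 * real n * d ^ 3" using d by simp
      have M1: "real M \<le> 10 * real n * d ^ 3" unfolding M_def by (rule of_nat_floor[OF M0])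
      have M2: "10 * real n * d ^ 3 < real M + 1" unfolding M_def using M0 by linarith
      have mu1: "real \<mu> \<le> real n * d / 5120" unfolding \<mu>_def m_def[symmetric] using m6 by (intro of_nat_floor) simp
      have b2: "real b \<le> 2 / d3\<^sup>2"
      proof -
        have "1 / d3\<^sup>2 \<ge> 1" using d3 by (simp add: power_le_one)
        then show ?thesis unfolding b_def by linarith
      qed
      have d3n: "real n * d ^ 3 = L ^ 3 * (S / r) ^ 3"
      proof -
        have "real n * d ^ 3 * (real n)\<^sup>2 = (d * real n) ^ 3" by (simp add: power2_eq_square power3_eq_cube)
        also have "\<dots> = L ^ 3 * S ^ 3" unfolding dn by (rule power_mult_distrib)
        finally show ?thesis using n13 r(2) unfolding r(3)[symmetric] by (simp add: power_divide field_simps)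
      qed
      define R where "R = (S / r) ^ 3"
      have R0: "0 < R" unfolding R_def using S0 r by (intro zero_less_power divide_pos_pos) auto
      define A where "A = 10 * D * (L ^ 3 * R)"
      have A0: "0 < A" using D1 L R0 by (simp add: A_def)
      have Areal: "A = D * (10 * real n * d ^ 3)" unfolding A_def R_def d3n[symmetric] by simp
      have tn: "real (t n) = real n / 2 + S" "t n \<le> n choose 2" using elim(1) by (auto simp: S_def)
      have t1: "n div 2 \<le> t n"
      proof -
        have "real (n div 2) \<le> real n / 2" by linarith
        then show ?thesis using tn S0 by linarith
      qed
      have tt: "S \<le> real (t n - n div 2)"
      proof -
        have "real (n div 2) \<le> real n / 2" by linarith
        then show ?thesis using tn t1 by (simp add: of_nat_diff)
      qed
      have lower: "prob_ord n (\<lambda>es. \<not> c * S\<^sup>2 \<le> real (forb P (proc P n es (t n)))) 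
         \<le> prob_ord n (\<lambda>es. \<not> (\<exists>F. pieces n b M \<mu> (take (n div 2) es) F)) + exp (- A)"
      proof (rule prob_forb_lower[OF G t1 tn(2)])
        \<comment> \<open>The covered set spans at least m^2 / 4 pairs. Half of this is allowed to
          stay open, which defines \<open>c\<close>; of that half, the exceptional pairs use up at
          most m^2 / 16, and m^2 / 16 remains as \<open>q\<close>.\<close>
        have "c * S\<^sup>2 + m\<^sup>2 / 8 = m\<^sup>2 / 4" by (simp add: c_def m power_mult_distrib power_divide)
        then show "c * S\<^sup>2 + m\<^sup>2 / 8 \<le> real (\<mu> choose 2)" unfolding \<mu>_def using choose_two_floor[OF m6] by linarith
        show "2 ^ card V0 * real M \<le> A" unfolding Areal D_def[symmetric] using M1 D1 by (intro mult_left_mono) auto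
        show "0 \<le> m\<^sup>2 / 16" by simp
        show "m\<^sup>2 / 16 + (real M + 2 ^ card V0 * real M) * (real b)\<^sup>2 \<le> m\<^sup>2 / 8"
        proof -
          have "(real b)\<^sup>2 \<le> (2 / d3\<^sup>2)\<^sup>2" using b2 by (intro power_mono) auto
          also have "\<dots> = 4 * 51200 ^ 4 / d ^ 4" unfolding d3_def by (simp add: power_divide power_mult[symmetric])
          finally have bb: "(real b)\<^sup>2 \<le> 4 * 51200 ^ 4 / d ^ 4" .
          have "(real M + 2 ^ card V0 * real M) * (real b)\<^sup>2 = (1 + D) * (real M * (real b)\<^sup>2)"
            by (simp add: D_def algebra_simps)
          also have "\<dots> \<le> (1 + D) * ((10 * real n * d ^ 3) * (4 * 51200 ^ 4 / d ^ 4))"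
            using D1 M1 bb d by (intro mult_left_mono mult_mono) auto
          also have "\<dots> = c1 * (real n / d)" using d by (simp add: c1_def power3_eq_cube power4_eq_xxxx)
          also have "\<dots> \<le> m\<^sup>2 / 16"
          proof -
            \<comment> \<open>The exceptional pairs number O(n / d) = O(n^2 / S), while m^2 is of
              order S^2; \<open>S\<close> exceeding a large multiple of n^(2/3) decides between
              them.\<close>
            have "c2 * (real n)\<^sup>2 = (c2 * r) * (r * r)" unfolding r(3)[symmetric] by (simp add: power3_eq_cube)
            also have "\<dots> \<le> S * (S * S)" using c2S c2 rS r S0 by (intro mult_mono) auto
            finally have "c2 * (real n)\<^sup>2 \<le> S ^ 3" by (simp add: power3_eq_cube)
            then have "L\<^sup>2 / (16 * 5120\<^sup>2) * (c2 * (real n)\<^sup>2) / S \<le> L\<^sup>2 / (16 * 5120\<^sup>2) * S ^ 3 / S"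
              using S0 by (intro divide_right_mono mult_left_mono) auto
            also have "L\<^sup>2 / (16 * 5120\<^sup>2) * S ^ 3 / S = m\<^sup>2 / 16"
              using S0 by (simp add: m power2_eq_square power3_eq_cube)
            also have "L\<^sup>2 / (16 * 5120\<^sup>2) * (c2 * (real n)\<^sup>2) / S = c1 * (real n / d)"
              using S0 L n13 by (simp add: c2_def d_def power2_eq_square power3_eq_cube)
            finally show ?thesis .
          qed
          finally show ?thesis by simp
        qed
        show "2 * A \<le> m\<^sup>2 / 16 * real (t n - n div 2) / (2 * real (n choose 2))"
        proof -
          have N: "2 * real (n choose 2) \<le> (real n)\<^sup>2" "0 < 2 * real (n choose 2)"
            using n13 by (simp_all add: choose_two_real power2_eq_square)
          have "2 * A = 20 * D * (real n * d ^ 3)" unfolding Areal by simp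
          also have "\<dots> = 20 * D * (L ^ 3 * (S / r) ^ 3)" unfolding d3n ..
          also have "\<dots> = (20 * D * L) * (L\<^sup>2 * S ^ 3 / (real n)\<^sup>2)"
            unfolding r(3)[symmetric] by (simp add: power_divide power2_eq_square power3_eq_cube)
          also have "20 * D * L = 1 / (16 * 5120\<^sup>2)" using L(3) by simp
          also have "1 / (16 * 5120\<^sup>2) * (L\<^sup>2 * S ^ 3 / (real n)\<^sup>2) = m\<^sup>2 / 16 * S / (real n)\<^sup>2"
            by (simp add: m power2_eq_square power3_eq_cube)
          also have "\<dots> \<le> m\<^sup>2 / 16 * real (t n - n div 2) / (real n)\<^sup>2"
            using tt by (intro divide_right_mono mult_left_mono) auto
          also have "\<dots> \<le> m\<^sup>2 / 16 * real (t n - n div 2) / (2 * real (n choose 2))"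
            using N by (intro divide_left_mono) auto
          finally show ?thesis .
        qed
      qed
      have nob: "prob_ord n (\<lambda>es. \<not> (\<exists>F. pieces n b M \<mu> (take (n div 2) es) F)) \<le> C3 / (real n * d ^ 3)"
        unfolding C3_def using prob_no_band[OF n13(1) d r r20[unfolded d3_def] b1[unfolded d3_def] M2 mu1] .
      have "prob_ord n (\<lambda>es. \<not> (c * (s n)\<^sup>2 \<le> real (forb P (proc P n es (t n))) \<and> real (forb P (proc P n es (t n))) \<le> 802 * (s n)\<^sup>2))
        \<le> prob_ord n (\<lambda>es. \<not> c * S\<^sup>2 \<le> real (forb P (proc P n es (t n))) \<or> \<not> real (forb P (proc P n es (t n))) \<le> 802 * (s n)\<^sup>2)"
        by (rule prob_ord_mono) (auto simp: S_def)
      also have "\<dots> \<le> prob_ord n (\<lambda>es. \<not> c * S\<^sup>2 \<le> real (forb P (proc P n es (t n)))) + prob_ord n (\<lambda>es. \<not> real (forb P (proc P n es (t n))) \<le> 802 * (s n)\<^sup>2)"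
        by (rule prob_ord_union)
      also have "\<dots> \<le> (C3 / (real n * d ^ 3) + 1 / A) + 7 / R"
        using lower nob exp_minus_le_inverse[OF A0] elim(5) unfolding R_def S_def r_def by linarith
      also have "real n * d ^ 3 = L ^ 3 * R" unfolding d3n R_def ..
      also have "(C3 / (L ^ 3 * R) + 1 / A) + 7 / R = Ctot / R"
        using R0 L D1 by (simp add: Ctot_def A_def field_simps)
      finally show ?case by (simp add: R_def S_def r_def)
    qed
  qed
  moreover have "0 < c" using L by (simp add: c_def)
  ultimately show ?thesis by (intro exI[of _ c] conjI exI[of _ 802]) auto
qed

end

section \<open>The giant component\<close>

definition vertex_deg :: "nat set set \<Rightarrow> nat \<Rightarrow> nat" where
  "vertex_deg E v = card {e \<in> E. v \<in> e}"

text \<open>The edges at \<open>v\<close> are \<open>n - 1\<close> independent trials, and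
  \<open>1 - p + p * exp 1\<close> is at most \<open>exp (2 * p)\<close> because
  \<open>exp 1\<close> is at most 3.\<close>

lemma subset_mean_exp_deg:
  assumes v: "v \<in> {1..n}" and p: "0 \<le> p" "p \<le> 1"
  shows "subset_mean p (Kn_edges n) (\<lambda>E. exp (real (vertex_deg E v))) \<le> exp (2 * (real n * p))"
proof -
  define V where "V = {1..n} - {v}"
  have V: "v \<notin> V" "finite V" "card V = n - 1" "{1..n} = insert v V" using v by (auto simp: V_def)
  have inj: "inj_on (\<lambda>x. {v, x}) V" by (auto simp: inj_on_def doubleton_eq_iff)
  have "subset_mean p (Kn_edges n) (\<lambda>E. exp (real (vertex_deg E v))) = subset_mean p (pairs V \<union> (\<lambda>x. {v, x}) ` V) (\<lambda>E. exp (real (vertex_deg E v)))"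
    unfolding Kn_edges_eq V(4) pairs_insert[OF V(1)] ..
  also have "\<dots> = subset_mean p (pairs V) (\<lambda>E. subset_mean p ((\<lambda>x. {v, x}) ` V) (\<lambda>Y. exp (real (vertex_deg (E \<union> Y) v))))"
  proof (rule subset_mean_union)
    show "pairs V \<inter> (\<lambda>x. {v, x}) ` V = {}" using V(1) by (auto simp: in_pairs_iff)
  qed (use V(2) in auto)
  also have "\<dots> = subset_mean p (pairs V) (\<lambda>E. subset_mean p V (\<lambda>X. exp 1 ^ card X))"
    unfolding subset_mean_image[OF V(2) inj]
  proof (intro subset_mean_cong)
    fix E X assume EX: "E \<subseteq> pairs V" "X \<subseteq> V"
    have "\<And>e. e \<in> E \<Longrightarrow> v \<notin> e" using EX(1) V(1) pairs_subset_Pow by blast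
    then have "{e \<in> E \<union> (\<lambda>x. {v, x}) ` X. v \<in> e} = (\<lambda>x. {v, x}) ` X" by auto
    then have "vertex_deg (E \<union> (\<lambda>x. {v, x}) ` X) v = card X"
      unfolding vertex_deg_def using card_image[OF inj_on_subset[OF inj EX(2)]] by simp
    then show "exp (real (vertex_deg (E \<union> (\<lambda>x. {v, x}) ` X) v)) = exp 1 ^ card X"
      using exp_of_nat_mult[of "card X" "1::real"] by simp
  qed
  also have "\<dots> = bin_mean p (card V) (\<lambda>i. exp 1 ^ i)" using V(2) subset_mean_card[OF V(2), of p "\<lambda>i. exp 1 ^ i"] by simp
  also have "\<dots> = (1 - p + p * exp 1) ^ card V" using bin_mean_power[of p "card V" "exp 1" 0] by simp
  also have "\<dots> \<le> exp (2 * p) ^ card V"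
  proof (rule power_mono)
    have "exp 1 \<le> (3::real)" by (rule exp_le)
    then have "p * exp 1 \<le> p * 3" using p by (intro mult_left_mono) auto
    then show "1 - p + p * exp 1 \<le> exp (2 * p)" using exp_ge_add_one_self[of "2 * p"] by linarith
    show "0 \<le> 1 - p + p * exp 1" using p by simp
  qed
  also have "\<dots> \<le> exp (2 * p) ^ n" unfolding V(3) using p by (intro power_increasing) auto
  also have "\<dots> = exp (2 * (real n * p))" by (simp add: exp_of_nat_mult[symmetric] mult_ac)
  finally show ?thesis .
qed

lemma vertex_deg_mono: "E \<subseteq> E' \<Longrightarrow> finite E' \<Longrightarrow> vertex_deg E v \<le> vertex_deg E' v"
  unfolding vertex_deg_def by (intro card_mono) auto

lemma prob_deg:
  assumes t: "1 \<le> t" "real t + 2 * sqrt (real t) \<le> real (n choose 2)"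
    and a: "real n * ((real t + 2 * sqrt (real t)) / real (n choose 2)) \<le> a"
  shows "prob_t n t (\<lambda>E. \<exists>v\<in>{1..n}. r < vertex_deg E v) \<le> 4 * (real n * (exp (2 * a) / exp (real r)))"
proof -
  define p where "p = (real t + 2 * sqrt (real t)) / real (n choose 2)"
  have N0: "0 \<le> real (n choose 2)" by simp
  have p: "0 \<le> p" "p \<le> 1" unfolding p_def using t(2) by (auto simp: divide_le_eq_1)
  have "prob_t n t (\<lambda>E. \<exists>v\<in>{1..n}. r < vertex_deg E v) \<le> 4 * subset_mean p (Kn_edges n) (\<lambda>E. of_bool (\<exists>v\<in>{1..n}. r < vertex_deg E v))"
    unfolding p_def
  proof (rule prob_t_increasing[OF _ t])
    fix E E' assume "E \<subseteq> E'" "E' \<subseteq> Kn_edges n" "\<exists>v\<in>{1..n}. r < vertex_deg E v"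
    then show "\<exists>v\<in>{1..n}. r < vertex_deg E' v" using vertex_deg_mono[of E E'] finite_subset[OF _ finite_Kn] by (meson less_le_trans)
  qed
  also have "subset_mean p (Kn_edges n) (\<lambda>E. of_bool (\<exists>v\<in>{1..n}. r < vertex_deg E v)) \<le> subset_mean p (Kn_edges n) (\<lambda>E. \<Sum>v\<in>{1..n}. of_bool (r < vertex_deg E v))"
  proof (rule subset_mean_mono[OF p])
    fix E
    show "of_bool (\<exists>v\<in>{1..n}. r < vertex_deg E v) \<le> (\<Sum>v\<in>{1..n}. of_bool (r < vertex_deg E v) :: real)"
    proof (cases "\<exists>v\<in>{1..n}. r < vertex_deg E v")
      case True
      then obtain v where v: "v \<in> {1..n}" "r < vertex_deg E v" by auto
      have "(of_bool (r < vertex_deg E v) :: real) \<le> (\<Sum>v\<in>{1..n}. of_bool (r < vertex_deg E v))"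
        using v(1) by (intro member_le_sum) auto
      then show ?thesis using v True by simp
    qed (simp add: sum_nonneg)
  qed
  also have "\<dots> = (\<Sum>v\<in>{1..n}. subset_mean p (Kn_edges n) (\<lambda>E. of_bool (r < vertex_deg E v)))" by (rule subset_mean_sum)
  also have "\<dots> \<le> (\<Sum>v\<in>{1..n}. exp (2 * a) / exp (real r))"
  proof (rule sum_mono)
    fix v assume v: "v \<in> {1..n}"
    have "subset_mean p (Kn_edges n) (\<lambda>E. of_bool (r < vertex_deg E v)) \<le> subset_mean p (Kn_edges n) (\<lambda>E. exp (real (vertex_deg E v))) / exp (real r)"
      by (rule subset_mean_markov[OF p]) auto
    also have "\<dots> \<le> exp (2 * (real n * p)) / exp (real r)"
      using subset_mean_exp_deg[OF v p] by (intro divide_right_mono) auto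
    also have "\<dots> \<le> exp (2 * a) / exp (real r)"
      using a unfolding p_def[symmetric] by (intro divide_right_mono) auto
    finally show "subset_mean p (Kn_edges n) (\<lambda>E. of_bool (r < vertex_deg E v)) \<le> exp (2 * a) / exp (real r)" .
  qed
  finally show ?thesis by simp
qed

section \<open>The survival probability as a threshold\<close>

lemma exp_strict_tangent: "z \<noteq> 0 \<Longrightarrow> 1 + z < exp z" for z :: real
proof -
  assume z: "z \<noteq> 0"
  have "1 + z \<noteq> exp z"
  proof
    assume "1 + z = exp z"
    then have "ln (exp z) = exp z - 1" by simp
    then have "exp z = 1" by (intro ln_eq_minus_one) auto
    then show False using z by simp
  qed
  then show ?thesis using exp_ge_add_one_self[of z] by linarith
qed

text \<open>Strict convexity: between 0 and \<open>y\<close> the exponential lies below its chord,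
  which itself lies below \<open>1 - x\<close>. Concretely, the tangent inequalities from
  \<open>x\<close> towards \<open>y\<close> and towards 0, the latter strict, are averaged with
  weights \<open>x\<close> and \<open>y - x\<close>.\<close>

lemma survival_below:
  fixes c :: real
  assumes c: "0 < c" and x: "0 < x" "x < y" and y: "exp (- c * y) \<le> 1 - y"
  shows "exp (- c * x) < 1 - x"
proof -
  define E where "E = exp (- c * x)"
  have E0: "0 < E" by (simp add: E_def)
  have "E * (1 + - c * (y - x)) \<le> E * exp (- c * (y - x))"
    using E0 by (intro mult_left_mono exp_ge_add_one_self) auto
  also have "\<dots> = exp (- c * y)" by (simp add: E_def exp_add[symmetric] algebra_simps)
  finally have 1: "x * (E * (1 + - c * (y - x))) \<le> x * (1 - y)" using y x by (intro mult_left_mono) auto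
  have "E * (1 + c * x) < E * exp (c * x)" using E0 c x by (intro mult_strict_left_mono exp_strict_tangent) auto
  also have "\<dots> = 1" by (simp add: E_def exp_add[symmetric])
  finally have 2: "(y - x) * (E * (1 + c * x)) < (y - x) * 1" using x by (intro mult_strict_left_mono) auto
  have "y * E = x * (E * (1 + - c * (y - x))) + (y - x) * (E * (1 + c * x))" by (simp add: algebra_simps)
  also have "\<dots> < x * (1 - y) + (y - x) * 1" using 1 2 by linarith
  also have "\<dots> = y * (1 - x)" by (simp add: algebra_simps)
  finally show ?thesis using x unfolding E_def by (subst (asm) mult_less_cancel_left_pos) auto
qed

lemma beta_props:
  assumes c: "1 < c"
  shows "0 < beta c" "beta c < 1" "0 < y \<Longrightarrow> y < beta c \<Longrightarrow> exp (- c * y) < 1 - y"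
    "beta c < x \<Longrightarrow> 1 - x < exp (- c * x)"
proof -
  define g where "g x = 1 - x - exp (- c * x)" for x
  \<comment> \<open>The maximiser of (c - 1) x - c^2 x^2 / 2, the lower bound for \<open>g\<close>
    given by \<open>exp_quadratic_upper\<close>; it keeps the intermediate value theorem away from
    the root 0.\<close>
  define x0 where "x0 = (c - 1) / c\<^sup>2"
  have x0: "0 < x0" "x0 < 1"
  proof -
    show "0 < x0" using c by (simp add: x0_def)
    have "c * 1 < c * c" using c by (intro mult_strict_left_mono) auto
    then have "c - 1 < c * c" using c by linarith
    then show "x0 < 1" using c by (simp add: x0_def power2_eq_square)
  qed
  have "0 \<le> g x0"
  proof -
    have "exp (- (c * x0)) \<le> 1 - c * x0 + (c * x0)\<^sup>2 / 2" using c x0 by (intro exp_quadratic_upper) simp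
    moreover have "(c * x0)\<^sup>2 = (c - 1) * x0" using c by (simp add: x0_def power2_eq_square)
    moreover have "(c - 1) * x0 = c * x0 - x0" by (simp add: algebra_simps)
    moreover have "0 \<le> (c - 1) * x0" using c x0 by simp
    ultimately show ?thesis unfolding g_def mult_minus_left by linarith
  qed
  moreover have "g 1 \<le> 0" by (simp add: g_def)
  moreover have "continuous_on {x0..1} g" unfolding g_def by (intro continuous_intros)
  ultimately obtain b where b: "x0 \<le> b" "b \<le> 1" "g b = 0" using IVT2'[of g 1 0 x0] x0 by auto
  have bp: "0 < b" "1 - b = exp (- c * b)" using b x0 by (auto simp: g_def)
  have b1: "b < 1"
  proof -
    have "0 < exp (- c * b)" by simp
    then show ?thesis using bp(2) by linarith
  qed
  have uniq: "x = b" if "0 < x \<and> 1 - x = exp (- c * x)" for x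
  proof (rule ccontr)
    assume "x \<noteq> b"
    then consider "x < b" | "b < x" by linarith
    then show False
    proof cases
      case 1
      have "exp (- c * x) < 1 - x" by (rule survival_below[of c x b]) (use 1 c that bp in linarith)+
      then show False using that by linarith
    next
      case 2
      have "exp (- c * b) < 1 - b" by (rule survival_below[of c b x]) (use 2 c that bp in linarith)+
      then show False using bp by linarith
    qed
  qed
  have be: "beta c = b" unfolding beta_def
  proof (rule the_equality)
    show "0 < b \<and> 1 - b = exp (- c * b)" using bp by (rule conjI)
  qed (rule uniq)
  have eb: "exp (- c * b) \<le> 1 - b" using bp(2) by linarith
  show "0 < beta c" "beta c < 1" using be bp b1 by auto
  show "exp (- c * y) < 1 - y" if "0 < y" "y < beta c"
    by (rule survival_below[of c y b]) (use that c be eb in linarith)+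
  show "1 - x < exp (- c * x)" if "beta c < x"
  proof (rule ccontr)
    assume "\<not> 1 - x < exp (- c * x)"
    then have "exp (- c * x) \<le> 1 - x" by simp
    then have "exp (- c * b) < 1 - b" by (intro survival_below[of c b x]) (use that c bp be in linarith)+
    then show False using bp by linarith
  qed
qed

text \<open>For a constant rate \<open>l\<close> the variance bound is linear in \<open>n\<close>,
  so deviations of order \<open>n\<close> have probability O(1 / n).\<close>

lemma (in comp_rec) V_linear:
  assumes "real n * p \<le> a"
  shows "V \<le> real n * (1 + a * ((1 / l + 1) / l))"
proof -
  define x where "x = 1 - f"
  have x: "0 \<le> x" "x \<le> 1" using f0 f1 by (auto simp: x_def)
  have "(p * x\<^sup>2 / l + p * x) * x / l = p * ((x\<^sup>2 / l + x) * x / l)" by (simp add: algebra_simps)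
  also have "\<dots> \<le> p * ((1 / l + 1) * 1 / l)"
    using x l0 p0 by (intro mult_left_mono divide_right_mono mult_mono add_mono) (auto simp: power_le_one)
  finally have "(real n)\<^sup>2 * ((p * x\<^sup>2 / l + p * x) * x / l) \<le> (real n)\<^sup>2 * (p * ((1 / l + 1) / l))"
    by (intro mult_left_mono) auto
  also have "\<dots> = real n * ((real n * p) * ((1 / l + 1) / l))" by (simp add: power2_eq_square)
  also have "\<dots> \<le> real n * (a * ((1 / l + 1) / l))"
    using assms l0 by (intro mult_left_mono mult_right_mono) auto
  finally show ?thesis unfolding V_def x_def[symmetric] by (simp add: algebra_simps)
qed

context constrained_process begin

text \<open>Well above the critical time the covering component has linear size and cannot serve as
  a piece, so every large component is cut by \<open>conn_set_split\<close>. Each part keeps at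
  least \<open>m\<close> vertices, which bounds the number of parts; the degree bound passes from
  all drawn edges to the accepted ones.\<close>

lemma pieces_split:
  assumes xs: "set xs \<subseteq> Kn_edges n" and m: "1 \<le> m" and vertex_deg: "\<And>v. v \<in> {1..n} \<Longrightarrow> vertex_deg (set xs) v \<le> r"
    and \<mu>: "\<mu> \<le> card (big_comps n (real m) (set xs))"
  shows "\<exists>F. pieces n ((r + 1) * m + 1) (n div m) \<mu> xs F"
proof -
  let ?E = "set xs" and ?proc_edges = "proc_edges P n xs"
  have E: "?E \<subseteq> pairs {1..n}" using xs by (simp add: Kn_edges_eq)
  define A where "A = big_comps n (real m) ?E"
  have A1: "A \<subseteq> {1..n}" "finite A" by (auto simp: A_def big_comps_def)
  define CC where "CC = (\<lambda>v. reach ?E {v}) ` A"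
  have fC: "conn_set_family ?proc_edges CC" unfolding CC_def by (rule conn_set_family_components[OF xs A1(2)])
  have sub: "C \<subseteq> A \<and> m \<le> card C" if CC: "C \<in> CC" for C
  proof -
    obtain v where v: "v \<in> A" "C = reach ?E {v}" using CC by (auto simp: CC_def)
    have "C \<subseteq> A" unfolding v(2) A_def using comp_size_le_big(1)[OF E] v(1) by (simp add: A_def)
    then show ?thesis using v by (auto simp: A_def big_comps_def comp_size_def)
  qed
  have "\<exists>F. conn_set_family ?proc_edges F \<and> \<Union>F = C \<and> (\<forall>B\<in>F. m \<le> card B \<and> card B \<le> (r + 1) * m + 1)" if C: "C \<in> CC" for C
  proof (rule conn_set_split[OF _ _ _ m])
    show "finite C" using sub[OF C] A1(2) finite_subset by auto
    show "conn_set ?proc_edges C" using fC C by (simp add: conn_set_family_def)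
    show "m \<le> card C" using sub[OF C] by simp
    fix x assume x: "x \<in> C"
    have "card {y \<in> C. {x, y} \<in> ?proc_edges} \<le> card {e \<in> ?E. x \<in> e}"
    proof (rule card_inj_on_le[of "\<lambda>y. {x, y}"])
      show "inj_on (\<lambda>y. {x, y}) {y \<in> C. {x, y} \<in> ?proc_edges}" by (auto simp: inj_on_def doubleton_eq_iff)
      show "(\<lambda>y. {x, y}) ` {y \<in> C. {x, y} \<in> ?proc_edges} \<subseteq> {e \<in> ?E. x \<in> e}" using proc_edges_subset[of P n xs] by auto
    qed simp
    also have "\<dots> \<le> r" using vertex_deg[of x] x sub[OF C] A1(1) by (auto simp: vertex_deg_def)
    finally show "card {y \<in> C. {x, y} \<in> ?proc_edges} \<le> r" .
  qed
  then obtain f where f: "\<And>C. C \<in> CC \<Longrightarrow> conn_set_family ?proc_edges (f C) \<and> \<Union>(f C) = C \<and> (\<forall>B\<in>f C. m \<le> card B \<and> card B \<le> (r + 1) * m + 1)"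
    by metis
  define F where "F = (\<Union>C\<in>CC. f C)"
  have fF: "conn_set_family ?proc_edges F"
    unfolding conn_set_family_def
  proof (intro conjI ballI impI)
    show "finite F" unfolding F_def using fC f by (intro finite_UN_I) (auto simp: conn_set_family_def)
  next
    fix B assume "B \<in> F"
    then obtain C where "C \<in> CC" "B \<in> f C" by (auto simp: F_def)
    then show "conn_set ?proc_edges B" using f by (auto simp: conn_set_family_def)
  next
    fix B B' assume "B \<in> F" "B' \<in> F" and ne: "B \<noteq> B'"
    then obtain C C' where C: "C \<in> CC" "B \<in> f C" "C' \<in> CC" "B' \<in> f C'" by (auto simp: F_def)
    show "B \<inter> B' = {}"
    proof (cases "C = C'")
      case True
      then show ?thesis using f[OF C(1)] C ne by (auto simp: conn_set_family_def)
    next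
      case False
      then have "C \<inter> C' = {}" using fC C by (simp add: conn_set_family_def)
      moreover have "B \<subseteq> C" "B' \<subseteq> C'" using f[OF C(1)] f[OF C(3)] C by auto
      ultimately show ?thesis by auto
    qed
  qed
  have UF: "\<Union>F = A"
  proof
    show "\<Union>F \<subseteq> A"
    proof
      fix u assume "u \<in> \<Union>F"
      then obtain C B where C: "C \<in> CC" "B \<in> f C" "u \<in> B" by (auto simp: F_def)
      then have "u \<in> C" using f[OF C(1)] by auto
      then show "u \<in> A" using sub[OF C(1)] by auto
    qed
    show "A \<subseteq> \<Union>F"
    proof
      fix v assume v: "v \<in> A"
      then have C: "reach ?E {v} \<in> CC" by (simp add: CC_def)
      have "v \<in> reach ?E {v}" using reach_superset by auto
      then obtain B where "B \<in> f (reach ?E {v})" "v \<in> B" using f[OF C] by (metis Union_iff)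
      then show "v \<in> \<Union>F" using C by (auto simp: F_def)
    qed
  qed
  have FB: "m \<le> card B \<and> card B \<le> (r + 1) * m + 1 \<and> finite B" if B: "B \<in> F" for B
  proof -
    have "B \<subseteq> A" using UF B by auto
    then have "finite B" using A1(2) finite_subset by auto
    moreover obtain C where "C \<in> CC" "B \<in> f C" using B by (auto simp: F_def)
    ultimately show ?thesis using f by auto
  qed
  have "real m * real (card F) \<le> real (card (\<Union>F))" using FB by (intro conn_set_family_card_Union[OF fF]) auto
  also have "\<dots> \<le> real n" unfolding UF using card_mono[OF _ A1(1)] by simp
  finally have "m * card F \<le> n" by (simp flip: of_nat_mult)
  then have "card F \<le> n div m" using m by (simp add: less_eq_div_iff_mult_less_eq mult.commute)
  moreover have "\<mu> \<le> card (\<Union>F)" using \<mu> UF by (simp add: A_def)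
  ultimately show ?thesis unfolding pieces_def using fF UF A1(1) FB by (intro exI[of _ F]) simp
qed

end

text \<open>\<open>time_upper\<close> and \<open>time_lower\<close> enclose \<open>n p\<close> when
  p (n choose 2) is t + 2 sqrt t or t - 2 sqrt t with \<open>t\<close> the rounded value of c n / 2;
  the last term of \<open>time_lower\<close> is the rounding error.\<close>

definition time_upper :: "real \<Rightarrow> nat \<Rightarrow> real" where
  "time_upper c n = c * (real n / (real n - 1)) + 4 * sqrt (c / 2) * (sqrt (real n) / (real n - 1))"

definition time_lower :: "real \<Rightarrow> nat \<Rightarrow> real" where
  "time_lower c n = c * (real n / (real n - 1)) - 4 * sqrt (c / 2) * (sqrt (real n) / (real n - 1)) - 2 / (real n - 1)"

lemma q_tendsto: "time_upper c \<longlonglongrightarrow> c" "time_lower c \<longlonglongrightarrow> c"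
proof -
  have 1: "(\<lambda>n. real n / (real n - 1)) \<longlonglongrightarrow> 1" and 2: "(\<lambda>n. sqrt (real n) / (real n - 1)) \<longlonglongrightarrow> 0"
    and 3: "(\<lambda>n. 2 / (real n - 1)) \<longlonglongrightarrow> 0" by real_asymp+
  have "(\<lambda>n. c * (real n / (real n - 1)) + 4 * sqrt (c / 2) * (sqrt (real n) / (real n - 1))) \<longlonglongrightarrow> c * 1 + 4 * sqrt (c / 2) * 0"
    by (intro tendsto_intros 1 2)
  then show "time_upper c \<longlonglongrightarrow> c" by (simp add: time_upper_def[abs_def])
  have "(\<lambda>n. c * (real n / (real n - 1)) - 4 * sqrt (c / 2) * (sqrt (real n) / (real n - 1)) - 2 / (real n - 1)) \<longlonglongrightarrow> c * 1 - 4 * sqrt (c / 2) * 0 - 0"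
    by (intro tendsto_intros 1 2 3)
  then show "time_lower c \<longlonglongrightarrow> c" by (simp add: time_lower_def[abs_def])
qed

lemma floor_time:
  assumes c: "0 < c" and n: "2 \<le> n"
  defines "t \<equiv> nat \<lfloor>c * real n / 2\<rfloor>"
  shows "real t \<le> c * real n / 2" "c * real n / 2 - 1 \<le> real t"
    "real n * ((real t + 2 * sqrt (real t)) / real (n choose 2)) \<le> time_upper c n"
    "time_lower c n \<le> real n * ((real t - 2 * sqrt (real t)) / real (n choose 2))"
    "real n * ((real t - 2 * sqrt (real t)) / real (n choose 2)) \<le> time_upper c n"
proof -
  have c0: "0 \<le> c * real n / 2" using c by simp
  show t1: "real t \<le> c * real n / 2" unfolding t_def by (rule of_nat_floor[OF c0])
  show t2: "c * real n / 2 - 1 \<le> real t" unfolding t_def using c0 by linarith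
  have n1: "0 < real n - 1" using n by simp
  have "sqrt (real t) \<le> sqrt (c / 2 * real n)" using t1 by simp
  then have st: "sqrt (real t) \<le> sqrt (c / 2) * sqrt (real n)" unfolding real_sqrt_mult .
  have up: "time_upper c n = 2 * (c * real n / 2 + 2 * (sqrt (c / 2) * sqrt (real n))) / (real n - 1)"
  proof -
    have "2 * (c * real n / 2 + 2 * (sqrt (c / 2) * sqrt (real n))) = c * real n + 4 * (sqrt (c / 2) * sqrt (real n))" by simp
    then show ?thesis unfolding time_upper_def by (simp add: add_divide_distrib)
  qed
  show 3: "real n * ((real t + 2 * sqrt (real t)) / real (n choose 2)) \<le> time_upper c n"
    unfolding N_mult[OF n] up using t1 st n1 by (intro divide_right_mono mult_left_mono add_mono) auto
  have lo: "time_lower c n = 2 * ((c * real n / 2 - 1) - 2 * (sqrt (c / 2) * sqrt (real n))) / (real n - 1)"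
  proof -
    have "2 * ((c * real n / 2 - 1) - 2 * (sqrt (c / 2) * sqrt (real n))) = c * real n - 4 * (sqrt (c / 2) * sqrt (real n)) - 2" by simp
    then show ?thesis unfolding time_lower_def by (simp add: diff_divide_distrib)
  qed
  show "time_lower c n \<le> real n * ((real t - 2 * sqrt (real t)) / real (n choose 2))"
    unfolding N_mult[OF n] lo using t2 st n1 by (intro divide_right_mono mult_left_mono diff_mono) auto
  have "real n * ((real t - 2 * sqrt (real t)) / real (n choose 2)) \<le> real n * ((real t + 2 * sqrt (real t)) / real (n choose 2))"
    by (intro mult_left_mono divide_right_mono) auto
  then show "real n * ((real t - 2 * sqrt (real t)) / real (n choose 2)) \<le> time_upper c n" using 3 by linarith
qed

lemma time_bound:
  assumes n: "2 \<le> n" and np: "real n * (y / real (n choose 2)) \<le> q" "4 * q \<le> real n"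
  shows "y / real (n choose 2) \<le> q / real n" "y / real (n choose 2) \<le> 1/4" "y \<le> real (n choose 2)"
proof -
  have n0: "0 < real n" "0 < real (n choose 2)" using n by (auto simp: choose_two_real)
  show 1: "y / real (n choose 2) \<le> q / real n" using np(1) n0 by (simp add: pos_le_divide_eq mult.commute)
  also have "\<dots> \<le> 1/4" using np(2) n0 by (simp add: pos_divide_le_eq)
  finally show 2: "y / real (n choose 2) \<le> 1/4" .
  then have "y \<le> 1/4 * real (n choose 2)" using n0(2) by (simp only: pos_divide_le_eq)
  then show "y \<le> real (n choose 2)" using n0(2) by linarith
qed

section \<open>Forbidden pairs in the presence of a giant component\<close>

context constrained_process begin

lemma prob_giant_upper:
  assumes c: "1 < c" and e: "0 < \<epsilon>"
  shows "\<exists>A. \<forall>\<^sub>F n in sequentially. prob_ord n (\<lambda>es. \<not> real (forb P (proc P n es (nat \<lfloor>c * real n / 2\<rfloor>))) \<le> (real n)\<^sup>2 / 2 * ((beta c)\<^sup>2 + \<epsilon>)) \<le> A / real n"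
proof -
  define b where "b = beta c"
  have b: "0 < b" "b < 1" using beta_props(1,2)[OF c] by (auto simp: b_def)
  define \<eta> where "\<eta> = min (\<epsilon> / 16) ((1 - b) / 2)"
  have eta: "0 < \<eta>" "\<eta> \<le> \<epsilon> / 16" "b + \<eta> < 1" "\<eta> \<le> 1"
    using e b by (auto simp: \<eta>_def min_def field_simps)
  define x where "x = b + \<eta>"
  have x: "0 < x" "x < 1" using b eta by (auto simp: x_def)
  \<comment> \<open>Since \<open>x\<close> exceeds \<open>beta c\<close>, \<open>1 - x\<close> is a
    strict subsolution for \<open>l = 0\<close>; the gap \<open>Lam - c * x\<close> has room for a
    positive constant rate \<open>l\<close>.\<close>
  define Lam where "Lam = - ln (1 - x)"
  have Lam: "c * x < Lam" "exp (- Lam) = 1 - x"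
  proof -
    show "exp (- Lam) = 1 - x" using x by (simp add: Lam_def)
    have "1 - x < exp (- c * x)" using beta_props(4)[OF c, of x] eta by (simp add: x_def b_def)
    then have "exp (- Lam) < exp (- c * x)" using x by (simp add: Lam_def)
    then show "c * x < Lam" by simp
  qed
  define l where "l = (Lam - c * x) / 2"
  have l: "0 < l" "l + c * x < Lam" using Lam by (auto simp: l_def field_simps)
  \<comment> \<open>A component of at least \<open>k\<close> vertices has weight at least
    \<open>\<rho>\<close>, so \<open>X\<close> below \<open>n (b + 2 \<eta>)\<close> leaves at most
    \<open>n (b + 3 \<eta>)\<close> vertices in such components. As \<open>k\<close> is constant,
    all others contribute only O(n) pairs.\<close>
  define \<rho> where "\<rho> = (b + 2 * \<eta>) / (b + 3 * \<eta>)"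
  have rho: "0 < \<rho>" "\<rho> < 1" "\<rho> * (b + 3 * \<eta>) = b + 2 * \<eta>" using b eta by (auto simp: \<rho>_def)
  define k where "k = - ln (1 - \<rho>) / l"
  have k: "0 \<le> k" "1 - exp (- l * k) = \<rho>" using rho l by (auto simp: k_def divide_nonpos_pos)
  define Cv where "Cv = 1 + (c + 1) * ((1 / l + 1) / l)"
  have tq: "(\<lambda>n. l + time_upper c n * x + time_upper c n * (time_upper c n * (1 / real n) * x\<^sup>2)) \<longlonglongrightarrow> l + c * x + c * (c * 0 * x\<^sup>2)"
    by (intro tendsto_intros q_tendsto lim_1_over_n)
  have ev1: "\<forall>\<^sub>F n in sequentially. l + time_upper c n * x + time_upper c n * (time_upper c n * (1 / real n) * x\<^sup>2) < Lam"
    using tq by (rule order_tendstoD) (use l in simp)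
  have ev2: "\<forall>\<^sub>F n in sequentially. time_upper c n < c + 1" by (rule order_tendstoD[OF q_tendsto(1)]) simp
  have ev3: "\<forall>\<^sub>F n in sequentially. 4 * (c + 1) \<le> real n" by real_asymp
  have ev4: "\<forall>\<^sub>F n in sequentially. k / \<eta> \<le> real n" by real_asymp
  have ev5: "\<forall>\<^sub>F n in sequentially. 4 / c \<le> real n" by real_asymp
  have "\<forall>\<^sub>F n in sequentially. prob_ord n (\<lambda>es. \<not> real (forb P (proc P n es (nat \<lfloor>c * real n / 2\<rfloor>))) \<le> (real n)\<^sup>2 / 2 * ((beta c)\<^sup>2 + \<epsilon>)) \<le> 4 * Cv / \<eta>\<^sup>2 / real n"
    using ev1 ev2 ev3 ev4 ev5 eventually_ge_at_top[of 2]
  proof eventually_elim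
    case (elim n)
    define t where "t = nat \<lfloor>c * real n / 2\<rfloor>"
    have n: "2 \<le> n" "0 < real n" using elim(6) by auto
    have c0: "0 < c" using c by simp
    note ft = floor_time[OF c0 n(1), folded t_def]
    define p where "p = (real t + 2 * sqrt (real t)) / real (n choose 2)"
    have "1 \<le> c * real n / 2 - 1" using elim(5) c by (simp add: field_simps)
    then have t1: "1 \<le> t" using ft(2) by linarith
    have q: "real n * p \<le> time_upper c n" using ft(3) by (simp add: p_def)
    have q4: "4 * time_upper c n \<le> real n" using elim(2,3) by (simp add: algebra_simps)
    have p0: "0 \<le> p" by (simp add: p_def)
    have pq: "p \<le> time_upper c n / real n" "p \<le> 1/4" "real t + 2 * sqrt (real t) \<le> real (n choose 2)"
      using time_bound[OF n(1) ft(3) q4] by (auto simp: p_def)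
    have px: "0 \<le> p * x" "p * x \<le> 1/4" using p0 x pq mult_mono[of p "1/4" x 1] by auto
    have q0: "0 \<le> time_upper c n" using q p0 n by (meson mult_nonneg_nonneg of_nat_0_le_iff order_trans)
    interpret comp_rec p l "1 - x" n
    proof
      have "real n * p * x \<le> time_upper c n * x" using q x by (intro mult_right_mono) auto
      moreover have "(real n * p) * (p * x\<^sup>2) \<le> time_upper c n * (time_upper c n * (1 / real n) * x\<^sup>2)"
        using q pq p0 q0 by (intro mult_mono mult_right_mono) auto
      ultimately have 1: "l + real n * (p * x) + real n * (p * x)\<^sup>2 \<le> Lam"
        using elim(1) by (simp add: power2_eq_square mult_ac)
      have "1 - x = exp (- Lam)" by (simp add: Lam)
      also have "\<dots> \<le> exp (- l + real n * (- (p * x) - (p * x)\<^sup>2))" using 1 by (simp add: algebra_simps)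
      also have "\<dots> = exp (- l) * exp (real n * (- (p * x) - (p * x)\<^sup>2))" by (rule exp_add)
      also have "\<dots> \<le> exp (- l) * (1 - p * x) ^ n" using px by (intro mult_left_mono power_exp_lower) auto
      finally show "1 - x \<le> exp (- l) * (1 - p + p * (1 - x)) ^ n" by (simp add: algebra_simps)
    qed (use p0 pq x l in auto)
    define z where "z = real n * (b + 2 * \<eta>)"
    have nd: "0 < real n * \<eta>" using n eta by simp
    have zf: "real n * (1 - (1 - x)) + real n * \<eta> = z" by (simp add: z_def x_def algebra_simps)
    have "prob_ord n (\<lambda>es. \<not> real (forb P (proc P n es t)) \<le> (real n)\<^sup>2 / 2 * (b\<^sup>2 + \<epsilon>)) \<le> prob_t n t (\<lambda>E. z \<le> real n - comp_laplace l n E)"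
    proof (rule prob_ord_mono, rule ccontr)
      fix es assume es: "es \<in> orderings n" and big_comps_forb: "\<not> real (forb P (proc P n es t)) \<le> (real n)\<^sup>2 / 2 * (b\<^sup>2 + \<epsilon>)"
        and "\<not> z \<le> real n - comp_laplace l n (set (take t es))"
      let ?E = "set (take t es)"
      have sub: "?E \<subseteq> Kn_edges n" using es set_take_subset[of t es] by (simp add: orderings_def)
      have "\<rho> * real (card (big_comps n k ?E)) \<le> z"
        using X_big[OF l(1), of k n ?E] \<open>\<not> z \<le> _\<close> unfolding k(2) by linarith
      also have "z = \<rho> * (real n * (b + 3 * \<eta>))" unfolding z_def rho(3)[symmetric] by simp
      finally have B: "real (card (big_comps n k ?E)) \<le> real n * (b + 3 * \<eta>)" using rho(1) by (subst (asm) mult_le_cancel_left_pos) auto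
      have kn: "k * real n \<le> (real n)\<^sup>2 * \<eta>"
      proof -
        have "k \<le> \<eta> * real n" using elim(4) eta(1) by (simp add: pos_divide_le_eq mult.commute)
        then have "k * real n \<le> \<eta> * real n * real n" by (intro mult_right_mono) auto
        then show ?thesis by (simp add: power2_eq_square mult_ac)
      qed
      have "2 * real (forb P (proc P n es t)) \<le> k * real n + (real (card (big_comps n k ?E)))\<^sup>2"
        using forb_upper[OF sub] sum_comp_size_le_count[OF sub[unfolded Kn_edges_eq] k(1)] by linarith
      also have "\<dots> \<le> (real n)\<^sup>2 * \<eta> + (real n * (b + 3 * \<eta>))\<^sup>2"
        using kn B by (intro add_mono power_mono) auto
      also have "\<dots> = (real n)\<^sup>2 * (\<eta> + (b + 3 * \<eta>)\<^sup>2)"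
        unfolding power_mult_distrib by (rule distrib_left[symmetric])
      also have "\<dots> \<le> (real n)\<^sup>2 * (b\<^sup>2 + \<epsilon>)"
      proof (rule mult_left_mono)
        have "\<eta> * b \<le> \<eta> * 1" "\<eta> * \<eta> \<le> \<eta> * 1" using eta b by (auto intro!: mult_left_mono)
        then show "\<eta> + (b + 3 * \<eta>)\<^sup>2 \<le> b\<^sup>2 + \<epsilon>" using eta(2) by (simp add: power2_eq_square algebra_simps)
      qed simp
      finally show False using big_comps_forb by simp
    qed
    also have "\<dots> \<le> 4 * subset_mean p (Kn_edges n) (\<lambda>E. of_bool (z \<le> real n - comp_laplace l n E))"
      unfolding p_def by (rule prob_X_increasing[OF l(1) t1 pq(3)])
    also have "\<dots> \<le> 4 * (V / (real n * \<eta>)\<^sup>2)" using EP_X_upper[OF n(1) nd] unfolding zf by simp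
    also have "\<dots> \<le> 4 * (real n * Cv / (real n * \<eta>)\<^sup>2)"
      unfolding Cv_def using q elim(2) by (intro mult_left_mono divide_right_mono V_linear) auto
    also have "\<dots> = 4 * Cv / \<eta>\<^sup>2 / real n" using n by (simp add: power2_eq_square)
    finally show ?case unfolding t_def b_def .
  qed
  then show ?thesis by blast
qed

lemma prob_giant_lower:
  assumes c: "1 < c" and e: "0 < \<epsilon>"
  shows "\<exists>g. g \<longlonglongrightarrow> 0 \<and> (\<forall>\<^sub>F n in sequentially. prob_ord n (\<lambda>es. \<not> (real n)\<^sup>2 / 2 * ((beta c)\<^sup>2 - \<epsilon>) \<le> real (forb P (proc P n es (nat \<lfloor>c * real n / 2\<rfloor>)))) \<le> g n)"
proof -
  obtain V0 E0 where G: "finite V0" "E0 \<subseteq> pairs V0" "(V0, E0) \<notin> P" by (rule excluded)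
  define D :: real where "D = 2 ^ card V0"
  have D1: "1 \<le> D" unfolding D_def by simp
  define b where "b = beta c"
  have b: "0 < b" "b < 1" using beta_props(1,2)[OF c] by (auto simp: b_def)
  define \<eta> where "\<eta> = min (\<epsilon> / 16) (b / 8)"
  have eta: "0 < \<eta>" "\<eta> \<le> \<epsilon> / 16" "\<eta> \<le> b / 8" using e b by (auto simp: \<eta>_def)
  define y where "y = b - \<eta>"
  have y: "0 < y" "y < b" "y < 1" using eta b by (auto simp: y_def)
  define Lam where "Lam = - ln (1 - y)"
  have Lam: "Lam < c * y" "exp (- Lam) = 1 - y" "0 < Lam"
  proof -
    show "exp (- Lam) = 1 - y" using y by (simp add: Lam_def)
    have "exp (- c * y) < 1 - y" using beta_props(3)[OF c, of y] y by (simp add: b_def)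
    then have "exp (- c * y) < exp (- Lam)" using y by (simp add: Lam_def)
    then show "Lam < c * y" by simp
    show "0 < Lam" using y by (simp add: Lam_def)
  qed
  \<comment> \<open>The earlier time: close enough to \<open>c\<close> that \<open>1 - y\<close>
    remains a strict supersolution, yet leaving a linear number of edges for the sprinkling.\<close>
  define c' where "c' = (Lam / y + c) / 2"
  have c': "0 < c'" "c' < c" "Lam < c' * y"
  proof -
    have "Lam / y < c" using Lam y by (simp add: pos_divide_less_eq)
    then show "c' < c" by (simp add: c'_def)
    have "0 < Lam / y" using Lam y by simp
    then show "0 < c'" using c by (simp add: c'_def)
    have "c' * y = (Lam + c * y) / 2" using y by (simp add: c'_def field_simps)
    then show "Lam < c' * y" using Lam by simp
  qed
  \<comment> \<open>The fraction of vertices that the exploration may use up without destroying the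
    supersolution.\<close>
  define \<kappa> where "\<kappa> = (c' * y - Lam) / (4 * (c' * y))"
  have kap: "0 < \<kappa>" "\<kappa> < 1" "Lam < c' * (1 - \<kappa>) * y"
  proof -
    have cy: "0 < c' * y" using c' y by simp
    show "0 < \<kappa>" using c' cy by (simp add: \<kappa>_def)
    show "\<kappa> < 1" using Lam cy by (simp add: \<kappa>_def pos_divide_less_eq)
    have "z * ((z - Lam) / (4 * z)) = (z - Lam) / 4" if "0 < z" for z :: real using that by simp
    from this[OF cy] have "c' * y * \<kappa> = (c' * y - Lam) / 4" by (simp only: \<kappa>_def)
    then have "c' * (1 - \<kappa>) * y = c' * y - (c' * y - Lam) / 4" by (simp add: algebra_simps)
    moreover have "Lam < z - (z - Lam) / 4" if "Lam < z" for z using that by (simp add: field_simps)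
    ultimately show "Lam < c' * (1 - \<kappa>) * y" using c'(3) by metis
  qed
  \<comment> \<open>Half of the available exponent per vertex: (\<eta> n^2 / 4) * ((c - c') n / 4) /
    n^2 = 2 a0 n.\<close>
  define a0 where "a0 = \<eta> * (c - c') / 32"
  have a0: "0 < a0" using eta c' by (simp add: a0_def)
  \<comment> \<open>Pieces of at least \<open>m\<close> vertices are so few that the adjacency bound
    \<open>D * (n div m)\<close> is at most \<open>a0 * n\<close>.\<close>
  define m where "m = nat \<lceil>D / a0\<rceil> + 1"
  have m: "1 \<le> m" "D / a0 \<le> real m" unfolding m_def using of_nat_ceiling[of "D / a0"] by auto
  then have m0: "0 < real m" "D \<le> a0 * real m" using a0 by (auto simp: pos_divide_le_eq mult.commute)
  \<comment> \<open>With this rate, vertices in components smaller than \<open>m\<close> add at most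
    \<open>\<eta> * n\<close> to \<open>X\<close>.\<close>
  define l where "l = \<eta> / real m"
  have l: "0 < l" "l * real m = \<eta>" using eta m0 by (auto simp: l_def)
  define Cv where "Cv = 1 + (c' + 1) * ((1 / l + 1) / l)"
  \<comment> \<open>The power 1/4 suits both demands: larger degrees have probability O(n exp (-
    n^(1/4))), and pieces of size O(n^(1/4)) have only O(n^(3/2)) exceptional pairs.\<close>
  define rn where "rn n = nat \<lfloor>real n powr (1/4)\<rfloor>" for n :: nat
  define g where "g n = 4 * (real n * (exp (2 * (c' + 1)) / exp (real n powr (1/4) - 1))) + 4 * Cv / \<eta>\<^sup>2 / real n + exp (- (a0 * real n))" for n :: nat
  have g0: "g \<longlonglongrightarrow> 0"
  proof -
    have 1: "(\<lambda>n. real n / exp (real n powr (1/4) - 1)) \<longlonglongrightarrow> 0" by real_asymp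
    have 2: "(\<lambda>n. exp (- (a0 * real n))) \<longlonglongrightarrow> 0" using a0 by real_asymp
    have "(\<lambda>n. 4 * exp (2 * (c' + 1)) * (real n / exp (real n powr (1/4) - 1)) + 4 * Cv / \<eta>\<^sup>2 * (1 / real n) + exp (- (a0 * real n))) \<longlonglongrightarrow> 
      4 * exp (2 * (c' + 1)) * 0 + 4 * Cv / \<eta>\<^sup>2 * 0 + 0"
      by (intro tendsto_intros 1 2 lim_1_over_n)
    moreover have "g = (\<lambda>n. 4 * exp (2 * (c' + 1)) * (real n / exp (real n powr (1/4) - 1)) + 4 * Cv / \<eta>\<^sup>2 * (1 / real n) + exp (- (a0 * real n)))"
      by (rule ext) (simp add: g_def)
    ultimately show ?thesis by (simp only: mult_zero_right add_0_right)
  qed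
  have tl: "(\<lambda>n. time_lower c' n * (1 - \<kappa>) * y) \<longlonglongrightarrow> c' * (1 - \<kappa>) * y" by (intro tendsto_intros q_tendsto)
  have ev1: "\<forall>\<^sub>F n in sequentially. Lam < time_lower c' n * (1 - \<kappa>) * y" by (rule order_tendstoD(1)[OF tl kap(3)])
  have ev2: "\<forall>\<^sub>F n in sequentially. time_upper c' n < c' + 1" by (rule order_tendstoD[OF q_tendsto(1)]) simp
  have ev3: "\<forall>\<^sub>F n in sequentially. 4 * (c' + 1) + 4 * (c + 1) \<le> real n" by real_asymp
  have te: "(\<lambda>n. exp (- l * (\<kappa> * real n - 1))) \<longlonglongrightarrow> 0"
  proof -
    have "(\<lambda>n. exp l * exp (- ((l * \<kappa>) * real n))) \<longlonglongrightarrow> exp l * 0"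
      using l kap by (intro tendsto_intros; real_asymp)
    moreover have "exp l * exp (- ((l * \<kappa>) * real n)) = exp (- l * (\<kappa> * real n - 1))" for n
      by (simp add: exp_add[symmetric] algebra_simps)
    ultimately show ?thesis by simp
  qed
  have ev4: "\<forall>\<^sub>F n in sequentially. exp (- l * (\<kappa> * real n - 1)) < min (1/2) (\<eta> / 2)"
    by (rule order_tendstoD[OF te]) (use eta in simp)
  have ev5: "\<forall>\<^sub>F n in sequentially. 10 / c' + 8 / (c - c') + 3 / \<eta> + 6 / (b - 4 * \<eta>) \<le> real n" by real_asymp
  have tb: "(\<lambda>n. (1 + D) * (((real n powr (1/4) + 1) * real m + 1)\<^sup>2 / real n)) \<longlonglongrightarrow> (1 + D) * 0"
  proof (intro tendsto_intros)
    have lim: "(\<lambda>n. ((real n powr (1/4) + 1) / sqrt (real n) * real m + 1 / sqrt (real n))\<^sup>2) \<longlonglongrightarrow> (0 * real m + 0)\<^sup>2"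
      by (intro tendsto_intros; real_asymp)
    have eq: "((real n powr (1/4) + 1) / sqrt (real n) * real m + 1 / sqrt (real n))\<^sup>2 = ((real n powr (1/4) + 1) * real m + 1)\<^sup>2 / real n" for n
    proof -
      have "a / w * M + 1 / w = (a * M + 1) / w" for a w M :: real by (simp add: add_divide_distrib)
      then have "(real n powr (1/4) + 1) / sqrt (real n) * real m + 1 / sqrt (real n) = ((real n powr (1/4) + 1) * real m + 1) / sqrt (real n)" .
      then show ?thesis by (simp add: power_divide)
    qed
    show "(\<lambda>n. ((real n powr (1/4) + 1) * real m + 1)\<^sup>2 / real n) \<longlonglongrightarrow> 0" using lim unfolding eq by simp
  qed
  have ev6: "\<forall>\<^sub>F n in sequentially. (1 + D) * (((real n powr (1/4) + 1) * real m + 1)\<^sup>2 / real n) < \<eta> / 4"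
    by (rule order_tendstoD[OF tb]) (use eta in simp)
  have "\<forall>\<^sub>F n in sequentially. prob_ord n (\<lambda>es. \<not> (real n)\<^sup>2 / 2 * ((beta c)\<^sup>2 - \<epsilon>) \<le> real (forb P (proc P n es (nat \<lfloor>c * real n / 2\<rfloor>)))) \<le> g n"
    using ev1 ev2 ev3 ev4 ev5 ev6 eventually_ge_at_top[of 2]
  proof eventually_elim
    case (elim n)
    define t where "t = nat \<lfloor>c * real n / 2\<rfloor>"
    define t1 where "t1 = nat \<lfloor>c' * real n / 2\<rfloor>"
    have n: "2 \<le> n" "0 < real n" using elim(7) by auto
    have c0: "0 < c" using c by simp
    have pos5: "0 \<le> 10 / c'" "0 \<le> 8 / (c - c')" "0 \<le> 3 / \<eta>" "0 \<le> 6 / (b - 4 * \<eta>)" using c' eta b by auto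
    have n5: "10 / c' \<le> real n" "8 / (c - c') \<le> real n" "3 / \<eta> \<le> real n" "6 / (b - 4 * \<eta>) \<le> real n"
      using elim(5) pos5 by linarith+
    note ft = floor_time[OF c0 n(1), folded t_def] and ft1 = floor_time[OF c'(1) n(1), folded t1_def]
    have "10 \<le> c' * real n" using n5(1) c' by (simp add: pos_divide_le_eq mult.commute)
    then have t14: "4 \<le> t1" using ft1(2) by linarith
    have tt: "(c - c') * real n / 4 \<le> real (t - t1)" "t1 \<le> t"
    proof -
      have "8 \<le> (c - c') * real n" using n5(2) c' by (simp add: pos_divide_le_eq mult.commute)
      moreover have "Z / 4 \<le> Z / 2 - 1" if "8 \<le> Z" for Z :: real using that by simp
      ultimately have "(c - c') * real n / 4 \<le> (c - c') * real n / 2 - 1" by blast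
      also have "\<dots> = c * real n / 2 - 1 - c' * real n / 2" by (simp add: left_diff_distrib diff_divide_distrib)
      also have "\<dots> \<le> real t - real t1" using ft(2) ft1(1) by linarith
      finally have *: "(c - c') * real n / 4 \<le> real t - real t1" .
      moreover have "0 \<le> (c - c') * real n / 4" using c' by simp
      ultimately show "t1 \<le> t" by linarith
      then show "(c - c') * real n / 4 \<le> real (t - t1)" using * by (simp add: of_nat_diff)
    qed
    have tN: "t \<le> n choose 2"
    proof -
      have "c * real n / 2 \<le> real n * (real n - 1) / 2"
        using elim(3) c' n mult_right_mono[of c "real n - 1" "real n"] by (simp add: mult.commute)
      then show ?thesis using ft(1) choose_two_real[of n] by linarith
    qed
    define p where "p = (real t1 - 2 * sqrt (real t1)) / real (n choose 2)"
    define p' where "p' = (real t1 + 2 * sqrt (real t1)) / real (n choose 2)"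
    have q4: "4 * time_upper c' n \<le> real n" using elim(2,3) c by (simp add: algebra_simps)
    have pq: "p \<le> 1/4" using time_bound[OF n(1) ft1(5) q4] by (simp add: p_def)
    have pq': "real t1 + 2 * sqrt (real t1) \<le> real (n choose 2)" using time_bound[OF n(1) ft1(3) q4] by simp
    have np: "time_lower c' n \<le> real n * p" "real n * p \<le> c' + 1" using ft1(4,5) elim(2) by (auto simp: p_def)
    have "2 \<le> sqrt (real t1)" using t14 by (intro real_le_rsqrt) simp
    then have "2 * sqrt (real t1) \<le> sqrt (real t1) * sqrt (real t1)" by (intro mult_right_mono) auto
    then have p0: "0 \<le> p" unfolding p_def by (intro divide_nonneg_nonneg) auto
    \<comment> \<open>The trivial subsolution \<open>f = 0\<close> is enough here: \<open>l\<close>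
      is constant, so the error \<open>2 * exp (- l * K)\<close> vanishes and the variance is linear
      anyway.\<close>
    interpret comp_rec p l 0 n by unfold_locales (use p0 pq l in auto)
    define K where "K = nat \<lfloor>\<kappa> * real n\<rfloor>"
    have K1: "real K \<le> \<kappa> * real n" unfolding K_def using kap by (intro of_nat_floor) simp
    have K2: "\<kappa> * real n - 1 \<le> real K" unfolding K_def using kap(1) by linarith
    have "\<kappa> * real n \<le> 1 * real n" using kap(2) by (intro mult_right_mono) auto
    then have Kn: "K \<le> n" using K1 by linarith
    have "- l * real K \<le> - l * (\<kappa> * real n - 1)" using K2 l by simp
    then have "exp (- l * real K) \<le> exp (- l * (\<kappa> * real n - 1))" by (rule exp_le_cancel_iff[THEN iffD2])
    then have eK: "exp (- l * real K) \<le> 1/2" "2 * exp (- l * real K) \<le> \<eta>"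
      using elim(4) unfolding min_less_iff_conj by linarith+
    have "\<psi> n 1 \<le> (1 - y) + 2 * exp (- l * real K) * (1 - 0)"
    proof (rule psi_1_le)
      have py: "0 \<le> p * y" "p * y \<le> 1" using p0 pq y mult_mono[of p 1 y 1] by auto
      have "exp (- l) * (1 - p + p * (1 - y)) ^ (n - K) = exp (- l) * (1 - p * y) ^ (n - K)" by (simp add: algebra_simps)
      also have "\<dots> \<le> 1 * exp (- real (n - K) * (p * y))"
        using l py by (intro mult_mono power_exp_upper) auto
      also have "\<dots> \<le> exp (- Lam)"
      proof -
        have "(1 - \<kappa>) * real n \<le> real (n - K)" using K1 Kn by (simp add: of_nat_diff algebra_simps)
        then have "(1 - \<kappa>) * real n * (p * y) \<le> real (n - K) * (p * y)" using py by (intro mult_right_mono) auto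
        moreover have "time_lower c' n * ((1 - \<kappa>) * y) \<le> real n * p * ((1 - \<kappa>) * y)" using np kap y by (intro mult_right_mono) auto
        ultimately have "Lam \<le> real (n - K) * (p * y)" using elim(1) by (simp add: mult_ac)
        then show ?thesis by simp
      qed
      finally show "exp (- l) * (1 - p + p * (1 - y)) ^ (n - K) \<le> 1 - y" unfolding Lam(2) .
    qed (use y n eK in auto)
    then have psi: "\<psi> n 1 \<le> 1 - (y - \<eta>)" using eK by simp
    have nd: "0 < real n * \<eta>" using n eta by simp
    \<comment> \<open>One \<open>\<eta>\<close> each for the choice of \<open>y\<close>, the
      truncation error in \<open>psi\<close>, the deviation of \<open>X\<close>, and the components
      smaller than \<open>m\<close>.\<close>
    define b4 where "b4 = b - 4 * \<eta>"
    have b4: "0 < b4" "b4 \<le> 1" using eta b by (auto simp: b4_def)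
    define \<mu> where "\<mu> = nat \<lfloor>real n * b4\<rfloor>"
    have mu1: "real \<mu> \<le> real n * b4" unfolding \<mu>_def using b4 by (intro of_nat_floor) simp
    define r where "r = rn n"
    define bb where "bb = (r + 1) * m + 1"
    let ?Q1 = "\<lambda>es. real n - comp_laplace l n (set (take t1 es)) \<le> real n * (y - \<eta>) - real n * \<eta>"
    let ?Q2 = "\<lambda>es. \<exists>v\<in>{1..n}. r < vertex_deg (set (take t1 es)) v"
    have P1: "prob_ord n ?Q1 \<le> 4 * Cv / \<eta>\<^sup>2 / real n"
    proof -
      have "t1 \<le> n choose 2" using tt tN by linarith
      then have "prob_ord n ?Q1 \<le> 4 * subset_mean p (Kn_edges n) (\<lambda>E. of_bool (real n - comp_laplace l n E \<le> real n * (y - \<eta>) - real n * \<eta>))"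
        unfolding p_def by (rule prob_X_decreasing[OF l(1) t14])
      also have "\<dots> \<le> 4 * (V / (real n * \<eta>)\<^sup>2)" using EP_X_lower[OF n(1) nd psi] by simp
      also have "\<dots> \<le> 4 * (real n * Cv / (real n * \<eta>)\<^sup>2)"
        unfolding Cv_def using np by (intro mult_left_mono divide_right_mono V_linear) auto
      also have "\<dots> = 4 * Cv / \<eta>\<^sup>2 / real n" using n by (simp add: power2_eq_square)
      finally show ?thesis .
    qed
    have r1: "real n powr (1/4) - 1 \<le> real r" "real r \<le> real n powr (1/4)"
      unfolding r_def rn_def using real_of_int_floor_add_one_ge[of "real n powr (1/4)"] by auto
    have P2: "prob_ord n ?Q2 \<le> 4 * (real n * (exp (2 * (c' + 1)) / exp (real n powr (1/4) - 1)))"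
    proof -
      have "prob_ord n ?Q2 \<le> 4 * (real n * (exp (2 * (c' + 1)) / exp (real r)))"
        by (rule prob_deg[OF _ pq']) (use t14 ft1(3) elim(2) in linarith)+
      also have "\<dots> \<le> 4 * (real n * (exp (2 * (c' + 1)) / exp (real n powr (1/4) - 1)))"
        using r1 by (intro mult_left_mono divide_left_mono) auto
      finally show ?thesis .
    qed
    have nop: "prob_ord n (\<lambda>es. \<not> (\<exists>F. pieces n bb (n div m) \<mu> (take t1 es) F)) \<le> prob_ord n (\<lambda>es. ?Q1 es \<or> ?Q2 es)"
    proof (rule prob_ord_mono, rule ccontr)
      fix es assume es: "es \<in> orderings n" and no: "\<not> (\<exists>F. pieces n bb (n div m) \<mu> (take t1 es) F)" and nq: "\<not> (?Q1 es \<or> ?Q2 es)"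
      let ?E = "set (take t1 es)"
      have sub: "?E \<subseteq> Kn_edges n" using es set_take_subset[of t1 es] by (simp add: orderings_def)
      have "(\<Sum>v\<in>{1..n} - big_comps n (real m) ?E. real (comp_size ?E v)) \<le> (\<Sum>v\<in>{1..n} - big_comps n (real m) ?E. real m)"
        by (intro sum_mono) (auto simp: big_comps_def)
      also have "\<dots> \<le> (\<Sum>v\<in>{1..n}. real m)" by (intro sum_mono2) auto
      finally have "l * (\<Sum>v\<in>{1..n} - big_comps n (real m) ?E. real (comp_size ?E v)) \<le> l * (real n * real m)"
        using l by (intro mult_left_mono) auto
      also have "\<dots> = real n * \<eta>" using l(2) by (simp add: mult_ac)
      finally have "real n - comp_laplace l n ?E \<le> real n * \<eta> + real (card (big_comps n (real m) ?E))"
        using X_le[OF l(1), of n ?E "real m"] by linarith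
      moreover have "real n * (y - \<eta>) - real n * \<eta> < real n - comp_laplace l n ?E" using nq by simp
      ultimately have "real n * b4 \<le> real (card (big_comps n (real m) ?E))" by (simp add: b4_def y_def algebra_simps)
      then have mb: "\<mu> \<le> card (big_comps n (real m) ?E)" using mu1 by linarith
      have dg: "vertex_deg ?E v \<le> r" if "v \<in> {1..n}" for v using nq that by (meson not_le)
      have "\<exists>F. pieces n bb (n div m) \<mu> (take t1 es) F"
        unfolding bb_def by (rule pieces_split[OF sub m(1) dg mb])
      then show False using no by simp
    qed
    have lower: "prob_ord n (\<lambda>es. \<not> (real n)\<^sup>2 / 2 * (b\<^sup>2 - \<epsilon>) \<le> real (forb P (proc P n es t)))
       \<le> prob_ord n (\<lambda>es. \<not> (\<exists>F. pieces n bb (n div m) \<mu> (take t1 es) F)) + exp (- (a0 * real n))"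
    proof (rule prob_forb_lower[OF G tt(2) tN])
      show "(real n)\<^sup>2 / 2 * (b\<^sup>2 - \<epsilon>) + (real n)\<^sup>2 / 2 * \<eta> \<le> real (\<mu> choose 2)"
      proof -
        define x where "x = real n * b4"
        have x6: "6 \<le> x" using n5(4) b4 unfolding x_def b4_def by (simp add: pos_divide_le_eq)
        have fl: "x - 1 \<le> real \<mu>" unfolding \<mu>_def x_def[symmetric] using x6 real_of_int_floor_add_one_ge[of x] by simp
        have k: "(x - 1) * (x - 2) / 2 \<le> k * (k - 1) / 2" if "x - 1 \<le> k" for k
          using that x6 by (intro divide_right_mono mult_mono) auto
        have "3 \<le> \<eta> * real n" using n5(3) eta by (simp add: pos_divide_le_eq mult.commute)
        then have "3 * x \<le> (\<eta> * real n) * real n"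
          using b4 n eta x6 by (intro mult_mono) (auto simp: x_def mult_left_le)
        then have x3: "3 * x \<le> (real n)\<^sup>2 * \<eta>" by (simp add: power2_eq_square mult_ac)
        have bb4: "b\<^sup>2 - \<epsilon> + 2 * \<eta> \<le> b4\<^sup>2"
        proof -
          have "\<eta> * b \<le> \<eta> * 1" using eta b by (intro mult_left_mono) auto
          moreover have "b4\<^sup>2 = b\<^sup>2 - 8 * (\<eta> * b) + 16 * \<eta>\<^sup>2" unfolding b4_def by (simp add: power2_eq_square algebra_simps)
          ultimately show ?thesis using eta(1,2) zero_le_power2[of \<eta>] by linarith
        qed
        have "(real n)\<^sup>2 * (b\<^sup>2 - \<epsilon> + 2 * \<eta>) \<le> (real n)\<^sup>2 * b4\<^sup>2" using bb4 by (intro mult_left_mono) auto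
        then have "(real n)\<^sup>2 * (b\<^sup>2 - \<epsilon>) + 2 * ((real n)\<^sup>2 * \<eta>) \<le> x\<^sup>2"
          by (simp add: x_def power_mult_distrib algebra_simps)
        then have "(real n)\<^sup>2 * (b\<^sup>2 - \<epsilon>) + (real n)\<^sup>2 * \<eta> \<le> x\<^sup>2 - 3 * x" using x3 by linarith
        also have "\<dots> \<le> (x - 1) * (x - 2)" by (simp add: power2_eq_square algebra_simps)
        finally have "(real n)\<^sup>2 / 2 * (b\<^sup>2 - \<epsilon>) + (real n)\<^sup>2 / 2 * \<eta> \<le> (x - 1) * (x - 2) / 2" by simp
        also have "\<dots> \<le> real (\<mu> choose 2)" unfolding choose_two_real by (rule k[OF fl])
        finally show ?thesis .
      qed
      show "2 ^ card V0 * real (n div m) \<le> a0 * real n"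
      proof -
        have "real (n div m) \<le> real n / real m" by (rule of_nat_div_le_of_nat)
        then have "D * real (n div m) \<le> D * (real n / real m)" using D1 by (intro mult_left_mono) auto
        also have "\<dots> = D / real m * real n" by simp
        also have "\<dots> \<le> a0 * real n" using m0 by (intro mult_right_mono) (auto simp: pos_divide_le_eq)
        finally show ?thesis by (simp add: D_def)
      qed
      show "0 \<le> (real n)\<^sup>2 / 4 * \<eta>" using eta by simp
      show "(real n)\<^sup>2 / 4 * \<eta> + (real (n div m) + 2 ^ card V0 * real (n div m)) * (real bb)\<^sup>2 \<le> (real n)\<^sup>2 / 2 * \<eta>"
      proof -
        define Y where "Y = (real n powr (1/4) + 1) * real m + 1"
        have bY: "real bb \<le> Y" 
        proof -
          have "(real r + 1) * real m \<le> (real n powr (1/4) + 1) * real m" using r1 by (intro mult_right_mono) auto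
          moreover have "real bb = (real r + 1) * real m + 1" by (simp add: bb_def algebra_simps)
          ultimately show ?thesis unfolding Y_def by linarith
        qed
        have "(real (n div m) + 2 ^ card V0 * real (n div m)) * (real bb)\<^sup>2 = (1 + D) * (real (n div m) * (real bb)\<^sup>2)"
          by (simp add: D_def algebra_simps)
        also have "\<dots> \<le> (1 + D) * (real n * Y\<^sup>2)"
          using D1 bY by (intro mult_left_mono mult_mono power_mono) auto
        also have "\<dots> = (real n)\<^sup>2 * ((1 + D) * (Y\<^sup>2 / real n))" using n by (simp add: power2_eq_square)
        also have "\<dots> \<le> (real n)\<^sup>2 * (\<eta> / 4)" using elim(6) unfolding Y_def by (intro mult_left_mono) auto
        finally have *: "(real (n div m) + 2 ^ card V0 * real (n div m)) * (real bb)\<^sup>2 \<le> (real n)\<^sup>2 * (\<eta> / 4)" .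
        have "(real n)\<^sup>2 / 4 * \<eta> = (real n)\<^sup>2 * (\<eta> / 4)" "(real n)\<^sup>2 / 2 * \<eta> = (real n)\<^sup>2 * (\<eta> / 4) + (real n)\<^sup>2 * (\<eta> / 4)"
          by simp_all
        then show ?thesis using * by linarith
      qed
      show "2 * (a0 * real n) \<le> (real n)\<^sup>2 / 4 * \<eta> * real (t - t1) / (2 * real (n choose 2))"
      proof -
        have N: "2 * real (n choose 2) \<le> (real n)\<^sup>2" "0 < 2 * real (n choose 2)"
          using n by (simp_all add: choose_two_real power2_eq_square)
        have "2 * (a0 * real n) = (real n)\<^sup>2 / 4 * \<eta> * ((c - c') * real n / 4) / (real n)\<^sup>2"
          using n by (simp add: a0_def)
        also have "\<dots> \<le> (real n)\<^sup>2 / 4 * \<eta> * real (t - t1) / (real n)\<^sup>2"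
          using tt eta by (intro divide_right_mono mult_left_mono) auto
        also have "\<dots> \<le> (real n)\<^sup>2 / 4 * \<eta> * real (t - t1) / (2 * real (n choose 2))"
          using N eta by (intro divide_left_mono) auto
        finally show ?thesis .
      qed
    qed
    show ?case unfolding t_def[symmetric] b_def[symmetric] g_def
      using lower nop prob_ord_union[of n ?Q1 ?Q2] P1 P2 by linarith
  qed
  then show ?thesis using g0 by blast
qed

theorem part_giant:
  assumes c: "1 < c" and e: "0 < \<epsilon>"
  shows "whp (\<lambda>n es. \<bar>real (forb P (proc P n es (nat \<lfloor>c * real n / 2\<rfloor>))) / (real n ^ 2 / 2) - (beta c)\<^sup>2\<bar> \<le> \<epsilon>)"
proof -
  let ?f = "\<lambda>n es. real (forb P (proc P n es (nat \<lfloor>c * real n / 2\<rfloor>)))"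
  obtain A where A: "\<forall>\<^sub>F n in sequentially. prob_ord n (\<lambda>es. \<not> ?f n es \<le> (real n)\<^sup>2 / 2 * ((beta c)\<^sup>2 + \<epsilon>)) \<le> A / real n"
    using prob_giant_upper[OF assms] by (rule exE)
  obtain g where g: "g \<longlonglongrightarrow> 0 \<and> (\<forall>\<^sub>F n in sequentially. prob_ord n (\<lambda>es. \<not> (real n)\<^sup>2 / 2 * ((beta c)\<^sup>2 - \<epsilon>) \<le> ?f n es) \<le> g n)"
    using prob_giant_lower[OF assms] by (rule exE)
  show ?thesis
  proof (rule whpI)
    have "(\<lambda>n. A * (1 / real n) + g n) \<longlonglongrightarrow> A * 0 + 0" using g by (intro tendsto_intros lim_1_over_n) simp
    then show "(\<lambda>n. A / real n + g n) \<longlonglongrightarrow> 0" by simp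
    show "\<forall>\<^sub>F n in sequentially. prob_ord n (\<lambda>es. \<not> \<bar>?f n es / (real n ^ 2 / 2) - (beta c)\<^sup>2\<bar> \<le> \<epsilon>) \<le> A / real n + g n"
      using A g[THEN conjunct2] eventually_gt_at_top[of 0]
    proof eventually_elim
      case (elim n)
      have n0: "0 < (real n)\<^sup>2 / 2" using elim(3) by simp
      have "prob_ord n (\<lambda>es. \<not> \<bar>?f n es / (real n ^ 2 / 2) - (beta c)\<^sup>2\<bar> \<le> \<epsilon>) \<le> 
        prob_ord n (\<lambda>es. \<not> ?f n es \<le> (real n)\<^sup>2 / 2 * ((beta c)\<^sup>2 + \<epsilon>) \<or> \<not> (real n)\<^sup>2 / 2 * ((beta c)\<^sup>2 - \<epsilon>) \<le> ?f n es)"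
      proof (rule prob_ord_mono)
        fix es assume *: "\<not> \<bar>?f n es / (real n ^ 2 / 2) - (beta c)\<^sup>2\<bar> \<le> \<epsilon>"
        show "\<not> ?f n es \<le> (real n)\<^sup>2 / 2 * ((beta c)\<^sup>2 + \<epsilon>) \<or> \<not> (real n)\<^sup>2 / 2 * ((beta c)\<^sup>2 - \<epsilon>) \<le> ?f n es"
        proof (rule ccontr)
          assume "\<not> ?thesis"
          then have "?f n es / (real n ^ 2 / 2) \<le> (beta c)\<^sup>2 + \<epsilon>" "(beta c)\<^sup>2 - \<epsilon> \<le> ?f n es / (real n ^ 2 / 2)"
            unfolding pos_divide_le_eq[OF n0] pos_le_divide_eq[OF n0] by (simp_all add: mult.commute)
          then show False using * by linarith
        qed
      qed
      also have "\<dots> \<le> A / real n + g n" using prob_ord_union[of n] elim(1,2) by (meson add_mono order_trans)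
      finally show ?case .
    qed
  qed
qed

end

theorem mainTheorem9:
  fixes P :: "graph set" and h :: "nat \<Rightarrow> real"
  assumes "admissible_class P"
    and "filterlim h at_top sequentially"
  shows
   "(\<forall>(t :: nat \<Rightarrow> nat) (s :: nat \<Rightarrow> real).
       (\<forall>\<^sub>F n in sequentially. 1 \<le> t n \<and> t n \<le> n choose 2 \<and> real (t n) = real n / 2 - s n) \<and>
       filterlim (\<lambda>n. s n / real n powr (2/3)) at_top sequentially
       \<longrightarrow> (\<exists>C>0. whp (\<lambda>n es. real (forb P (proc P n es (t n))) \<le> C * h n * real n ^ 2 / s n)))
  \<and> (\<forall>(t :: nat \<Rightarrow> nat) (s :: nat \<Rightarrow> real).
       (\<forall>\<^sub>F n in sequentially. 1 \<le> t n \<and> t n \<le> n choose 2 \<and> real (t n) = real n / 2 + s n) \<and>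
       s \<in> O(\<lambda>n. real n powr (2/3))
       \<longrightarrow> (\<exists>C>0. whp (\<lambda>n es. real (forb P (proc P n es (t n))) \<le> C * h n * real n powr (4/3))))
  \<and> (\<forall>(t :: nat \<Rightarrow> nat) (s :: nat \<Rightarrow> real).
       (\<forall>\<^sub>F n in sequentially. 1 \<le> t n \<and> t n \<le> n choose 2 \<and> real (t n) = real n / 2 + s n) \<and>
       filterlim (\<lambda>n. s n / real n powr (2/3)) at_top sequentially \<and>
       (\<lambda>n. s n / real n) \<longlonglongrightarrow> 0
       \<longrightarrow> (\<exists>c>0. \<exists>C>0. whp (\<lambda>n es. c * (s n)\<^sup>2 \<le> real (forb P (proc P n es (t n))) \<and>
                                      real (forb P (proc P n es (t n))) \<le> C * (s n)\<^sup>2)))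
  \<and> (\<forall>c :: real. c > 1 \<longrightarrow>
       (\<forall>\<epsilon>>0. whp (\<lambda>n es.
          \<bar>real (forb P (proc P n es (nat \<lfloor>c * real n / 2\<rfloor>))) / (real n ^ 2 / 2) - (beta c)\<^sup>2\<bar> \<le> \<epsilon>)))"
proof -
  interpret constrained_process P by unfold_locales (rule assms(1))
  have "\<exists>C>0. whp (\<lambda>n es. real (forb P (proc P n es (t n))) \<le> C * h n * real n ^ 2 / s n)"
    if "\<forall>\<^sub>F n in sequentially. 1 \<le> t n \<and> t n \<le> n choose 2 \<and> real (t n) = real n / 2 - s n"
      "filterlim (\<lambda>n. s n / real n powr (2/3)) at_top sequentially" for t :: "nat \<Rightarrow> nat" and s :: "nat \<Rightarrow> real"
    using part_subcritical[OF assms(2) that] by (intro exI[of _ 4]) simp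
  moreover note part_critical[OF assms(2)] part_supercritical part_giant
  ultimately show ?thesis by (intro conjI allI impI; (elim conjE)?) simp_all
qed

end
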